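(* Let $p_-:P\to B_-$ and $p_+:P\to B_+$ be cellular maps of finite CW complexes. For the span of cellular chain maps $$C_*(P)\xrightarrow{p_{-\#}}C_*(B_-),\qquad C_*(P)\xrightarrow{p_{+\#}}C_*(B_+),$$ regarded as a diagram $D$, the bar realization admits an integral chain decomposition $$\mathfrak C(D)\cong\operatorname{Cone}(p_{-\#},-p_{+\#})\oplus\bigl(C_*(P)\otimes E_1\bigr).$$ Hence the full bar inventory $\mathcal M_{\mathfrak C(D)}(t)$ exceeds the reduced mapping-cone inventory $\mathcal M_{\operatorname{Cone}(p_{-\#},-p_{+\#})}(t)$ by $$(1+t)\,\mathcal M_P(t).$$ All of this additional inventory consists of unit-labelled pairs (i.e. $C_*(P)\otimes E_1$ is a direct sum of complexes $E_k$).
   Context: All chain complexes are bounded complexes of finitely generated free abelian groups. $\mathcal M_C(t)=\sum_k\operatorname{rank}_{\mathbb Z}(C_k)t^k$, and $\mathcal M_P=\mathcal M_{C_*(P)}$ counts cells of $P$. $E_k$ is the contractible complex $0\leftarrow\mathbb Z e_{k-1}\xleftarrow{\mathrm{id}}\mathbb Z e_k\leftarrow0$ in degrees $k-1,k$. $\operatorname{Cone}(p_{-\#},-p_{+\#})$ is the mapping cone of the chain map $(p_{-\#},-p_{+\#}):C_*(P)\to C_*(B_-)\oplus C_*(B_+)$. The span is a functor $D$ on the finite poset $\mathcal I$ with three objects $0,-,+$ and relations $0<-$, $0<+$, with $D(0)=C_*(P)$, $D(\pm)=C_*(B_\pm)$. The bar realization is $\mathfrak C(D)=\operatorname{Tot}N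 B_\bullet( *,\mathcal I,D)$, where $B_q( *,\mathcal I,D)=\bigoplus_{i_0\to\cdots\to i_q}D(i_0)$ with the standard bar faces (the face $d_0$ omits $i_0$ and applies $D(i_0\to i_1)$; the other faces compose or delete arrows) and degeneracies, $N$ denotes normalization in the simplicial direction and $\operatorname{Tot}$ the total complex. Concretely, in degree $n$ it is $C_n(P)\oplus C_n(B_-)\oplus C_n(B_+)\oplus C_{n-1}(P)\oplus C_{n-1}(P)$, the last two summands being indexed by $0<-$ and $0<+$. *)

theory Defs
  imports "HOL-Homology.Homology" "HOL-Algebra.Weak_Morphisms"
    "HOL-Computational_Algebra.Formal_Laurent_Series"
begin

section \<open>Chain complexes of abelian groups\<close>

text \<open>Complexes are graded by the integers, as the homology groups of the library are;
  \<open>bd C k\<close> goes from degree \<open>k\<close> to degree \<open>k - 1\<close>. Groups are written multiplicatively.\<close>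

record 'a cplx =
  ch :: "int \<Rightarrow> 'a monoid"
  bd :: "int \<Rightarrow> 'a \<Rightarrow> 'a"

definition chain_complex :: "'a cplx \<Rightarrow> bool" where
  "chain_complex C \<longleftrightarrow>
     (\<forall>k. comm_group (ch C k) \<and> bd C k \<in> hom (ch C k) (ch C (k - 1)) \<and>
          (\<forall>x \<in> carrier (ch C k). bd C (k - 1) (bd C k x) = \<one>\<^bsub>ch C (k - 2)\<^esub>))"

definition fg_free :: "('a, 'm) monoid_scheme \<Rightarrow> bool" where
  "fg_free G \<longleftrightarrow> (\<exists>n::nat. G \<cong> free_Abelian_group {..<n})"

definition rank_Z :: "('a, 'm) monoid_scheme \<Rightarrow> nat" where
  "rank_Z G = (THE n::nat. G \<cong> free_Abelian_group {..<n})"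

definition bounded_free_complex :: "'a cplx \<Rightarrow> bool" where
  "bounded_free_complex C \<longleftrightarrow>
     chain_complex C \<and> (\<forall>k. fg_free (ch C k)) \<and> finite {k. \<not> trivial_group (ch C k)}"

text \<open>The generating function of the ranks. It is a Laurent polynomial in \<open>t = fls_X\<close>, since
  the complexes are bounded but their degrees may be negative.\<close>

definition inventory :: "'a cplx \<Rightarrow> int fls" where
  "inventory C = Abs_fls (\<lambda>k. int (rank_Z (ch C k)))"

definition cplx_iso :: "'a cplx \<Rightarrow> 'b cplx \<Rightarrow> bool" where
  "cplx_iso C D \<longleftrightarrow>
     (\<exists>f. \<forall>k. f k \<in> iso (ch C k) (ch D k) \<and>
          (\<forall>x \<in> carrier (ch C k). f (k - 1) (bd C k x) = bd D k (f k x)))"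

definition cplx_sum :: "'a cplx \<Rightarrow> 'b cplx \<Rightarrow> ('a \<times> 'b) cplx" where
  "cplx_sum C D = \<lparr>ch = (\<lambda>k. ch C k \<times>\<times> ch D k), bd = (\<lambda>k (x, y). (bd C k x, bd D k y))\<rparr>"

definition cplx_Sum :: "'i set \<Rightarrow> ('i \<Rightarrow> 'a cplx) \<Rightarrow> ('i \<Rightarrow> 'a) cplx" where
  "cplx_Sum I C = \<lparr>ch = (\<lambda>k. sum_group I (\<lambda>i. ch (C i) k)),
                    bd = (\<lambda>k x. \<lambda>i\<in>I. bd (C i) k (x i))\<rparr>"

text \<open>The mapping cone of \<open>f : C \<rightarrow> D\<close>, with differential
  \<open>(x, y) \<mapsto> (- d x, f x + d y)\<close> on \<open>C (n - 1) \<oplus> D n\<close>.\<close>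

definition mapping_cone :: "'a cplx \<Rightarrow> 'b cplx \<Rightarrow> (int \<Rightarrow> 'a \<Rightarrow> 'b) \<Rightarrow> ('a \<times> 'b) cplx" where
  "mapping_cone C D f =
     \<lparr>ch = (\<lambda>n. ch C (n - 1) \<times>\<times> ch D n),
      bd = (\<lambda>n (x, y). (inv\<^bsub>ch C (n - 2)\<^esub> bd C (n - 1) x,
                        f (n - 1) x \<otimes>\<^bsub>ch D (n - 1)\<^esub> bd D n y))\<rparr>"

definition neg_map :: "'b cplx \<Rightarrow> (int \<Rightarrow> 'a \<Rightarrow> 'b) \<Rightarrow> int \<Rightarrow> 'a \<Rightarrow> 'b" where
  "neg_map D f k x = inv\<^bsub>ch D k\<^esub> f k x"

definition pair_map :: "(int \<Rightarrow> 'a \<Rightarrow> 'b) \<Rightarrow> (int \<Rightarrow> 'a \<Rightarrow> 'c) \<Rightarrow> int \<Rightarrow> 'a \<Rightarrow> 'b \<times> 'c" where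
  "pair_map f g k x = (f k x, g k x)"

text \<open>The map induced on cosets by a homomorphism \<open>f\<close> into \<open>G'\<close> that carries the subgroup
  divided out in the source into \<open>N'\<close>: the coset \<open>N #> x\<close> goes to \<open>N' #> f x\<close>.\<close>

definition coset_map :: "('b, 'm) monoid_scheme \<Rightarrow> 'b set \<Rightarrow> ('a \<Rightarrow> 'b) \<Rightarrow> 'a set \<Rightarrow> 'b set" where
  "coset_map G' N' f X = set_mult G' N' (f ` X)"

section \<open>Tensor products\<close>

definition tensor_relators :: "'a monoid \<Rightarrow> 'b monoid \<Rightarrow> ('a \<times> 'b \<Rightarrow>\<^sub>0 int) set" where
  "tensor_relators A B =
     generate (free_Abelian_group (carrier A \<times> carrier B))
       ({frag_of (a \<otimes>\<^bsub>A\<^esub> a', b) - frag_of (a, b) - frag_of (a', b) | a a' b.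
           a \<in> carrier A \<and> a' \<in> carrier A \<and> b \<in> carrier B} \<union>
        {frag_of (a, b \<otimes>\<^bsub>B\<^esub> b') - frag_of (a, b) - frag_of (a, b') | a b b'.
           a \<in> carrier A \<and> b \<in> carrier B \<and> b' \<in> carrier B})"

definition tensor_group :: "'a monoid \<Rightarrow> 'b monoid \<Rightarrow> ('a \<times> 'b \<Rightarrow>\<^sub>0 int) set monoid" where
  "tensor_group A B = free_Abelian_group (carrier A \<times> carrier B) Mod tensor_relators A B"

definition tensor_map ::
    "'c monoid \<Rightarrow> 'd monoid \<Rightarrow> ('a \<Rightarrow> 'c) \<Rightarrow> ('b \<Rightarrow> 'd) \<Rightarrow>
     ('a \<times> 'b \<Rightarrow>\<^sub>0 int) set \<Rightarrow> ('c \<times> 'd \<Rightarrow>\<^sub>0 int) set" where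
  "tensor_map A' B' f g =
     coset_map (free_Abelian_group (carrier A' \<times> carrier B')) (tensor_relators A' B')
       (frag_extend (\<lambda>(a, b). frag_of (f a, g b)))"

text \<open>The differential is \<open>d (x \<otimes> y) = d x \<otimes> y + (-1)\<^sup>i x \<otimes> d y\<close> for \<open>x\<close> of degree \<open>i\<close>; the
  component of index \<open>i\<close> of an element of degree \<open>n\<close> lies in \<open>C i \<otimes> E (n - i)\<close>.\<close>

definition cplx_tensor :: "'a cplx \<Rightarrow> 'b cplx \<Rightarrow> (int \<Rightarrow> ('a \<times> 'b \<Rightarrow>\<^sub>0 int) set) cplx" where
  "cplx_tensor C E =
     \<lparr>ch = (\<lambda>n. sum_group UNIV (\<lambda>i. tensor_group (ch C i) (ch E (n - i)))),
      bd = (\<lambda>n x i.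
        let A = ch C i; B = ch E (n - 1 - i); G = tensor_group A B in
          tensor_map A B (bd C (i + 1)) id (x (i + 1)) \<otimes>\<^bsub>G\<^esub>
          tensor_map A B id (bd E (n - i)) (x i) [^]\<^bsub>G\<^esub> (if even i then 1 else - 1 :: int))\<rparr>"

definition elementary_cplx :: "int \<Rightarrow> int cplx" where
  "elementary_cplx k =
     \<lparr>ch = (\<lambda>n. if n = k - 1 \<or> n = k then integer_group else singleton_group 0),
      bd = (\<lambda>n. if n = k then id else (\<lambda>_. 0))\<rparr>"

section \<open>The bar realization of a diagram on a finite poset\<close>

record ('i, 'a) diagram =
  ob :: "'i \<Rightarrow> 'a cplx"
  mor :: "'i \<Rightarrow> 'i \<Rightarrow> int \<Rightarrow> 'a \<Rightarrow> 'a"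

text \<open>A string \<open>i_0 \<le> \<dots> \<le> i_q\<close> of \<open>q\<close> composable arrows, identities allowed, is the list of its objects.\<close>

definition bar_index :: "nat \<Rightarrow> 'i::{order,finite} list set" where
  "bar_index q = {c. length c = Suc q \<and> sorted_wrt (\<le>) c}"

definition omit :: "nat \<Rightarrow> 'i list \<Rightarrow> 'i list" where
  "omit j c = take j c @ drop (Suc j) c"

definition repeat :: "nat \<Rightarrow> 'i list \<Rightarrow> 'i list" where
  "repeat j c = take (Suc j) c @ drop j c"

definition bar_group :: "('i::{order,finite}, 'a) diagram \<Rightarrow> nat \<Rightarrow> int \<Rightarrow> ('i list \<Rightarrow> 'a) monoid" where
  "bar_group D q n = sum_group (bar_index q) (\<lambda>c. ch (ob D (hd c)) n)"

text \<open>The face \<open>d_j\<close> from simplicial degree \<open>Suc q\<close> to \<open>q\<close> and the degeneracy \<open>s_j\<close> from \<open>q\<close> to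
  \<open>Suc q\<close>. The summand of a string \<open>c\<close> is sent to the one of \<open>omit j c\<close> or \<open>repeat j c\<close>, so that a
  component of the image collects all summands with the same target.\<close>

definition bar_face ::
    "('i::{order,finite}, 'a) diagram \<Rightarrow> nat \<Rightarrow> int \<Rightarrow> nat \<Rightarrow> ('i list \<Rightarrow> 'a) \<Rightarrow> 'i list \<Rightarrow> 'a" where
  "bar_face D q n j x =
     (\<lambda>c\<in>bar_index q. finprod (ch (ob D (hd c)) n)
        (\<lambda>b. if j = 0 then mor D (b ! 0) (b ! 1) n (x b) else x b)
        {b \<in> bar_index (Suc q). omit j b = c})"

definition bar_degen ::
    "('i::{order,finite}, 'a) diagram \<Rightarrow> nat \<Rightarrow> int \<Rightarrow> nat \<Rightarrow> ('i list \<Rightarrow> 'a) \<Rightarrow> 'i list \<Rightarrow> 'a" where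
  "bar_degen D q n j x =
     (\<lambda>c\<in>bar_index (Suc q). finprod (ch (ob D (hd c)) n) x {b \<in> bar_index q. repeat j b = c})"

definition bar_face_sum ::
    "('i::{order,finite}, 'a) diagram \<Rightarrow> nat \<Rightarrow> int \<Rightarrow> ('i list \<Rightarrow> 'a) \<Rightarrow> 'i list \<Rightarrow> 'a" where
  "bar_face_sum D q n x =
     finprod (bar_group D q n)
       (\<lambda>j. bar_face D q n j x [^]\<^bsub>bar_group D q n\<^esub> ((- 1) ^ j :: int)) {..Suc q}"

definition bar_internal ::
    "('i::{order,finite}, 'a) diagram \<Rightarrow> nat \<Rightarrow> int \<Rightarrow> ('i list \<Rightarrow> 'a) \<Rightarrow> 'i list \<Rightarrow> 'a" where
  "bar_internal D q n x = (\<lambda>c\<in>bar_index q. bd (ob D (hd c)) n (x c))"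

text \<open>Normalization is the quotient by the subgroup spanned by the degenerate elements.\<close>

definition bar_degenerate :: "('i::{order,finite}, 'a) diagram \<Rightarrow> nat \<Rightarrow> int \<Rightarrow> ('i list \<Rightarrow> 'a) set" where
  "bar_degenerate D q n =
     generate (bar_group D q n)
       {bar_degen D p n j x | p j x. q = Suc p \<and> j \<le> p \<and> x \<in> carrier (bar_group D p n)}"

definition norm_bar_group :: "('i::{order,finite}, 'a) diagram \<Rightarrow> nat \<Rightarrow> int \<Rightarrow> ('i list \<Rightarrow> 'a) set monoid" where
  "norm_bar_group D q n = bar_group D q n Mod bar_degenerate D q n"

text \<open>The total complex, with differential \<open>\<Sum>\<^sub>j (-1)\<^sup>j d_j + (-1)\<^sup>q d\<close> in simplicial degree \<open>q\<close>; the
  component of index \<open>q\<close> of an element of degree \<open>m\<close> has internal degree \<open>m - q\<close>.\<close>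

definition bar_realization :: "('i::{order,finite}, 'a) diagram \<Rightarrow> (nat \<Rightarrow> ('i list \<Rightarrow> 'a) set) cplx" where
  "bar_realization D =
     \<lparr>ch = (\<lambda>m. sum_group UNIV (\<lambda>q. norm_bar_group D q (m - int q))),
      bd = (\<lambda>m x q.
        let n = m - 1 - int q; N = norm_bar_group D q n in
          coset_map (bar_group D q n) (bar_degenerate D q n) (bar_face_sum D q n) (x (Suc q)) \<otimes>\<^bsub>N\<^esub>
          coset_map (bar_group D q n) (bar_degenerate D q n) (bar_internal D q (m - int q)) (x q)
            [^]\<^bsub>N\<^esub> ((- 1) ^ q :: int))\<rparr>"

subsection \<open>Spans\<close>

datatype span_obj = Apex | Minus | Plus

instantiation span_obj :: "{order, finite}"
begin

definition less_eq_span_obj :: "span_obj \<Rightarrow> span_obj \<Rightarrow> bool" where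
  "i \<le> j \<longleftrightarrow> i = j \<or> i = Apex"

definition less_span_obj :: "span_obj \<Rightarrow> span_obj \<Rightarrow> bool" where
  "i < j \<longleftrightarrow> i = Apex \<and> j \<noteq> Apex"

instance
proof
  have "(UNIV :: span_obj set) = {Apex, Minus, Plus}"
    using span_obj.exhaust by auto
  then show "finite (UNIV :: span_obj set)"
    by (metis finite.emptyI finite.insertI)
qed (auto simp: less_eq_span_obj_def less_span_obj_def)

end

text \<open>The three complexes of a span have different element types. They are transported along
  the injections into the sum type to form a diagram with values in a single type.\<close>

definition embed_cplx :: "('a \<Rightarrow> 'b) \<Rightarrow> 'a cplx \<Rightarrow> 'b cplx" where
  "embed_cplx \<iota> C = \<lparr>ch = (\<lambda>k. image_group \<iota> (ch C k)),
                      bd = (\<lambda>k. \<iota> \<circ> bd C k \<circ> inv_into (carrier (ch C k)) \<iota>)\<rparr>"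

definition span_diagram ::
    "'a cplx \<Rightarrow> 'b cplx \<Rightarrow> 'c cplx \<Rightarrow> (int \<Rightarrow> 'a \<Rightarrow> 'b) \<Rightarrow> (int \<Rightarrow> 'a \<Rightarrow> 'c) \<Rightarrow>
     (span_obj, 'a + 'b + 'c) diagram" where
  "span_diagram A B C f g =
     \<lparr>ob = (\<lambda>i. case i of Apex \<Rightarrow> embed_cplx Inl A
                        | Minus \<Rightarrow> embed_cplx (Inr \<circ> Inl) B
                        | Plus \<Rightarrow> embed_cplx (Inr \<circ> Inr) C),
      mor = (\<lambda>i j k. case (i, j) of (Apex, Minus) \<Rightarrow> Inr \<circ> Inl \<circ> f k \<circ> projl
                                  | (Apex, Plus) \<Rightarrow> Inr \<circ> Inr \<circ> g k \<circ> projl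
                                  | _ \<Rightarrow> id)\<rparr>"

section \<open>Finite CW complexes and cellular chains\<close>

text \<open>A cell is recorded as its dimension together with the open cell as a subset of the space.\<close>

record 'a cell_complex =
  space_of :: "'a topology"
  cells :: "(nat \<times> 'a set) set"

text \<open>The skeleton is indexed by an integer; it is empty in negative degrees.\<close>

definition skeleton :: "'a cell_complex \<Rightarrow> int \<Rightarrow> 'a set" where
  "skeleton X k = \<Union> {e. \<exists>n. (n, e) \<in> cells X \<and> int n \<le> k}"

definition closed_disc :: "nat \<Rightarrow> (nat \<Rightarrow> real) topology" where
  "closed_disc n = subtopology (Euclidean_space n) {x. (\<Sum>i<n. (x i)\<^sup>2) \<le> 1}"

definition open_disc :: "nat \<Rightarrow> (nat \<Rightarrow> real) topology" where
  "open_disc n = subtopology (Euclidean_space n) {x. (\<Sum>i<n. (x i)\<^sup>2) < 1}"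

definition characteristic_map ::
    "'a cell_complex \<Rightarrow> nat \<Rightarrow> 'a set \<Rightarrow> ((nat \<Rightarrow> real) \<Rightarrow> 'a) \<Rightarrow> bool" where
  "characteristic_map X n e \<Phi> \<longleftrightarrow>
     continuous_map (closed_disc n) (space_of X) \<Phi> \<and>
     homeomorphic_map (open_disc n) (subtopology (space_of X) e) \<Phi> \<and>
     \<Phi> ` (topspace (closed_disc n) - topspace (open_disc n)) \<subseteq> skeleton X (int n - 1)"

text \<open>With finitely many cells, closure-finiteness is vacuous, and the weak topology condition
  follows because the space is the union of finitely many closed cells.\<close>

definition finite_CW :: "'a cell_complex \<Rightarrow> bool" where
  "finite_CW X \<longleftrightarrow>
     Hausdorff_space (space_of X) \<and> finite (cells X) \<and>
     topspace (space_of X) = \<Union> (snd ` cells X) \<and>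
     pairwise (\<lambda>c c'. disjnt (snd c) (snd c')) (cells X) \<and>
     (\<forall>(n, e) \<in> cells X. \<exists>\<Phi>. characteristic_map X n e \<Phi>)"

definition cellular_map :: "'a cell_complex \<Rightarrow> 'b cell_complex \<Rightarrow> ('a \<Rightarrow> 'b) \<Rightarrow> bool" where
  "cellular_map X Y f \<longleftrightarrow>
     continuous_map (space_of X) (space_of Y) f \<and> (\<forall>k. f ` skeleton X k \<subseteq> skeleton Y k)"

text \<open>The cellular chain group is \<open>H_k (X\<^sup>k, X\<^sup>k\<^sup>-\<^sup>1)\<close>, with the connecting homomorphism of the triple
  \<open>(X\<^sup>k, X\<^sup>k\<^sup>-\<^sup>1, X\<^sup>k\<^sup>-\<^sup>2)\<close> as boundary.\<close>

definition cellular_chains :: "'a cell_complex \<Rightarrow> 'a chain set cplx" where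
  "cellular_chains X =
     \<lparr>ch = (\<lambda>k. relative_homology_group k (subtopology (space_of X) (skeleton X k)) (skeleton X (k - 1))),
      bd = (\<lambda>k. hom_relboundary k (subtopology (space_of X) (skeleton X k))
                   (skeleton X (k - 1)) (skeleton X (k - 2)))\<rparr>"

definition cellular_chain_map ::
    "'a cell_complex \<Rightarrow> 'b cell_complex \<Rightarrow> ('a \<Rightarrow> 'b) \<Rightarrow> int \<Rightarrow> 'a chain set \<Rightarrow> 'b chain set" where
  "cellular_chain_map X Y f k =
     hom_induced k (subtopology (space_of X) (skeleton X k)) (skeleton X (k - 1))
       (subtopology (space_of Y) (skeleton Y k)) (skeleton Y (k - 1)) f"

definition cell_inventory :: "'a cell_complex \<Rightarrow> int fls" where
  "cell_inventory X = (\<Sum>(n, e) \<in> cells X. fls_X ^ n)"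

end

theory Submission
  imports Defs
begin

text \<open>The theorem has a topological and an algebraic half.

Topologically, the group \<open>H_k (X\<^sup>k, X\<^sup>k\<^sup>-\<^sup>1)\<close> of a finite CW complex is free with one generator for each
\<open>k\<close>-cell. For one cell attached to a closed set \<open>B\<close>, a radial stretching of the cell deforms everything
outside a smaller concentric disc into \<open>B\<close>; then \<open>B\<close> can be excised, and what remains is a pair
that depends only on the dimension (\<open>relative_homology_attach_cell\<close>). The disc is itself a cell
attached to its boundary sphere, so the relative homology is that of disc modulo sphere, which
the homology of spheres determines. Several cells are attached one after another:
the exact sequence of a triple degenerates to a short exact sequence whose quotient is infinite
cyclic, and it splits (\<open>relative_homology_attach_cells\<close>).

Algebraically, a string of composable arrows in the poset \<open>0 < -, 0 < +\<close> has no repeated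
object only if it is one of the three objects or one of the two arrows. The degenerate elements are precisely
those that vanish on these five strings (\<open>bar_degenerate_eq\<close>), so the normalized bar complex of a
span is in degree \<open>n\<close> the group \<open>A_n + B_n + C_n + A_(n-1) + A_(n-1)\<close>, with boundary
\<open>(a, b, c, u, v) \<mapsto> (d a - u - v, d b + f u, d c + g v, - d u, - d v)\<close> (\<open>span_total_bar_realization\<close>). The pair
\<open>(u, (b, c + g a))\<close> is then a chain map onto the cone of \<open>(f, - g)\<close>: adding \<open>g a\<close> turns the term \<open>g v\<close>
of the boundary into \<open>- g u\<close>. The
remaining coordinates can be chosen as \<open>a\<close> and the first component of its own boundary, \<open>d a - u - v\<close>. In these
coordinates the boundary merely shifts: \<open>(y, z) \<mapsto> (z, 0)\<close> (\<open>span_total_decomposition\<close>).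

The complex \<open>A_n + A_(n-1)\<close> with the shift as boundary, called the path complex of \<open>A\<close> here, is
isomorphic to \<open>A \<otimes> E_1\<close> (\<open>cplx_tensor_elementary_path\<close>), since tensoring with the
integers changes nothing and \<open>(y, z)\<close> can be replaced by \<open>(y, d y \<plusminus> z)\<close>. Bases of the groups \<open>A_j\<close> decompose it into copies of
\<open>E_(j+1)\<close> (\<open>path_cplx_elementary\<close>), and its ranks are those of \<open>(1 + t)\<close> times the inventory of \<open>A\<close>.\<close>

section \<open>Radial stretching of discs\<close>
definition radius :: "nat \<Rightarrow> (nat \<Rightarrow> real) \<Rightarrow> real" where
  "radius n x = sqrt (\<Sum>i<n. (x i)\<^sup>2)"

text \<open>At time \<open>0\<close> this is the identity of the unit disc. At time \<open>1\<close> it doubles the radius and stops at the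
sphere, so that all points of radius at least \<open>1 / 2\<close> arrive on the sphere.\<close>
definition radial_push :: "nat \<Rightarrow> real \<Rightarrow> (nat \<Rightarrow> real) \<Rightarrow> nat \<Rightarrow> real" where
  "radial_push n t x = (\<lambda>i. (1 + t) * x i / max 1 ((1 + t) * radius n x))"

lemma radius_nonneg: "0 \<le> radius n x"
  by (simp add: radius_def sum_nonneg)

lemma closed_disc_eq: "closed_disc n = top_of_set {x. (\<forall>i\<ge>n. x i = 0) \<and> radius n x \<le> 1}"
  by (auto simp: closed_disc_def Euclidean_space_def euclidean_product_topology subtopology_subtopology
      radius_def intro!: arg_cong [where f = top_of_set])

lemma topspace_closed_disc: "topspace (closed_disc n) = {x. (\<forall>i\<ge>n. x i = 0) \<and> radius n x \<le> 1}"
  by (simp add: closed_disc_eq)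

lemma open_disc_eq: "open_disc n = top_of_set {x. (\<forall>i\<ge>n. x i = 0) \<and> radius n x < 1}"
  by (auto simp: open_disc_def Euclidean_space_def euclidean_product_topology subtopology_subtopology
      radius_def intro!: arg_cong [where f = top_of_set])

lemma topspace_open_disc: "topspace (open_disc n) = {x. (\<forall>i\<ge>n. x i = 0) \<and> radius n x < 1}"
  by (simp add: open_disc_eq)

lemma open_disc_subset: "topspace (open_disc n) \<subseteq> topspace (closed_disc n)"
  by (auto simp: topspace_open_disc topspace_closed_disc)

lemma open_disc_subtopology: "subtopology (closed_disc n) (topspace (open_disc n)) = open_disc n"
  by (auto simp: topspace_open_disc closed_disc_eq open_disc_eq subtopology_subtopology
      intro!: arg_cong [where f = top_of_set])

lemma continuous_on_radius: "continuous_on S (radius n)"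
  unfolding radius_def
  by (intro continuous_intros continuous_on_product_coordinates[THEN continuous_on_subset]) auto

lemma component_le_radius:
  assumes "i < n" shows "\<bar>x i\<bar> \<le> radius n x"
proof -
  have "(x i)\<^sup>2 \<le> (\<Sum>i<n. (x i)\<^sup>2)"
    using assms by (intro member_le_sum) auto
  then have "sqrt ((x i)\<^sup>2) \<le> radius n x"
    unfolding radius_def by (rule real_sqrt_le_mono)
  then show ?thesis by simp
qed

text \<open>The disc is a closed subset of the cube \<open>[-1, 1]\<^sup>\<nat>\<close>, which is compact by Tychonoff's theorem.\<close>
lemma compact_space_closed_disc: "compact_space (closed_disc n)"
proof -
  let ?D = "{x. (\<forall>i\<ge>n. x i = 0) \<and> radius n x \<le> 1}"
  have "compactin (powertop_real UNIV) (\<Pi>\<^sub>E i\<in>UNIV. {-1..1})"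
    by (simp add: compactin_PiE)
  then have "compact (\<Pi>\<^sub>E i\<in>(UNIV::nat set). {-1..1::real})"
    by (simp add: euclidean_product_topology)
  moreover have "closed ?D"
  proof -
    have "closedin (Euclidean_space n) {x \<in> topspace (Euclidean_space n). radius n x \<in> {..1}}"
      by (rule closedin_continuous_map_preimage[where Y = euclideanreal])
         (simp_all add: continuous_map_Euclidean_space_iff continuous_on_radius)
    then have "closed {x \<in> topspace (Euclidean_space n). radius n x \<in> {..1}}"
      by (rule closedin_Euclidean_imp_closed)
    then show ?thesis
      by (simp add: topspace_Euclidean_space)
  qed
  moreover have "?D \<subseteq> (\<Pi>\<^sub>E i\<in>UNIV. {-1..1})"
  proof
    fix x assume x: "x \<in> ?D"
    have "\<bar>x i\<bar> \<le> 1" for i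
      using x component_le_radius[of i n x] by (cases "i < n") auto
    then show "x \<in> (\<Pi>\<^sub>E i\<in>UNIV. {-1..1})"
      by (auto simp: abs_le_iff intro: minus_le_iff[THEN iffD1])
  qed
  ultimately have "compact ?D"
    using compact_Int_closed[of "\<Pi>\<^sub>E i\<in>(UNIV::nat set). {-1..1::real}" ?D] by (simp add: Int_absorb1 Int_commute)
  then show ?thesis
    by (simp add: closed_disc_eq compact_space_subtopology)
qed

lemma radius_scale: "radius n (\<lambda>i. c * x i) = \<bar>c\<bar> * radius n x"
  by (simp add: radius_def power_mult_distrib real_sqrt_mult flip: sum_distrib_left)

lemma radius_radial_push:
  assumes "0 \<le> t"
  shows "radius n (radial_push n t x) = min 1 ((1 + t) * radius n x)"
proof -
  let ?c = "(1 + t) / max 1 ((1 + t) * radius n x)"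
  have "radial_push n t x = (\<lambda>i. ?c * x i)"
    by (auto simp: radial_push_def)
  then have "radius n (radial_push n t x) = \<bar>?c\<bar> * radius n x"
    by (simp only: radius_scale)
  also have "\<bar>?c\<bar> = ?c"
    using assms by simp
  also have "?c * radius n x = min 1 ((1 + t) * radius n x)"
    by (auto simp: max_def min_def)
  finally show ?thesis .
qed

lemma radial_push_0:
  assumes "radius n x \<le> 1" shows "radial_push n 0 x = x"
  using assms by (auto simp: radial_push_def max_def)

lemma radial_push_sphere:
  assumes "radius n x = 1" "0 \<le> t" shows "radial_push n t x = x"
  using assms by (auto simp: radial_push_def max_def)

lemma radial_push_in_closed_disc:
  assumes "x \<in> topspace (closed_disc n)" "0 \<le> t"
  shows "radial_push n t x \<in> topspace (closed_disc n)"
  using assms by (auto simp: topspace_closed_disc radius_radial_push) (simp add: radial_push_def)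

lemma continuous_map_radial_push:
  "continuous_map (prod_topology (top_of_set {0..1}) (closed_disc n)) (closed_disc n)
     (\<lambda>(t, x). radial_push n t x)"
proof -
  let ?D = "topspace (closed_disc n)"
  have c: "continuous_on S (\<lambda>p. snd p i)" for S :: "(real \<times> (nat \<Rightarrow> real)) set" and i
    using continuous_on_compose2[OF continuous_on_product_coordinates[of i] continuous_on_snd[OF continuous_on_id]]
    by auto
  have r: "continuous_on S (\<lambda>p. radius n (snd p))" for S :: "(real \<times> (nat \<Rightarrow> real)) set"
    using continuous_on_compose2[OF continuous_on_radius[of UNIV n] continuous_on_snd[OF continuous_on_id]]
    by auto
  have "continuous_on ({0..1} \<times> ?D) (\<lambda>(t, x). radial_push n t x)"
    unfolding case_prod_unfold radial_push_def
    by (rule continuous_on_coordinatewise_then_product) (intro continuous_intros c r, auto)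
  moreover have "(\<lambda>(t, x). radial_push n t x) \<in> {0..1} \<times> ?D \<rightarrow> ?D"
    using radial_push_in_closed_disc[of _ n] by auto
  ultimately show ?thesis
    by (simp add: closed_disc_eq)
qed

section \<open>Attaching one cell\<close>
definition outer_shell :: "nat \<Rightarrow> (nat \<Rightarrow> real) set" where
  "outer_shell n = {x \<in> topspace (open_disc n). 1 / 2 < radius n x}"

text \<open>The space \<open>X\<close> consists of a closed base \<open>B\<close> and one open \<open>n\<close>-cell \<open>e\<close>. Besides the steps of a
CW complex, the closed disc with its boundary sphere as base is an instance; the relative homology of a
cell is found by comparing the two.\<close>
locale cell_attachment =
  fixes X :: "'a topology" and B e :: "'a set" and n :: nat and \<Phi> :: "(nat \<Rightarrow> real) \<Rightarrow> 'a"
  assumes Hausdorff: "Hausdorff_space X"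
    and closed_base: "closedin X B"
    and topspace_eq: "topspace X = B \<union> e"
    and disjoint: "disjnt B e"
    and cont: "continuous_map (closed_disc n) X \<Phi>"
    and homeo: "homeomorphic_map (open_disc n) (subtopology X e) \<Phi>"
    and boundary: "\<Phi> ` (topspace (closed_disc n) - topspace (open_disc n)) \<subseteq> B"
begin

abbreviation disc where "disc \<equiv> topspace (closed_disc n)"
abbreviation odisc where "odisc \<equiv> topspace (open_disc n)"

definition core :: "'a set" where "core = \<Phi> ` {x \<in> disc. radius n x \<le> 1 / 2}"

definition chart :: "'a \<Rightarrow> nat \<Rightarrow> real" where "chart = inv_into odisc \<Phi>"

text \<open>Radial stretching inside the cell, with the base kept fixed. The two clauses agree where they meet because
stretching fixes the boundary sphere.\<close>
definition push :: "real \<Rightarrow> 'a \<Rightarrow> 'a" where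
  "push t x = (if x \<in> B then x else \<Phi> (radial_push n t (chart x)))"

lemma image_open_disc: "\<Phi> ` odisc = e"
  using homeomorphic_imp_surjective_map[OF homeo] topspace_eq by auto

lemma inj_open_disc: "inj_on \<Phi> odisc"
  using homeomorphic_imp_injective_map[OF homeo] .

lemma chart_cell: "x \<in> e \<Longrightarrow> chart x \<in> odisc" and cell_chart: "x \<in> e \<Longrightarrow> \<Phi> (chart x) = x"
  unfolding chart_def by (simp_all add: inv_into_into f_inv_into_f image_open_disc)

lemma chart_param: "y \<in> odisc \<Longrightarrow> chart (\<Phi> y) = y"
  unfolding chart_def by (simp add: inj_open_disc)

lemma param_in_cell: "y \<in> odisc \<Longrightarrow> \<Phi> y \<in> e"
  using image_open_disc by blast

lemma param_in_base_iff: "y \<in> disc \<Longrightarrow> \<Phi> y \<in> B \<longleftrightarrow> y \<notin> odisc"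
  using boundary disjoint param_in_cell by (auto simp: disjnt_def)

lemma disc_boundary_iff: "y \<in> disc \<Longrightarrow> y \<notin> odisc \<longleftrightarrow> radius n y = 1"
  by (auto simp: topspace_closed_disc topspace_open_disc)

lemma push_param:
  assumes "y \<in> disc" "0 \<le> t"
  shows "push t (\<Phi> y) = \<Phi> (radial_push n t y)"
  using assms param_in_base_iff[of y] disc_boundary_iff[of y]
  by (auto simp: push_def chart_param radial_push_sphere)

lemma param_in_space: "y \<in> disc \<Longrightarrow> \<Phi> y \<in> topspace X"
  using cont by (auto simp: continuous_map_def)

lemma push_in_space:
  assumes "x \<in> topspace X" "0 \<le> t" shows "push t x \<in> topspace X"
proof (cases "x \<in> B")
  case False
  then have "x \<in> e" using assms topspace_eq by auto
  then show ?thesis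
    using False assms open_disc_subset[of n]
    by (auto simp: push_def intro!: param_in_space radial_push_in_closed_disc dest: chart_cell)
qed (use assms in \<open>simp add: push_def\<close>)

text \<open>The preimage of a closed set \<open>C\<close> has two parts. The part over the base is \<open>[0, 1] \<times> (B \<inter> C)\<close>. The
part over the closed cell is the image, under the characteristic map, of a closed and hence compact subset of
\<open>[0, 1] \<times> D\<^sup>n\<close>; it is closed because \<open>X\<close> is a Hausdorff space.\<close>
lemma continuous_map_push:
  "continuous_map (prod_topology (top_of_set {0..1}) X) X (\<lambda>(t, x). push t x)"
  unfolding continuous_map_closedin
proof (intro conjI allI impI)
  let ?I = "top_of_set {0..1::real}"
  show "(\<lambda>(t, x). push t x) \<in> topspace (prod_topology ?I X) \<rightarrow> topspace X"
    by (auto intro: push_in_space)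
  fix C assume C: "closedin X C"
  let ?T = "{p \<in> topspace (prod_topology ?I (closed_disc n)). (case p of (t, y) \<Rightarrow> \<Phi> (radial_push n t y)) \<in> C}"
  let ?J = "\<lambda>p. (fst p, \<Phi> (snd p))"
  have "continuous_map (prod_topology ?I (closed_disc n)) X (\<lambda>(t, y). \<Phi> (radial_push n t y))"
    using continuous_map_compose[OF continuous_map_radial_push cont]
    by (simp add: comp_def case_prod_unfold)
  then have "closedin (prod_topology ?I (closed_disc n)) ?T"
    using C by (rule closedin_continuous_map_preimage)
  moreover have "compact_space (prod_topology ?I (closed_disc n))"
    by (simp add: compact_space_prod_topology compact_space_closed_disc compact_space_subtopology)
  ultimately have "compactin (prod_topology ?I (closed_disc n)) ?T"
    by (simp add: closedin_compact_space)
  moreover have "continuous_map (prod_topology ?I (closed_disc n)) (prod_topology ?I X) ?J"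
    by (auto simp: continuous_map_pairwise comp_def continuous_map_fst
        intro!: continuous_map_compose[OF continuous_map_snd cont, unfolded comp_def])
  ultimately have "compactin (prod_topology ?I X) (?J ` ?T)"
    by (rule image_compactin)
  then have "closedin (prod_topology ?I X) (?J ` ?T)"
    by (intro compactin_imp_closedin) (auto simp: Hausdorff_space_prod_topology Hausdorff Hausdorff_space_subtopology)
  moreover have "closedin (prod_topology ?I X) ({0..1} \<times> (B \<inter> C))"
    using C closed_base by (auto simp: closedin_prod_Times_iff)
  moreover have "{p \<in> topspace (prod_topology ?I X). (case p of (t, x) \<Rightarrow> push t x) \<in> C}
      = {0..1} \<times> (B \<inter> C) \<union> ?J ` ?T" (is "?L = ?R")
  proof
    show "?L \<subseteq> ?R"
    proof
      fix p assume p: "p \<in> ?L"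
      obtain t x where px: "p = (t, x)" by (cases p)
      with p have t: "0 \<le> t" "t \<le> 1" and x: "x \<in> topspace X" "push t x \<in> C"
        by auto
      show "p \<in> ?R"
      proof (cases "x \<in> B")
        case True
        then show ?thesis using px t x by (simp add: push_def)
      next
        case False
        then have "x \<in> e" using x topspace_eq by auto
        then have "p = ?J (t, chart x)" "(t, chart x) \<in> ?T"
          using chart_cell[of x] cell_chart[of x] x t px open_disc_subset[of n] False
          by (auto simp: push_def)
        then have "p \<in> ?J ` ?T" by (rule image_eqI)
        then show ?thesis ..
      qed
    qed
    show "?R \<subseteq> ?L"
      using closedin_subset[OF closed_base]
      by (auto simp: push_param param_in_space) (auto simp: push_def)
  qed
  ultimately show "closedin (prod_topology ?I X) {p \<in> topspace (prod_topology ?I X). (case p of (t, x) \<Rightarrow> push t x) \<in> C}"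
    by (simp add: closedin_Un)
qed

lemma push_base: "x \<in> B \<Longrightarrow> push t x = x"
  by (simp add: push_def)

lemma push_0: "x \<in> topspace X \<Longrightarrow> push 0 x = x"
  using chart_cell[of x] cell_chart[of x] topspace_eq open_disc_subset[of n]
  by (auto simp: push_def radial_push_0 topspace_open_disc)

lemma core_iff: "y \<in> disc \<Longrightarrow> \<Phi> y \<in> core \<longleftrightarrow> radius n y \<le> 1 / 2"
proof
  assume y: "y \<in> disc" and "\<Phi> y \<in> core"
  then obtain z where z: "z \<in> disc" "radius n z \<le> 1 / 2" "\<Phi> y = \<Phi> z"
    by (auto simp: core_def)
  then have zo: "z \<in> odisc" by (auto simp: topspace_closed_disc topspace_open_disc)
  then have "\<Phi> y \<notin> B" using z param_in_base_iff by metis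
  then have "y \<in> odisc" using y param_in_base_iff by blast
  then have "y = z" using z zo inj_open_disc by (meson inj_onD)
  then show "radius n y \<le> 1 / 2" using z by simp
qed (auto simp: core_def)

lemma core_subset: "core \<subseteq> e"
  by (auto simp: core_def topspace_closed_disc topspace_open_disc intro!: param_in_cell)

lemma closedin_core: "closedin X core"
proof -
  have "closedin (closed_disc n) {x \<in> disc. radius n x \<in> {..1/2}}"
    by (rule closedin_continuous_map_preimage[where Y = euclideanreal])
       (auto simp: closed_disc_eq continuous_on_radius)
  then have "compactin (closed_disc n) {x \<in> disc. radius n x \<le> 1 / 2}"
    by (simp add: closedin_compact_space compact_space_closed_disc)
  then show ?thesis
    unfolding core_def using cont Hausdorff by (blast intro: image_compactin compactin_imp_closedin)
qed

text \<open>Stretching does not decrease the radius, so that the complement of the core is invariant, and a radius greater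
than \<open>1 / 2\<close> has grown to \<open>1\<close> at the end.\<close>
lemma push_avoids_core:
  assumes "x \<in> topspace X - core" "0 \<le> t"
  shows "push t x \<in> topspace X - core" and "t = 1 \<Longrightarrow> push t x \<in> B"
proof -
  have "push t x \<in> topspace X - core \<and> (t = 1 \<longrightarrow> push t x \<in> B)"
  proof (cases "x \<in> B")
    case True
    then show ?thesis using assms by (simp add: push_base)
  next
    case False
    then have x: "x \<in> e" using assms topspace_eq by auto
    let ?y = "chart x"
    have y: "?y \<in> disc" "\<Phi> ?y = x"
      using chart_cell[OF x] cell_chart[OF x] open_disc_subset[of n] by auto
    then have r: "radius n ?y > 1 / 2"
      using core_iff[of ?y] assms by auto
    have p: "push t x = \<Phi> (radial_push n t ?y)" using False by (simp add: push_def)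
    have d: "radial_push n t ?y \<in> disc" using y assms radial_push_in_closed_disc by blast
    have "1 * radius n ?y \<le> (1 + t) * radius n ?y"
      using assms r by (intro mult_right_mono) auto
    then have "radius n (radial_push n t ?y) > 1 / 2"
      using r unfolding radius_radial_push[OF assms(2)] by linarith
    moreover have "t = 1 \<Longrightarrow> radius n (radial_push n t ?y) = 1"
      using r by (auto simp: radius_radial_push)
    ultimately show ?thesis
      using p d core_iff[OF d] param_in_space[OF d] param_in_base_iff[OF d] disc_boundary_iff[OF d] by auto
  qed
  then show "push t x \<in> topspace X - core" and "t = 1 \<Longrightarrow> push t x \<in> B" by auto
qed

lemma continuous_map_push_at: "0 \<le> t \<Longrightarrow> t \<le> 1 \<Longrightarrow> continuous_map X X (push t)"
  using continuous_map_compose[OF _ continuous_map_push, of X "\<lambda>x. (t, x)"]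
  by (auto simp: continuous_map_pairwise comp_def)

lemma homotopic_push:
  assumes "S \<subseteq> topspace X" "\<And>t x. 0 \<le> t \<Longrightarrow> t \<le> 1 \<Longrightarrow> x \<in> S \<Longrightarrow> push t x \<in> S"
  shows "homotopic_with (\<lambda>h. h \<in> S \<rightarrow> S) X X (push 1) id"
proof -
  have "homotopic_with (\<lambda>h. h \<in> S \<rightarrow> S) X X (push 0) (push 1)"
    unfolding homotopic_with_def
    by (rule exI[of _ "\<lambda>(t, x). push t x"]) (auto simp: continuous_map_push assms)
  then have "homotopic_with (\<lambda>h. h \<in> S \<rightarrow> S) X X (push 1) (push 0)"
    by (simp add: homotopic_with_symD)
  then show ?thesis
    by (rule homotopic_with_eq) (use assms(1) in \<open>auto simp: push_0 subset_iff Pi_iff\<close>)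
qed

text \<open>The inclusion of pairs has the stretching map at time \<open>1\<close> as homotopy inverse, and the stretching homotopy
respects both subspaces. Enlarging \<open>B\<close> to a neighbourhood in this way makes excision applicable.\<close>
lemma relative_homology_minus_core:
  "relative_homology_group p X B \<cong> relative_homology_group p X (topspace X - core)"
proof (rule homotopy_equivalent_space_imp_isomorphic_relative_homology_groups[where f = id and g = "push 1"])
  have sub: "B \<subseteq> topspace X" using topspace_eq by blast
  show "id \<in> B \<rightarrow> topspace X - core"
    using sub core_subset disjoint by (auto simp: disjnt_def)
  show "push 1 \<in> topspace X - core \<rightarrow> B"
    by (auto intro: push_avoids_core(2))
  show "homotopic_with (\<lambda>h. h \<in> B \<rightarrow> B) X X (push 1 \<circ> id) id"
    using homotopic_push[OF sub] by (simp add: push_base)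
  show "homotopic_with (\<lambda>k. k \<in> (topspace X - core) \<rightarrow> (topspace X - core)) X X (id \<circ> push 1) id"
    using homotopic_push[of "topspace X - core"] push_avoids_core(1) by auto
qed (simp_all add: continuous_map_push_at)

lemma relative_homology_excise_base:
  "relative_homology_group p (subtopology X e) (e - core) \<cong> relative_homology_group p X (topspace X - core)"
proof -
  have "openin X (topspace X - core)"
    using closedin_core by (simp add: openin_diff)
  then have "X closure_of B \<subseteq> (X interior_of (topspace X - core))"
    using closed_base core_subset disjoint topspace_eq
    by (auto simp: closure_of_closedin interior_of_openin disjnt_def)
  from homology_excision_axiom[OF this Diff_subset, of p]
  have "relative_homology_group p (subtopology X (topspace X - B)) (topspace X - core - B)
      \<cong> relative_homology_group p (subtopology X (topspace X)) (topspace X - core)"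
    by (rule is_isoI)
  moreover have "topspace X - B = e" "topspace X - core - B = e - core"
    using disjoint topspace_eq by (auto simp: disjnt_def)
  ultimately show ?thesis by simp
qed

text \<open>The characteristic map need not be injective on the sphere, but only the open cell is left after the
excision.\<close>
lemma relative_homology_cell:
  "relative_homology_group p (open_disc n) (outer_shell n) \<cong> relative_homology_group p (subtopology X e) (e - core)"
proof -
  have "\<Phi> ` outer_shell n = e - core"
    using core_iff open_disc_subset[of n]
    by (auto simp: outer_shell_def subset_iff simp flip: image_open_disc)
  then show ?thesis
    using homeomorphic_map_relative_homology_iso[OF homeo, of "outer_shell n" "e - core" p]
    by (auto simp: outer_shell_def is_iso_def)
qed

text \<open>The pair on the right involves neither the space nor the characteristic map, only the dimension of the cell.\<close>
proposition relative_homology_attach_cell: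
  "relative_homology_group p X B \<cong> relative_homology_group p (open_disc n) (outer_shell n)"
  using relative_homology_minus_core[of p] relative_homology_excise_base[of p] relative_homology_cell[of p]
  by (meson group.iso_sym group_relative_homology_group iso_trans)

end

lemma cell_attachment_closed_disc:
  "cell_attachment (closed_disc n) (topspace (closed_disc n) - topspace (open_disc n)) (topspace (open_disc n)) n id"
proof
  have "openin (closed_disc n) {x \<in> topspace (closed_disc n). radius n x \<in> {..<1}}"
    by (rule openin_continuous_map_preimage[where Y = euclideanreal])
       (auto simp: closed_disc_eq continuous_on_radius)
  moreover have "{x \<in> topspace (closed_disc n). radius n x \<in> {..<1}} = topspace (open_disc n)"
    by (auto simp: topspace_closed_disc topspace_open_disc)
  ultimately show "closedin (closed_disc n) (topspace (closed_disc n) - topspace (open_disc n))"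
    by (simp add: closedin_diff)
  show "homeomorphic_map (open_disc n) (subtopology (closed_disc n) (topspace (open_disc n))) id"
    by (simp add: open_disc_subtopology)
qed (use open_disc_subset[of n] in \<open>auto simp: disjnt_def closed_disc_eq Hausdorff_space_subtopology\<close>)

lemma contractible_closed_disc: "contractible_space (closed_disc n)"
proof -
  let ?h = "\<lambda>(t, x) i. (1 - t) * x i :: real"
  have c: "continuous_on S (\<lambda>p. snd p i)" for S :: "(real \<times> (nat \<Rightarrow> real)) set" and i
    using continuous_on_compose2[OF continuous_on_product_coordinates[of i] continuous_on_snd[OF continuous_on_id]]
    by auto
  have "continuous_on ({0..1} \<times> topspace (closed_disc n)) ?h"
    unfolding case_prod_unfold
    by (rule continuous_on_coordinatewise_then_product) (intro continuous_intros c)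
  moreover have "?h \<in> {0..1} \<times> topspace (closed_disc n) \<rightarrow> topspace (closed_disc n)"
    using mult_le_one[of "1 - t" "radius n x" for t x]
    by (auto simp: topspace_closed_disc radius_scale radius_nonneg)
  ultimately have "continuous_map (prod_topology (top_of_set {0..1}) (closed_disc n)) (closed_disc n) ?h"
    by (simp add: closed_disc_eq)
  then have "homotopic_with (\<lambda>x. True) (closed_disc n) (closed_disc n) id (\<lambda>x i. 0)"
    unfolding homotopic_with_def by (intro exI[of _ ?h]) auto
  then show ?thesis
    unfolding contractible_space_def by blast
qed

lemma closed_disc_boundary_sphere:
  "subtopology (closed_disc (Suc n)) (topspace (closed_disc (Suc n)) - topspace (open_disc (Suc n))) = nsphere n"
proof -
  have "{x. (\<forall>i\<ge>Suc n. x i = 0) \<and> radius (Suc n) x \<le> 1} \<inter>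
      (topspace (closed_disc (Suc n)) - topspace (open_disc (Suc n)))
      = {x. (\<Sum>i\<le>n. (x i)\<^sup>2) = 1 \<and> (\<forall>i>n. x i = 0)}"
    by (auto simp: topspace_closed_disc topspace_open_disc radius_def Suc_le_eq lessThan_Suc_atMost not_less)
  then show ?thesis
    by (simp add: closed_disc_eq nsphere subtopology_subtopology euclidean_product_topology)
qed

text \<open>For \<open>n > 0\<close> contractibility of the disc identifies the group with the reduced homology of the sphere one degree lower.
For \<open>n = 0\<close> the boundary is empty and the disc is a point.\<close>
lemma relative_homology_disc_boundary:
  fixes p :: int and n :: nat
  defines "H \<equiv> relative_homology_group p (closed_disc n) (topspace (closed_disc n) - topspace (open_disc n))"
  shows "p = int n \<Longrightarrow> H \<cong> integer_group" and "p \<noteq> int n \<Longrightarrow> trivial_group H"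
proof -
  have "(p = int n \<longrightarrow> H \<cong> integer_group) \<and> (p \<noteq> int n \<longrightarrow> trivial_group H)"
  proof (cases n)
    case 0
    have r: "radius 0 x = 0" for x by (simp add: radius_def)
    have "topspace (closed_disc 0) - topspace (open_disc 0) = {}"
      by (auto simp: topspace_closed_disc topspace_open_disc r)
    moreover have "topspace (closed_disc 0) = {\<lambda>i. 0}"
      by (auto simp: topspace_closed_disc r)
    ultimately show ?thesis
      using homology_coefficients homology_dimension_axiom 0 unfolding H_def by (metis of_nat_0)
  next
    case (Suc m)
    have "topspace (nsphere m) \<noteq> {}"
      using in_topspace_nsphere by blast
    then have "topspace (closed_disc n) \<inter> (topspace (closed_disc n) - topspace (open_disc n)) \<noteq> {}"
      unfolding Suc closed_disc_boundary_sphere[symmetric] topspace_subtopology .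
    from isomorphic_group_relative_homology_of_contractible[OF contractible_closed_disc this]
    have iso: "H \<cong> reduced_homology_group (p - 1) (nsphere m)"
      unfolding H_def by (simp add: Suc closed_disc_boundary_sphere)
    show ?thesis
    proof (intro conjI impI)
      assume "p = int n"
      then show "H \<cong> integer_group"
        using iso reduced_homology_group_nsphere(1)[of m] Suc by (metis (no_types) add_diff_cancel_left' iso_trans of_nat_Suc)
    next
      assume "p \<noteq> int n"
      then have "trivial_group (reduced_homology_group (p - 1) (nsphere m))"
        using Suc by (intro reduced_homology_group_nsphere(2)) auto
      then show "trivial_group H"
        using iso H_def group_relative_homology_group isomorphic_group_triviality group_reduced_homology_group by metis
    qed
  qed
  then show "p = int n \<Longrightarrow> H \<cong> integer_group" and "p \<noteq> int n \<Longrightarrow> trivial_group H" by auto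
qed

context cell_attachment
begin

text \<open>A disc is a cell attached to its boundary, so that both attachments have the same local model.\<close>
lemma relative_homology_cell_attachment:
  shows "relative_homology_group (int n) X B \<cong> integer_group"
    and "p \<noteq> int n \<Longrightarrow> trivial_group (relative_homology_group p X B)"
proof -
  interpret D: cell_attachment "closed_disc n" "topspace (closed_disc n) - topspace (open_disc n)"
    "topspace (open_disc n)" n id
    by (rule cell_attachment_closed_disc)
  have iso: "relative_homology_group p X B
      \<cong> relative_homology_group p (closed_disc n) (topspace (closed_disc n) - topspace (open_disc n))" for p
    using relative_homology_attach_cell[of p] D.relative_homology_attach_cell[of p]
    by (meson group.iso_sym group_relative_homology_group iso_trans)
  show "relative_homology_group (int n) X B \<cong> integer_group"
    using iso_trans[OF iso relative_homology_disc_boundary(1)] by simp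
  show "trivial_group (relative_homology_group p X B)" if "p \<noteq> int n"
    using relative_homology_disc_boundary(2)[OF that] iso isomorphic_group_triviality group_relative_homology_group
    by metis
qed

end

section \<open>Splitting off free quotients\<close>
lemma DirProd_free_Abelian_group:
  assumes "disjnt S T"
  shows "free_Abelian_group S \<times>\<times> free_Abelian_group T \<cong> free_Abelian_group (S \<union> T)"
proof -
  let ?h = "\<lambda>(x, y). x + y :: 'a \<Rightarrow>\<^sub>0 int"
  have "?h \<in> hom (free_Abelian_group S \<times>\<times> free_Abelian_group T) (free_Abelian_group (S \<union> T))"
    by (rule homI) (auto simp: algebra_simps dest!: subsetD[OF keys_add])
  moreover have "inj_on ?h (carrier (free_Abelian_group S \<times>\<times> free_Abelian_group T))"
  proof (rule inj_onI, clarsimp)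
    fix a b a' b' :: "'a \<Rightarrow>\<^sub>0 int"
    assume k: "Poly_Mapping.keys a \<subseteq> S" "Poly_Mapping.keys b \<subseteq> T" "Poly_Mapping.keys a' \<subseteq> S"
      "Poly_Mapping.keys b' \<subseteq> T" and eq: "a + b = a' + b'"
    have e: "a - a' = b' - b" using eq by (simp add: algebra_simps)
    have "Poly_Mapping.keys (a - a') \<subseteq> S" using k keys_diff[of a a'] by blast
    moreover have "Poly_Mapping.keys (a - a') \<subseteq> T" using k keys_diff[of b' b] unfolding e by blast
    ultimately have "Poly_Mapping.keys (a - a') \<subseteq> {}"
      using assms unfolding disjnt_def by (metis Int_subset_iff)
    then have "a - a' = 0" by (simp only: subset_empty keys_eq_empty)
    then show "a = a' \<and> b = b'" using e by simp
  qed
  moreover have "x \<in> ?h ` carrier (free_Abelian_group S \<times>\<times> free_Abelian_group T)"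
    if "Poly_Mapping.keys x \<subseteq> S \<union> T" for x
    using that
  proof (rule free_Abelian_group_induct)
    show "0 \<in> ?h ` carrier (free_Abelian_group S \<times>\<times> free_Abelian_group T)"
      by (rule image_eqI[of _ _ "(0, 0)"]) auto
  next
    fix x y
    assume "x \<in> ?h ` carrier (free_Abelian_group S \<times>\<times> free_Abelian_group T)"
      "y \<in> ?h ` carrier (free_Abelian_group S \<times>\<times> free_Abelian_group T)"
    then obtain a b a' b' where "x = a + b" "y = a' + b'" "Poly_Mapping.keys a \<subseteq> S" "Poly_Mapping.keys b \<subseteq> T"
      "Poly_Mapping.keys a' \<subseteq> S" "Poly_Mapping.keys b' \<subseteq> T" by auto
    then show "x - y \<in> ?h ` carrier (free_Abelian_group S \<times>\<times> free_Abelian_group T)"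
      using keys_diff[of a a'] keys_diff[of b b']
      by (intro image_eqI[of _ _ "(a - a', b - b')"]) auto
  next
    fix a assume "a \<in> S \<union> T"
    then show "frag_of a \<in> ?h ` carrier (free_Abelian_group S \<times>\<times> free_Abelian_group T)"
      using image_eqI[of "frag_of a" ?h "(frag_of a, 0)"] image_eqI[of "frag_of a" ?h "(0, frag_of a)"]
      by (cases "a \<in> S") auto
  qed
  ultimately have "?h \<in> iso (free_Abelian_group S \<times>\<times> free_Abelian_group T) (free_Abelian_group (S \<union> T))"
    by (auto simp: iso_iff hom_def Pi_iff)
  then show ?thesis by (rule is_isoI)
qed

lemma trivial_free_Abelian_group_empty: "trivial_group (free_Abelian_group {})"
proof -
  have "carrier (free_Abelian_group {}) = {0}" by (auto simp: free_Abelian_group_def)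
  then show ?thesis by (simp add: trivial_group_def)
qed

lemma trivial_groups_isomorphic:
  assumes "trivial_group G" "trivial_group H" shows "G \<cong> H"
proof (rule is_isoI)
  show "(\<lambda>_. \<one>\<^bsub>H\<^esub>) \<in> iso G H"
    using assms by (auto simp: trivial_group_def iso_iff hom_def group.is_monoid)
qed

lemma free_Abelian_group_card:
  "finite S \<Longrightarrow> card S = n \<Longrightarrow> free_Abelian_group S \<cong> free_Abelian_group {..<n::nat}"
  by (simp add: isomorphic_free_Abelian_groups eqpoll_def finite_same_card_bij)

lemma DirProd_free_rank:
  assumes "G \<cong> free_Abelian_group {..<m::nat}" "H \<cong> free_Abelian_group {..<n::nat}"
    and "group G" "group H"
  shows "G \<times>\<times> H \<cong> free_Abelian_group {..<m + n}"
proof -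
  have "H \<cong> free_Abelian_group {m..<m + n}"
    by (rule iso_trans[OF assms(2) group.iso_sym[OF _ free_Abelian_group_card]]) simp_all
  then have "G \<times>\<times> H \<cong> free_Abelian_group {..<m} \<times>\<times> free_Abelian_group {m..<m + n}"
    using assms by (simp add: group.DirProd_iso_trans)
  also have "\<dots> \<cong> free_Abelian_group ({..<m} \<union> {m..<m + n})"
    by (rule DirProd_free_Abelian_group) (auto simp: disjnt_def)
  also have "{..<m} \<union> {m..<m + n} = {..<m + n}" by auto
  finally show ?thesis .
qed

text \<open>Basis elements of the free quotient are lifted to the middle group; the universal property turns the lifts
into a section.\<close>
lemma short_exact_sequence_free_splits:
  assumes ex: "short_exact_sequence C B A g f" and B: "comm_group B"
    and C: "C \<cong> free_Abelian_group S"
  shows "B \<cong> A \<times>\<times> C"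
proof -
  interpret B: comm_group B by fact
  have grp: "group A" "group C" and gf: "exact_seq ([C, B, A], [g, f])" "g \<in> epi B C"
    using short_exact_sequenceD[OF ex] by (auto simp: group_hom_def)
  have ghom: "g \<in> hom B C" using gf by (simp add: epi_def)
  obtain k l where kl: "group_isomorphisms C (free_Abelian_group S) l k"
    using C group.iso_iff_group_isomorphisms[OF grp(2)] unfolding is_iso_def by blast
  then have k: "k \<in> hom (free_Abelian_group S) C" and l: "l \<in> hom C (free_Abelian_group S)"
    and kl: "\<And>x. x \<in> carrier C \<Longrightarrow> k (l x) = x"
    by (auto simp: group_isomorphisms_def)
  have "\<exists>b \<in> carrier B. g b = k (frag_of s)" if "s \<in> S" for s
  proof -
    have "k (frag_of s) \<in> carrier C" using hom_in_carrier[OF k] that by simp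
    also have "carrier C = g ` carrier B" using gf(2) by (simp add: epi_def)
    finally show ?thesis by force
  qed
  then obtain b where b: "\<And>s. s \<in> S \<Longrightarrow> b s \<in> carrier B \<and> g (b s) = k (frag_of s)" by metis
  then obtain h where h: "h \<in> hom (free_Abelian_group S) B" "\<And>s. s \<in> S \<Longrightarrow> h (frag_of s) = b s"
    using B.free_Abelian_group_universal[of b S] by blast
  interpret h: group_hom "free_Abelian_group S" B h
    using h B.group_axioms by (simp add: group_hom_def group_hom_axioms_def)
  interpret k: group_hom "free_Abelian_group S" C k
    using k grp by (simp add: group_hom_def group_hom_axioms_def)
  interpret g: group_hom B C g
    using ghom B.group_axioms grp by (simp add: group_hom_def group_hom_axioms_def)
  have gh: "g (h x) = k x" if "Poly_Mapping.keys x \<subseteq> S" for x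
    using that
  proof (rule free_Abelian_group_induct)
    show "g (h 0) = k 0" using h.hom_one k.hom_one by simp
  next
    fix x y assume 2: "Poly_Mapping.keys x \<subseteq> S" "Poly_Mapping.keys y \<subseteq> S" "g (h x) = k x" "g (h y) = k y"
    have "x - y = x \<otimes>\<^bsub>free_Abelian_group S\<^esub> inv\<^bsub>free_Abelian_group S\<^esub> y"
      using 2 by simp
    then show "g (h (x - y)) = k (x - y)" using 2
      by (metis (no_types, lifting) h.hom_mult h.hom_inv k.hom_mult k.hom_inv g.hom_mult g.hom_inv h.hom_closed
        carrier_free_Abelian_group_iff B.inv_closed group.inv_closed[OF group_free_Abelian_group])
  next
    fix a assume "a \<in> S"
    then show "g (h (frag_of a)) = k (frag_of a)" using b h by simp
  qed
  have "g ((h \<circ> l) z) = z" if "z \<in> carrier C" for z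
    using gh[of "l z"] kl[OF that] hom_in_carrier[OF l that] by simp
  moreover have "h \<circ> l \<in> hom C B" using l h(1) by (rule hom_compose)
  ultimately obtain H K where HK: "H \<lhd> B" "subgroup K B" "H \<inter> K \<subseteq> {\<one>\<^bsub>B\<^esub>}" "set_mult B H K = carrier B"
    "f \<in> iso A (subgroup_generated B H)" "g \<in> iso (subgroup_generated B K) C"
    using splitting_lemma_right[OF ex] by metis
  then have "group_disjoint_sum B H K"
    by (simp add: group_disjoint_sum_def normal_imp_subgroup B.group_axioms)
  from group_disjoint_sum.iso_group_mul[OF this B]
  have "(\<lambda>(x, y). x \<otimes>\<^bsub>B\<^esub> y) \<in> iso (subgroup_generated B H \<times>\<times> subgroup_generated B K) B"
    using HK by blast
  then have "subgroup_generated B H \<times>\<times> subgroup_generated B K \<cong> B" by (rule is_isoI)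
  moreover have "A \<times>\<times> C \<cong> subgroup_generated B H \<times>\<times> subgroup_generated B K"
    by (intro group.DirProd_iso_trans grp is_isoI[OF HK(5)] group.iso_sym[OF B.group_subgroup_generated] is_isoI[OF HK(6)])
  ultimately have "A \<times>\<times> C \<cong> B" by (rule iso_trans[rotated])
  then show ?thesis by (rule group.iso_sym[OF DirProd_group[OF grp]])
qed

section \<open>Attaching finitely many cells of one dimension\<close>

text \<open>In the exact sequence of the triple \<open>(X, B, A)\<close> the groups \<open>H_(n+1) (X, B)\<close> and \<open>H_(n-1) (B, A)\<close>
vanish. Hence \<open>0 \<rightarrow> H_n (B, A) \<rightarrow> H_n (X, A) \<rightarrow> H_n (X, B) \<rightarrow> 0\<close> is exact, and its quotient is infinite cyclic.\<close>
lemma (in cell_attachment) relative_homology_attach_cell_rank: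
  assumes sub: "A \<subseteq> B"
    and free: "relative_homology_group (int n) (subtopology X B) A \<cong> free_Abelian_group {..<r::nat}"
    and triv: "\<And>p. p \<noteq> int n \<Longrightarrow> trivial_group (relative_homology_group p (subtopology X B) A)"
  shows "relative_homology_group (int n) X A \<cong> free_Abelian_group {..<Suc r}"
    and "\<And>p. p \<noteq> int n \<Longrightarrow> trivial_group (relative_homology_group p X A)"
proof -
  note t1 = homology_exactness_triple_1[of A B _ X, OF sub]
   and t2 = homology_exactness_triple_2[of A B _ X, OF sub]
   and t3 = homology_exactness_triple_3[of A B _ X, OF sub]
  show "trivial_group (relative_homology_group p X A)" if p: "p \<noteq> int n" for p
  proof -
    have "hom_induced p (subtopology X B) A X A id ` carrier (relative_homology_group p (subtopology X B) A)
        = kernel (relative_homology_group p X A) (relative_homology_group p X B) (hom_induced p X A X B id)"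
      using t3[of p] by simp
    moreover have "kernel (relative_homology_group p X A) (relative_homology_group p X B) (hom_induced p X A X B id)
        = carrier (relative_homology_group p X A)"
      using relative_homology_cell_attachment(2)[OF p]
      by (intro group_hom.kernel_to_trivial_group) (auto simp: group_hom_def group_hom_axioms_def hom_induced_hom)
    moreover have "hom_induced p (subtopology X B) A X A id ` carrier (relative_homology_group p (subtopology X B) A)
        = {\<one>\<^bsub>relative_homology_group p X A\<^esub>}"
      using triv[OF p]
      by (intro group_hom.image_from_trivial_group) (auto simp: group_hom_def group_hom_axioms_def hom_induced_hom)
    ultimately show ?thesis by (simp add: trivial_group_def)
  qed
  show "relative_homology_group (int n) X A \<cong> free_Abelian_group {..<Suc (r)}"
  proof -
    let ?i = "hom_induced (int n) (subtopology X B) A X A id" and ?j = "hom_induced (int n) X A X B id"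
    let ?GB = "relative_homology_group (int n) (subtopology X B) A"
      and ?GX = "relative_homology_group (int n) X A"
      and ?GY = "relative_homology_group (int n) X B"
    \<comment> \<open>The connecting map out of \<open>H_n (X, B)\<close> ends in the trivial group \<open>H_(n-1) (B, A)\<close>.\<close>
    have "?j ` carrier ?GX = kernel ?GY (relative_homology_group (int n - 1) (subtopology X B) A)
        (hom_relboundary (int n) X B A)"
      using t1[of "int n"] by simp
    also have "\<dots> = carrier ?GY"
      using triv[of "int n - 1"] group_homomorphism_hom_relboundary[of "int n" X B A]
      by (intro group_hom.kernel_to_trivial_group) (auto simp: group_hom_def group_hom_axioms_def)
    finally have epi: "?j \<in> epi ?GX ?GY" by (simp add: epi_def hom_induced_hom)
    have "hom_relboundary (int n + 1) X B A ` carrier (relative_homology_group (int n + 1) X B) = kernel ?GB ?GX ?i"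
      using t2[of "int n + 1"] by simp
    moreover have "hom_relboundary (int n + 1) X B A ` carrier (relative_homology_group (int n + 1) X B) = {\<one>\<^bsub>?GB\<^esub>}"
      using relative_homology_cell_attachment(2)[of "int n + 1"] group_homomorphism_hom_relboundary[of "int n + 1" X B A]
      by (intro group_hom.image_from_trivial_group) (auto simp: group_hom_def group_hom_axioms_def)
    ultimately have "kernel ?GB ?GX ?i = {\<one>\<^bsub>?GB\<^esub>}" by simp
    then have mon: "?i \<in> mon ?GB ?GX"
      using group_hom.inj_iff_trivial_ker[of ?GB ?GX ?i] by (simp add: mon_def hom_induced_hom group_hom_def group_hom_axioms_def)
    have ses: "short_exact_sequence ?GY ?GX ?GB ?j ?i"
      unfolding short_exact_sequence_iff using epi mon t3 by blast
    have Z: "?GY \<cong> free_Abelian_group {..<Suc 0}"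
      using relative_homology_cell_attachment(1) isomorphic_group_integer_free_Abelian_group_singleton[of "0::nat"]
      by (simp add: lessThan_Suc) (metis iso_trans)
    have "?GX \<cong> ?GB \<times>\<times> ?GY"
      by (rule short_exact_sequence_free_splits[OF ses _ Z]) simp
    also have "\<dots> \<cong> free_Abelian_group {..<r + Suc 0}"
      using free Z by (rule DirProd_free_rank) simp_all
    finally show ?thesis by simp
  qed
qed

text \<open>The cells are attached one by one. The vanishing in the other degrees has to be carried through
the induction, because it is what makes the exact sequence of the triple short.\<close>
lemma relative_homology_attach_cells:
  fixes X :: "'a topology" and k :: nat
  assumes "Hausdorff_space X" "closedin X A" "finite F"
    and char: "\<And>e. e \<in> F \<Longrightarrow> \<exists>\<Phi>. continuous_map (closed_disc k) X \<Phi> \<and>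
           homeomorphic_map (open_disc k) (subtopology X e) \<Phi> \<and>
           \<Phi> ` (topspace (closed_disc k) - topspace (open_disc k)) \<subseteq> A"
    and sub: "\<And>e. e \<in> F \<Longrightarrow> e \<subseteq> topspace X \<and> disjnt A e"
    and disj: "pairwise disjnt F"
  shows "closedin X (A \<union> \<Union>F) \<and>
     relative_homology_group (int k) (subtopology X (A \<union> \<Union>F)) A \<cong> free_Abelian_group {..<card F} \<and>
     (\<forall>p. p \<noteq> int k \<longrightarrow> trivial_group (relative_homology_group p (subtopology X (A \<union> \<Union>F)) A))"
  using \<open>finite F\<close> char sub disj
proof (induction F rule: finite_induct)
  case empty
  have "trivial_group (relative_homology_group p (subtopology X A) A)" for p
    using trivial_relative_homology_group_topspace[of p "subtopology X A"] closedin_subset[OF assms(2)]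
    by (simp add: Int_absorb1)
  then show ?case
    using assms(2) by (simp add: trivial_groups_isomorphic trivial_free_Abelian_group_empty)
next
  case (insert e F)
  let ?B = "A \<union> \<Union>F" and ?Y = "A \<union> \<Union>(insert e F)"
  have IH: "closedin X ?B" "relative_homology_group (int k) (subtopology X ?B) A \<cong> free_Abelian_group {..<card F}"
    "\<And>p. p \<noteq> int k \<Longrightarrow> trivial_group (relative_homology_group p (subtopology X ?B) A)"
    using insert by (auto simp: pairwise_insert)
  obtain \<Phi> where \<Phi>: "continuous_map (closed_disc k) X \<Phi>" "homeomorphic_map (open_disc k) (subtopology X e) \<Phi>"
    "\<Phi> ` (topspace (closed_disc k) - topspace (open_disc k)) \<subseteq> A"
    using insert.prems(1)[of e] by auto
  have e: "e \<subseteq> topspace X" "disjnt A e" using insert.prems(2)[of e] by auto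
  have dj: "disjnt ?B e"
    using e insert.prems(3) insert.hyps(2) by (auto simp: pairwise_insert disjnt_def)
  have im: "\<Phi> ` topspace (open_disc k) = e"
    using homeomorphic_imp_surjective_map[OF \<Phi>(2)] e by auto
  have imD: "\<Phi> ` topspace (closed_disc k) \<subseteq> A \<union> e" "e \<subseteq> \<Phi> ` topspace (closed_disc k)"
    using im \<Phi>(3) open_disc_subset[of k] by auto
  have "closedin X (\<Phi> ` topspace (closed_disc k))"
    using image_compactin[OF _ \<Phi>(1)] compact_space_closed_disc[of k] assms(1)
    by (auto simp: compact_space_def intro: compactin_imp_closedin)
  then have "closedin X (?B \<union> \<Phi> ` topspace (closed_disc k))" using IH by auto
  moreover have "?B \<union> \<Phi> ` topspace (closed_disc k) = ?Y" using imD by auto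
  ultimately have clY: "closedin X ?Y" by simp
  interpret cell_attachment "subtopology X ?Y" ?B e k \<Phi>
  proof
    show "closedin (subtopology X ?Y) ?B"
      using IH(1) by (auto intro: closedin_subset_topspace)
    show "topspace (subtopology X ?Y) = ?B \<union> e"
      using closedin_subset[OF clY] by auto
    show "continuous_map (closed_disc k) (subtopology X ?Y) \<Phi>"
      using \<Phi>(1) imD by (auto simp: continuous_map_in_subtopology)
    have "?Y \<inter> e = e" by auto
    then show "homeomorphic_map (open_disc k) (subtopology (subtopology X ?Y) e) \<Phi>"
      using \<Phi>(2) by (simp add: subtopology_subtopology)
  qed (use dj \<Phi>(3) assms(1) in \<open>auto simp: Hausdorff_space_subtopology\<close>)
  have BY: "subtopology (subtopology X ?Y) ?B = subtopology X ?B"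
    by (auto simp: subtopology_subtopology intro!: arg_cong[where f = "subtopology X"])
  have "relative_homology_group (int k) (subtopology X ?Y) A \<cong> free_Abelian_group {..<Suc (card F)}"
    by (rule relative_homology_attach_cell_rank(1)[of A]) (use IH in \<open>simp_all only: BY Un_upper1\<close>)
  moreover have "trivial_group (relative_homology_group p (subtopology X ?Y) A)" if "p \<noteq> int k" for p
    by (rule relative_homology_attach_cell_rank(2)[of A "card F", OF _ _ _ that]) (use IH in \<open>simp_all only: BY Un_upper1\<close>)
  ultimately show ?case
    using clY insert.hyps by simp
qed

section \<open>Cellular chains\<close>

lemma finite_CW_cell:
  assumes "finite_CW X" "(n, e) \<in> cells X"
  obtains \<Phi> where "characteristic_map X n e \<Phi>" and "e \<subseteq> topspace (space_of X)"
    and "\<Phi> ` topspace (open_disc n) = e"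
proof -
  obtain \<Phi> where \<Phi>: "characteristic_map X n e \<Phi>"
    using assms by (fastforce simp: finite_CW_def)
  have e: "e \<subseteq> topspace (space_of X)"
    using assms by (fastforce simp: finite_CW_def)
  moreover have "\<Phi> ` topspace (open_disc n) = e"
    using \<Phi> e homeomorphic_imp_surjective_map[of "open_disc n" "subtopology (space_of X) e" \<Phi>]
    by (auto simp: characteristic_map_def)
  ultimately show ?thesis using that \<Phi> by blast
qed

lemma skeleton_mono: "k \<le> l \<Longrightarrow> skeleton X k \<subseteq> skeleton X l"
  by (auto simp: skeleton_def) (meson order_trans)

text \<open>A skeleton is a finite union of closed cells, which are compact and hence closed in a Hausdorff space.\<close>
lemma closedin_skeleton:
  assumes X: "finite_CW X"
  shows "closedin (space_of X) (skeleton X k)"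
proof -
  let ?I = "{c \<in> cells X. int (fst c) \<le> k}"
  have "\<exists>K. closedin (space_of X) K \<and> snd c \<subseteq> K \<and> K \<subseteq> skeleton X k" if "c \<in> ?I" for c
  proof -
    obtain n e where c: "c = (n, e)" by (cases c)
    with that have "(n, e) \<in> cells X" by simp
    then obtain \<Phi> where \<Phi>: "characteristic_map X n e \<Phi>" "\<Phi> ` topspace (open_disc n) = e"
      using finite_CW_cell[OF X] by metis
    let ?K = "\<Phi> ` topspace (closed_disc n)"
    have "compactin (space_of X) ?K"
      using \<Phi>(1) compact_space_closed_disc[of n] by (auto simp: characteristic_map_def compact_space_def intro: image_compactin)
    then have "closedin (space_of X) ?K"
      using X by (auto simp: finite_CW_def intro: compactin_imp_closedin)
    moreover have "e \<subseteq> ?K" using \<Phi>(2) open_disc_subset[of n] by blast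
    moreover have "?K \<subseteq> e \<union> skeleton X (int n - 1)"
      using \<Phi> by (auto simp: characteristic_map_def)
    moreover have "e \<subseteq> skeleton X k" "skeleton X (int n - 1) \<subseteq> skeleton X k"
      using that c skeleton_mono[of "int n - 1" k X] by (auto simp: skeleton_def)
    ultimately show ?thesis using c by (intro exI[of _ ?K]) auto
  qed
  then have "\<exists>K. \<forall>c\<in>?I. closedin (space_of X) (K c) \<and> snd c \<subseteq> K c \<and> K c \<subseteq> skeleton X k"
    by (intro bchoice) blast
  then obtain K where K: "\<And>c. c \<in> ?I \<Longrightarrow> closedin (space_of X) (K c)"
    "\<And>c. c \<in> ?I \<Longrightarrow> snd c \<subseteq> K c" "\<And>c. c \<in> ?I \<Longrightarrow> K c \<subseteq> skeleton X k"
    by blast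
  have "{e. \<exists>n. (n, e) \<in> cells X \<and> int n \<le> k} = snd ` ?I"
  proof (intro equalityI subsetI)
    fix e assume "e \<in> {e. \<exists>n. (n, e) \<in> cells X \<and> int n \<le> k}"
    then obtain n where "(n, e) \<in> ?I" by auto
    then show "e \<in> snd ` ?I" by (rule image_eqI[rotated]) simp
  qed auto
  then have "skeleton X k = \<Union> (snd ` ?I)"
    by (simp add: skeleton_def)
  then have "skeleton X k \<subseteq> \<Union> (K ` ?I)"
    using UN_mono[of ?I ?I snd K] K(2) by simp
  moreover have "\<Union> (K ` ?I) \<subseteq> skeleton X k"
    by (rule UN_least) (rule K(3))
  ultimately have "skeleton X k = \<Union> (K ` ?I)" by (rule equalityI)
  moreover have "closedin (space_of X) (\<Union> (K ` ?I))"
  proof (rule closedin_Union)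
    have "finite (cells X)" using X unfolding finite_CW_def by blast
    then show "finite (K ` ?I)" by simp
    show "closedin (space_of X) C" if "C \<in> K ` ?I" for C
      using K(1) that by blast
  qed
  ultimately show ?thesis by simp
qed

definition cell_count :: "'a cell_complex \<Rightarrow> int \<Rightarrow> nat" where
  "cell_count X k = card {e. \<exists>n. (n, e) \<in> cells X \<and> int n = k}"

lemma cellular_chains_rank:
  assumes X: "finite_CW X"
  shows "ch (cellular_chains X) k \<cong> free_Abelian_group {..<cell_count X k}"
proof (cases "k < 0")
  case True
  then have "{e. \<exists>n. (n, e) \<in> cells X \<and> int n = k} = {}" by auto
  then have "cell_count X k = 0" unfolding cell_count_def by (metis card.empty)
  then show ?thesis
    using True by (simp add: cellular_chains_def trivial_groups_isomorphic trivial_free_Abelian_group_empty)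
next
  case False
  define n where "n = nat k"
  then have k: "k = int n" using False by simp
  let ?F = "{e. (n, e) \<in> cells X}"
  have "?F \<subseteq> snd ` cells X" by force
  then have fin: "finite ?F" using X finite_subset by (fastforce simp: finite_CW_def)
  have sk: "skeleton X k = skeleton X (k - 1) \<union> \<Union>?F"
  proof
    show "skeleton X k \<subseteq> skeleton X (k - 1) \<union> \<Union>?F"
    proof
      fix x assume "x \<in> skeleton X k"
      then obtain m e where m: "(m, e) \<in> cells X" "m \<le> n" "x \<in> e" by (auto simp: skeleton_def k)
      show "x \<in> skeleton X (k - 1) \<union> \<Union>?F"
      proof (cases "m = n")
        case False
        with m have "int m \<le> k - 1" by (simp add: k)
        with m show ?thesis by (auto simp: skeleton_def)
      qed (use m in auto)
    qed
    show "skeleton X (k - 1) \<union> \<Union>?F \<subseteq> skeleton X k"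
      using skeleton_mono[of "k - 1" k X] by (auto simp: skeleton_def[of X "int n"] k)
  qed
  have disj: "disjnt e e'" if "(m, e) \<in> cells X" "(m', e') \<in> cells X" "(m, e) \<noteq> (m', e')" for m e m' e'
    using X that by (force simp: finite_CW_def pairwise_def)
  have "relative_homology_group (int n) (subtopology (space_of X) (skeleton X (k - 1) \<union> \<Union>?F)) (skeleton X (k - 1))
      \<cong> free_Abelian_group {..<card ?F}"
  proof (rule relative_homology_attach_cells[THEN conjunct2, THEN conjunct1])
    show "Hausdorff_space (space_of X)" using X by (simp add: finite_CW_def)
    show "closedin (space_of X) (skeleton X (k - 1))" using X by (rule closedin_skeleton)
    show "finite ?F" by (rule fin)
    show "\<exists>\<Phi>. continuous_map (closed_disc n) (space_of X) \<Phi> \<and>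
        homeomorphic_map (open_disc n) (subtopology (space_of X) e) \<Phi> \<and>
        \<Phi> ` (topspace (closed_disc n) - topspace (open_disc n)) \<subseteq> skeleton X (k - 1)" if "e \<in> ?F" for e
    proof -
      have "(n, e) \<in> cells X" using that by simp
      then obtain \<Phi> where "characteristic_map X n e \<Phi>"
        using finite_CW_cell[OF X] by metis
      then show ?thesis by (auto simp: characteristic_map_def k)
    qed
    show "e \<subseteq> topspace (space_of X) \<and> disjnt (skeleton X (k - 1)) e" if "e \<in> ?F" for e
    proof
      show "e \<subseteq> topspace (space_of X)"
        using finite_CW_cell[OF X, of n e] that by auto
      show "disjnt (skeleton X (k - 1)) e"
        using disj[of _ _ n e] that by (force simp: skeleton_def disjnt_def k)
    qed
    show "pairwise disjnt ?F"
      using disj by (auto simp: pairwise_def)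
  qed
  moreover have "cell_count X k = card ?F" by (simp add: cell_count_def k)
  ultimately show ?thesis
    by (simp add: cellular_chains_def sk flip: k)
qed

lemma subtopology_skeleton:
  "subtopology (subtopology (space_of X) (skeleton X k)) (skeleton X (k - 1)) = subtopology (space_of X) (skeleton X (k - 1))"
  using skeleton_mono[of "k - 1" k X] by (simp add: subtopology_subtopology Int_absorb1)

text \<open>The composite of two boundaries passes through \<open>H_(k-1) (X\<^sup>k\<^sup>-\<^sup>1) \<rightarrow> H_(k-1) (X\<^sup>k\<^sup>-\<^sup>1, X\<^sup>k\<^sup>-\<^sup>2) \<rightarrow> H_(k-2) (X\<^sup>k\<^sup>-\<^sup>2)\<close>,
two consecutive maps of an exact sequence.\<close>
lemma chain_complex_cellular_chains: "chain_complex (cellular_chains X)"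
  unfolding chain_complex_def
proof (intro allI conjI ballI)
  fix k
  let ?X = "\<lambda>k. subtopology (space_of X) (skeleton X k)"
  show "comm_group (ch (cellular_chains X) k)" by (simp add: cellular_chains_def)
  show "bd (cellular_chains X) k \<in> hom (ch (cellular_chains X) k) (ch (cellular_chains X) (k - 1))"
    using group_homomorphism_hom_relboundary[of k "?X k" "skeleton X (k - 1)" "skeleton X (k - 2)"]
    by (simp add: cellular_chains_def subtopology_skeleton)
  fix x assume x: "x \<in> carrier (ch (cellular_chains X) k)"
  let ?y = "hom_boundary k (?X k) (skeleton X (k - 1)) x"
  have y: "?y \<in> carrier (homology_group (k - 1) (?X (k - 1)))"
    using hom_boundary_carrier[of k "?X k" "skeleton X (k - 1)" x] by (simp add: subtopology_skeleton)
  have "hom_boundary (k - 1) (?X (k - 1)) (skeleton X (k - 2))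
      (hom_induced (k - 1) (?X (k - 1)) {} (?X (k - 1)) (skeleton X (k - 2)) id ?y)
      = \<one>\<^bsub>homology_group (k - 2) (subtopology (?X (k - 1)) (skeleton X (k - 2)))\<^esub>"
    using homology_exactness_axiom_1[of "k - 1" "?X (k - 1)" "skeleton X (k - 2)"] y
    by (auto simp: kernel_def)
  moreover have "subtopology (?X (k - 1)) (skeleton X (k - 2)) = ?X (k - 2)"
    using subtopology_skeleton[of X "k - 1"] by simp
  ultimately show "bd (cellular_chains X) (k - 1) (bd (cellular_chains X) k x) = \<one>\<^bsub>ch (cellular_chains X) (k - 2)\<^esub>"
    using hom_one[OF hom_induced_hom[of "k - 2" "?X (k - 2)" "{}" "?X (k - 2)" "skeleton X (k - 3)" id]]
    by (simp add: cellular_chains_def hom_relboundary_def subtopology_skeleton)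
qed

lemma cellular_chain_map_hom:
  "cellular_chain_map X Y f k \<in> hom (ch (cellular_chains X) k) (ch (cellular_chains Y) k)"
  by (simp add: cellular_chain_map_def cellular_chains_def hom_induced_hom)

lemma cellular_chain_map_bd:
  assumes "cellular_map X Y f"
  shows "cellular_chain_map X Y f (k - 1) (bd (cellular_chains X) k x) = bd (cellular_chains Y) k (cellular_chain_map X Y f k x)"
proof -
  have im: "f \<in> skeleton X j \<rightarrow> skeleton Y j" for j
    using assms by (auto simp: cellular_map_def)
  have "continuous_map (subtopology (space_of X) (skeleton X k)) (subtopology (space_of Y) (skeleton Y k)) f"
    using assms im[of k] by (auto simp: cellular_map_def continuous_map_in_subtopology intro: continuous_map_from_subtopology)
  from naturality_hom_induced_relboundary[OF this im[of "k - 1"] im[of "k - 2"], of k]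
  show ?thesis
    by (simp add: cellular_chain_map_def cellular_chains_def subtopology_skeleton fun_eq_iff)
qed

lemma isoI_inverse:
  assumes "f \<in> hom G H" "\<And>y. y \<in> carrier H \<Longrightarrow> g y \<in> carrier G"
    and "\<And>x. x \<in> carrier G \<Longrightarrow> g (f x) = x" "\<And>y. y \<in> carrier H \<Longrightarrow> f (g y) = y"
  shows "f \<in> iso G H"
proof (rule isoI[OF assms(1)])
  show "bij_betw f (carrier G) (carrier H)"
    by (rule bij_betwI[where g = g]) (use assms hom_in_carrier[OF assms(1)] in auto)
qed

lemma comm_group_DirProd: "comm_group G \<Longrightarrow> comm_group H \<Longrightarrow> comm_group (G \<times>\<times> H)"
  by (intro group.group_comm_groupI DirProd_group)
    (auto simp: comm_group_def comm_monoid.m_comm)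

lemma comm_group_sum_group:
  assumes "\<And>i. i \<in> I \<Longrightarrow> comm_group (G i)"
  shows "comm_group (sum_group I G)"
proof (rule group.group_comm_groupI)
  have g: "\<And>i. i \<in> I \<Longrightarrow> group (G i)" using assms by (simp add: comm_group_def)
  then show "group (sum_group I G)" by simp
  fix x y assume "x \<in> carrier (sum_group I G)" "y \<in> carrier (sum_group I G)"
  then show "x \<otimes>\<^bsub>sum_group I G\<^esub> y = y \<otimes>\<^bsub>sum_group I G\<^esub> x"
    using assms g by (auto simp: carrier_sum_group comm_group_def intro!: restrict_ext comm_monoid.m_comm)
qed

section \<open>Isomorphisms of complexes\<close>

lemma chain_complexD:
  assumes "chain_complex C"
  shows "comm_group (ch C k)" "bd C k \<in> hom (ch C k) (ch C (k - 1))"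
    "x \<in> carrier (ch C k) \<Longrightarrow> bd C (k - 1) (bd C k x) = \<one>\<^bsub>ch C (k - 2)\<^esub>"
    "group (ch C k)"
  using assms by (auto simp: chain_complex_def comm_group_def)

text \<open>Transport of structure. The bar realization and the tensor product are recognized as complexes in this way, so that
\<open>d d = 0\<close> does not have to be derived from the simplicial identities or the sign rule.\<close>
lemma cplx_iso_chain_complex:
  assumes C: "chain_complex C" and D: "\<And>k. comm_group (ch D k)" and "cplx_iso C D"
  shows "chain_complex D"
proof -
  obtain f where f: "\<And>k. f k \<in> iso (ch C k) (ch D k)"
    "\<And>k x. x \<in> carrier (ch C k) \<Longrightarrow> f (k - 1) (bd C k x) = bd D k (f k x)"
    using \<open>cplx_iso C D\<close> unfolding cplx_iso_def by blast
  have sur: "\<exists>x \<in> carrier (ch C k). y = f k x" if "y \<in> carrier (ch D k)" for k y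
    using f(1)[of k] that by (auto simp: iso_iff)
  have hom: "f k \<in> hom (ch C k) (ch D k)" for k
    using f(1) by (simp add: iso_iff)
  have cl: "bd C k x \<in> carrier (ch C (k - 1))" if "x \<in> carrier (ch C k)" for k x
    using chain_complexD(2)[OF C] that by (rule hom_in_carrier)
  have fcl: "f k x \<in> carrier (ch D k)" if "x \<in> carrier (ch C k)" for k x
    using hom that by (rule hom_in_carrier)
  have one: "f k \<one>\<^bsub>ch C k\<^esub> = \<one>\<^bsub>ch D k\<^esub>" for k
    using hom_one[OF hom[of k]] chain_complexD(4)[OF C] D[of k] by (simp add: comm_group_def)
  have grp: "group (ch C k)" for k by (rule chain_complexD(4)[OF C])
  show ?thesis
    unfolding chain_complex_def
  proof (intro allI conjI ballI D)
    fix k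
    show "bd D k \<in> hom (ch D k) (ch D (k - 1))"
    proof (rule homI)
      fix y assume "y \<in> carrier (ch D k)"
      then obtain x where x: "x \<in> carrier (ch C k)" "y = f k x" using sur by blast
      then show "bd D k y \<in> carrier (ch D (k - 1))"
        using f(2) cl fcl by metis
    next
      fix y y' assume "y \<in> carrier (ch D k)" "y' \<in> carrier (ch D k)"
      then obtain x x' where x: "x \<in> carrier (ch C k)" "y = f k x" "x' \<in> carrier (ch C k)" "y' = f k x'"
        using sur by metis
      have "bd D k (y \<otimes>\<^bsub>ch D k\<^esub> y') = bd D k (f k (x \<otimes>\<^bsub>ch C k\<^esub> x'))"
        using x hom_mult[OF hom] by simp
      also have "\<dots> = f (k - 1) (bd C k (x \<otimes>\<^bsub>ch C k\<^esub> x'))"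
        using x grp[of k] by (intro f(2)[symmetric]) (simp add: group.is_monoid monoid.m_closed)
      also have "\<dots> = f (k - 1) (bd C k x) \<otimes>\<^bsub>ch D (k - 1)\<^esub> f (k - 1) (bd C k x')"
        using x cl hom_mult[OF hom] hom_mult[OF chain_complexD(2)[OF C]] by simp
      finally show "bd D k (y \<otimes>\<^bsub>ch D k\<^esub> y') = bd D k y \<otimes>\<^bsub>ch D (k - 1)\<^esub> bd D k y'"
        using x f(2) by simp
    qed
    fix y assume "y \<in> carrier (ch D k)"
    then obtain x where x: "x \<in> carrier (ch C k)" "y = f k x" using sur by blast
    have "bd D (k - 1) (bd D k y) = bd D (k - 1) (f (k - 1) (bd C k x))"
      using x f(2) by simp
    also have "\<dots> = f (k - 1 - 1) (bd C (k - 1) (bd C k x))"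
      using cl[OF x(1)] f(2)[of "bd C k x" "k - 1"] by simp
    also have "\<dots> = \<one>\<^bsub>ch D (k - 2)\<^esub>"
      using x chain_complexD(3)[OF C x(1)] one[of "k - 2"] by simp
    finally show "bd D (k - 1) (bd D k y) = \<one>\<^bsub>ch D (k - 2)\<^esub>" .
  qed
qed

lemma cplx_iso_sym:
  assumes grp: "\<And>k. group (ch C k)"
    and closed: "\<And>k x. x \<in> carrier (ch C k) \<Longrightarrow> bd C k x \<in> carrier (ch C (k - 1))"
    and "cplx_iso C D"
  shows "cplx_iso D C"
proof -
  obtain f where f: "\<And>k. f k \<in> iso (ch C k) (ch D k)"
    "\<And>k x. x \<in> carrier (ch C k) \<Longrightarrow> f (k - 1) (bd C k x) = bd D k (f k x)"
    using \<open>cplx_iso C D\<close> unfolding cplx_iso_def by blast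
  let ?g = "\<lambda>k. inv_into (carrier (ch C k)) (f k)"
  have inj: "inj_on (f k) (carrier (ch C k))" and im: "f k ` carrier (ch C k) = carrier (ch D k)" for k
    using f(1)[of k] by (auto simp: iso_iff)
  have "?g (k - 1) (bd D k y) = bd C k (?g k y)" if y: "y \<in> carrier (ch D k)" for k y
  proof -
    obtain x where x: "x \<in> carrier (ch C k)" "y = f k x"
      using im[of k] y by blast
    have "bd C k x \<in> carrier (ch C (k - 1))"
      using closed x(1) .
    then show ?thesis
      using x inj by (simp flip: f(2))
  qed
  moreover have "?g k \<in> iso (ch D k) (ch C k)" for k
    by (rule group.iso_set_sym[OF grp f(1)])
  ultimately show ?thesis
    unfolding cplx_iso_def by (intro exI[of _ ?g]) blast
qed

lemma chain_complex_iso_sym: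
  assumes "chain_complex C" "cplx_iso C D"
  shows "cplx_iso D C"
  by (rule cplx_iso_sym[OF chain_complexD(4)[OF assms(1)] hom_in_carrier[OF chain_complexD(2)[OF assms(1)]] assms(2)])

lemma cplx_iso_refl: "cplx_iso C C"
  unfolding cplx_iso_def by (intro exI[of _ "\<lambda>_. id"]) (simp add: id_iso)

lemma cplx_iso_trans:
  assumes "cplx_iso C D" "cplx_iso D E"
  shows "cplx_iso C E"
proof -
  obtain f g where f: "\<And>k. f k \<in> iso (ch C k) (ch D k)"
    "\<And>k x. x \<in> carrier (ch C k) \<Longrightarrow> f (k - 1) (bd C k x) = bd D k (f k x)"
    and g: "\<And>k. g k \<in> iso (ch D k) (ch E k)"
    "\<And>k x. x \<in> carrier (ch D k) \<Longrightarrow> g (k - 1) (bd D k x) = bd E k (g k x)"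
    using assms unfolding cplx_iso_def by metis
  have "f k x \<in> carrier (ch D k)" if "x \<in> carrier (ch C k)" for k x
    using f(1)[of k] that by (auto simp: iso_iff)
  then show ?thesis
    unfolding cplx_iso_def
    by (intro exI[of _ "\<lambda>k. g k \<circ> f k"]) (simp add: iso_set_trans[OF f(1) g(1)] f(2) g(2))
qed

lemma cplx_iso_sum:
  assumes "chain_complex C" "chain_complex D" "cplx_iso C C'" "cplx_iso D D'"
  shows "cplx_iso (cplx_sum C D) (cplx_sum C' D')"
proof -
  obtain f g where f: "\<And>k. f k \<in> iso (ch C k) (ch C' k)"
    "\<And>k x. x \<in> carrier (ch C k) \<Longrightarrow> f (k - 1) (bd C k x) = bd C' k (f k x)"
    and g: "\<And>k. g k \<in> iso (ch D k) (ch D' k)"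
    "\<And>k x. x \<in> carrier (ch D k) \<Longrightarrow> g (k - 1) (bd D k x) = bd D' k (g k x)"
    using assms unfolding cplx_iso_def by metis
  show ?thesis
    unfolding cplx_iso_def
    by (intro exI[of _ "\<lambda>k (x, y). (f k x, g k y)"])
      (simp add: cplx_sum_def iso_paired2 assms chain_complexD(4) f g)
qed

lemma chain_complex_cplx_sum:
  assumes "chain_complex C" "chain_complex D"
  shows "chain_complex (cplx_sum C D)"
  unfolding chain_complex_def
proof (intro allI conjI ballI)
  fix k
  show "comm_group (ch (cplx_sum C D) k)"
    by (simp add: cplx_sum_def comm_group_DirProd chain_complexD assms)
  show "bd (cplx_sum C D) k \<in> hom (ch (cplx_sum C D) k) (ch (cplx_sum C D) (k - 1))"
    using chain_complexD(2)[OF assms(1), of k] chain_complexD(2)[OF assms(2), of k]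
    by (auto simp: cplx_sum_def hom_def)
  fix x assume "x \<in> carrier (ch (cplx_sum C D) k)"
  then show "bd (cplx_sum C D) (k - 1) (bd (cplx_sum C D) k x) = \<one>\<^bsub>ch (cplx_sum C D) (k - 2)\<^esub>"
    using chain_complexD(3)[OF assms(1)] chain_complexD(3)[OF assms(2)] by (auto simp: cplx_sum_def)
qed

section \<open>Ranks and inventories\<close>

text \<open>The rank is well defined because free abelian groups are isomorphic only if their bases have the same size.\<close>
lemma rank_Z_eqI:
  assumes "group G" "G \<cong> free_Abelian_group {..<n::nat}"
  shows "rank_Z G = n"
  unfolding rank_Z_def
proof (rule the_equality)
  fix m assume "G \<cong> free_Abelian_group {..<m::nat}"
  then have "free_Abelian_group {..<m} \<cong> free_Abelian_group {..<n}"
    using assms by (meson group.iso_sym iso_trans)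
  then have "{..<m} \<approx> {..<n}" by (simp only: isomorphic_free_Abelian_groups)
  then show "m = n" by (simp add: eqpoll_iff_card)
qed fact

lemma fg_freeD:
  assumes "group G" "fg_free G" shows "G \<cong> free_Abelian_group {..<rank_Z G}"
  using assms rank_Z_eqI by (metis fg_free_def)

lemma fg_free_iso:
  assumes "group G" "G \<cong> H" "fg_free G" 
  shows "fg_free H"
  using assms by (meson fg_free_def group.iso_sym iso_trans)

lemma fg_free_DirProd:
  assumes "group G" "group H" "fg_free G" "fg_free H"
  shows "fg_free (G \<times>\<times> H)" and "rank_Z (G \<times>\<times> H) = rank_Z G + rank_Z H"
proof -
  have "G \<times>\<times> H \<cong> free_Abelian_group {..<rank_Z G + rank_Z H}"
    by (intro DirProd_free_rank fg_freeD assms)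
  then show "fg_free (G \<times>\<times> H)" "rank_Z (G \<times>\<times> H) = rank_Z G + rank_Z H"
    using rank_Z_eqI DirProd_group assms by (auto simp: fg_free_def)
qed

lemma rank_Z_iso:
  assumes "group G" "G \<cong> H" "fg_free G" "group H"
  shows "rank_Z H = rank_Z G"
proof -
  have "H \<cong> free_Abelian_group {..<rank_Z G}"
    using iso_trans[OF group.iso_sym[OF assms(1,2)] fg_freeD[OF assms(1,3)]] .
  then show ?thesis by (rule rank_Z_eqI[OF assms(4)])
qed

lemma rank_Z_trivial: "trivial_group G \<Longrightarrow> rank_Z G = 0" and fg_free_trivial: "trivial_group G \<Longrightarrow> fg_free G"
proof -
  assume t: "trivial_group G"
  then have "G \<cong> free_Abelian_group {..<0::nat}"
    by (simp add: trivial_groups_isomorphic trivial_free_Abelian_group_empty)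
  then show "rank_Z G = 0" "fg_free G"
    using t rank_Z_eqI[of G 0] unfolding trivial_group_def fg_free_def by blast+
qed

lemma bounded_free_complexD:
  assumes "bounded_free_complex C"
  shows "chain_complex C" "fg_free (ch C k)" "finite {k. \<not> trivial_group (ch C k)}"
    "finite {k. rank_Z (ch C k) \<noteq> 0}"
proof -
  show "chain_complex C" "fg_free (ch C k)" and fin: "finite {k. \<not> trivial_group (ch C k)}"
    using assms by (auto simp: bounded_free_complex_def)
  then show "finite {k. rank_Z (ch C k) \<noteq> 0}"
    by (rule_tac finite_subset[OF _ fin]) (auto simp: rank_Z_trivial)
qed

lemma bounded_free_complex_iso:
  assumes C: "bounded_free_complex C" and D: "chain_complex D" and iso: "\<And>k. ch C k \<cong> ch D k"
  shows "bounded_free_complex D"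
proof -
  have "trivial_group (ch D k)" if "trivial_group (ch C k)" for k
    using isomorphic_group_triviality1[OF iso _ that] chain_complexD(4)[OF D] .
  then have "finite {k. \<not> trivial_group (ch D k)}"
    by (intro finite_subset[OF _ bounded_free_complexD(3)[OF C]]) auto
  then show ?thesis
    using fg_free_iso[OF chain_complexD(4)[OF bounded_free_complexD(1)[OF C]] iso bounded_free_complexD(2)[OF C]] D
    by (simp add: bounded_free_complex_def)
qed

lemma cplx_iso_ch: "cplx_iso C D \<Longrightarrow> ch C k \<cong> ch D k"
  unfolding cplx_iso_def is_iso_def by blast

text \<open>Coefficients can be read off only because the support is finite: the series constructor needs almost all coefficients of
negative degree to vanish.\<close>
lemma inventory_nth:
  assumes "bounded_free_complex C"
  shows "fls_nth (inventory C) k = int (rank_Z (ch C k))"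
proof -
  have "finite (nat ` uminus ` {k. rank_Z (ch C k) \<noteq> 0})"
    using bounded_free_complexD(4)[OF assms] by simp
  moreover have "{n::nat. rank_Z (ch C (- int n)) \<noteq> 0} \<subseteq> nat ` uminus ` {k. rank_Z (ch C k) \<noteq> 0}"
    by (force simp: image_iff)
  ultimately have "finite {n::nat. rank_Z (ch C (- int n)) \<noteq> 0}"
    by (rule rev_finite_subset)
  then show ?thesis
    unfolding inventory_def by (subst nth_Abs_fls) (auto simp: eventually_cofinite)
qed

lemma
  assumes X: "finite_CW X"
  shows bounded_free_cellular_chains: "bounded_free_complex (cellular_chains X)"
    and inventory_cellular_chains: "inventory (cellular_chains X) = cell_inventory X"
proof -
  have cc: "chain_complex (cellular_chains X)" by (rule chain_complex_cellular_chains)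
  note rk = cellular_chains_rank[OF X]
  have fin: "finite (cells X)" using X unfolding finite_CW_def by blast
  have r: "rank_Z (ch (cellular_chains X) k) = cell_count X k" for k
    by (rule rank_Z_eqI[OF chain_complexD(4)[OF cc] rk])
  have "trivial_group (ch (cellular_chains X) k)" if "k \<notin> (int \<circ> fst) ` cells X" for k
  proof -
    have "{e. \<exists>n. (n, e) \<in> cells X \<and> int n = k} = {}" using that by force
    then have "cell_count X k = 0" unfolding cell_count_def by (metis card.empty)
    then show ?thesis
      using rk[of k] isomorphic_group_triviality[OF rk chain_complexD(4)[OF cc] group_free_Abelian_group, of k]
      by (simp add: trivial_free_Abelian_group_empty)
  qed
  then have "{k. \<not> trivial_group (ch (cellular_chains X) k)} \<subseteq> (int \<circ> fst) ` cells X" by blast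
  then have "finite {k. \<not> trivial_group (ch (cellular_chains X) k)}"
    using fin finite_subset by blast
  then show b: "bounded_free_complex (cellular_chains X)"
    unfolding bounded_free_complex_def fg_free_def using cc rk by blast
  show "inventory (cellular_chains X) = cell_inventory X"
  proof (rule fls_eqI)
    fix k
    have "fls_nth (cell_inventory X) k = (\<Sum>c\<in>cells X. if k = int (fst c) then 1 else 0)"
      unfolding cell_inventory_def by (simp add: fls_nth_sum case_prod_unfold)
    also have "\<dots> = int (card {c \<in> cells X. int (fst c) = k})"
      using fin by (simp add: sum.If_cases Int_def eq_commute)
    also have "card {c \<in> cells X. int (fst c) = k} = cell_count X k"
      unfolding cell_count_def
    proof (rule bij_betw_same_card[of snd], rule bij_betw_imageI)
      show "inj_on snd {c \<in> cells X. int (fst c) = k}" by (auto simp: inj_on_def)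
      show "snd ` {c \<in> cells X. int (fst c) = k} = {e. \<exists>n. (n, e) \<in> cells X \<and> int n = k}"
        by (force simp: image_iff)
    qed
    finally show "fls_nth (inventory (cellular_chains X)) k = fls_nth (cell_inventory X) k"
      by (simp add: inventory_nth[OF b] r)
  qed
qed

section \<open>The total complex of a span\<close>

text \<open>Up to isomorphism the tensor product of \<open>A\<close> with \<open>E_1\<close>, in coordinates in which the
boundary does not involve the boundary of \<open>A\<close>.\<close>
definition path_cplx :: "'a cplx \<Rightarrow> ('a \<times> 'a) cplx" where
  "path_cplx A = \<lparr>ch = (\<lambda>n. ch A n \<times>\<times> ch A (n - 1)), bd = (\<lambda>n (y, z). (z, \<one>\<^bsub>ch A (n - 2)\<^esub>))\<rparr>"

lemma chain_complex_path_cplx: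
  assumes A: "chain_complex A" shows "chain_complex (path_cplx A)"
  unfolding chain_complex_def
proof (intro allI conjI ballI)
  fix k
  have m: "monoid (ch A k)" for k using chain_complexD(4)[OF A] group.is_monoid by blast
  show "comm_group (ch (path_cplx A) k)"
    by (simp add: path_cplx_def comm_group_DirProd chain_complexD[OF A])
  show "bd (path_cplx A) k \<in> hom (ch (path_cplx A) k) (ch (path_cplx A) (k - 1))"
    by (rule homI) (auto simp: path_cplx_def monoid.one_closed[OF m] monoid.l_one[OF m])
  fix x assume "x \<in> carrier (ch (path_cplx A) k)"
  then show "bd (path_cplx A) (k - 1) (bd (path_cplx A) k x) = \<one>\<^bsub>ch (path_cplx A) (k - 2)\<^esub>"
    by (auto simp: path_cplx_def)
qed

definition chain_map :: "'a cplx \<Rightarrow> 'b cplx \<Rightarrow> (int \<Rightarrow> 'a \<Rightarrow> 'b) \<Rightarrow> bool" where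
  "chain_map C D f \<longleftrightarrow> (\<forall>k. f k \<in> hom (ch C k) (ch D k) \<and>
     (\<forall>x \<in> carrier (ch C k). f (k - 1) (bd C k x) = bd D k (f k x)))"

lemma chain_complex_mapping_cone:
  assumes A: "chain_complex A" and B: "chain_complex B" and f: "chain_map A B f"
  shows "chain_complex (mapping_cone A B f)"
  unfolding chain_complex_def
proof (intro allI conjI ballI)
  fix k
  interpret A1: comm_group "ch A (k - 1)" by (rule chain_complexD[OF A])
  interpret A2: comm_group "ch A (k - 2)" by (rule chain_complexD[OF A])
  interpret A3: comm_group "ch A (k - 3)" by (rule chain_complexD[OF A])
  interpret B0: comm_group "ch B k" by (rule chain_complexD[OF B])
  interpret B1: comm_group "ch B (k - 1)" by (rule chain_complexD[OF B])
  interpret B2: comm_group "ch B (k - 2)" by (rule chain_complexD[OF B])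
  interpret dA: group_hom "ch A (k - 1)" "ch A (k - 2)" "bd A (k - 1)"
    using chain_complexD(2)[OF A, of "k - 1"] by unfold_locales simp
  interpret dA2: group_hom "ch A (k - 2)" "ch A (k - 3)" "bd A (k - 2)"
    using chain_complexD(2)[OF A, of "k - 2"] by unfold_locales simp
  interpret dB: group_hom "ch B k" "ch B (k - 1)" "bd B k"
    using chain_complexD(2)[OF B, of k] by unfold_locales simp
  interpret dB1: group_hom "ch B (k - 1)" "ch B (k - 2)" "bd B (k - 1)"
    using chain_complexD(2)[OF B, of "k - 1"] by unfold_locales simp
  interpret f1: group_hom "ch A (k - 1)" "ch B (k - 1)" "f (k - 1)"
    using f by unfold_locales (simp add: chain_map_def)
  interpret f2: group_hom "ch A (k - 2)" "ch B (k - 2)" "f (k - 2)"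
    using f by unfold_locales (simp add: chain_map_def)
  show "comm_group (ch (mapping_cone A B f) k)"
    by (simp add: mapping_cone_def comm_group_DirProd chain_complexD[OF A] chain_complexD[OF B])
  show "bd (mapping_cone A B f) k \<in> hom (ch (mapping_cone A B f) k) (ch (mapping_cone A B f) (k - 1))"
    by (rule homI) (auto simp: mapping_cone_def A2.inv_mult B1.m_ac)
  fix x assume "x \<in> carrier (ch (mapping_cone A B f) k)"
  then obtain a b where x: "x = (a, b)" "a \<in> carrier (ch A (k - 1))" "b \<in> carrier (ch B k)"
    by (auto simp: mapping_cone_def)
  have "bd A (k - 2) (bd A (k - 1) a) = \<one>\<^bsub>ch A (k - 3)\<^esub>"
    using chain_complexD(3)[OF A x(2)] by simp
  moreover have "bd B (k - 1) (bd B k b) = \<one>\<^bsub>ch B (k - 2)\<^esub>"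
    using chain_complexD(3)[OF B x(3)] by simp
  moreover have "f (k - 2) (bd A (k - 1) a) = bd B (k - 1) (f (k - 1) a)"
    using f x(2) by (auto simp: chain_map_def) (metis diff_diff_add one_add_one)
  ultimately show "bd (mapping_cone A B f) (k - 1) (bd (mapping_cone A B f) k x) = \<one>\<^bsub>ch (mapping_cone A B f) (k - 2)\<^esub>"
    using x by (simp add: mapping_cone_def)
qed

text \<open>The normalized bar complex of a span, with one summand for each string without repetition: \<open>a\<close>, \<open>b\<close>, \<open>c\<close>
belong to the three objects, \<open>u\<close> and \<open>v\<close> to the arrows from \<open>A\<close> to \<open>B\<close> and to \<open>C\<close>. An arrow contributes its end,
moved by \<open>f\<close> or \<open>g\<close>, minus its beginning; its own boundary has the sign of simplicial degree \<open>1\<close>.\<close>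
definition span_total :: "'a cplx \<Rightarrow> 'b cplx \<Rightarrow> 'c cplx \<Rightarrow> (int \<Rightarrow> 'a \<Rightarrow> 'b) \<Rightarrow> (int \<Rightarrow> 'a \<Rightarrow> 'c) \<Rightarrow>
    ('a \<times> 'b \<times> 'c \<times> 'a \<times> 'a) cplx" where
  "span_total A B C f g =
     \<lparr>ch = (\<lambda>n. ch A n \<times>\<times> (ch B n \<times>\<times> (ch C n \<times>\<times> (ch A (n - 1) \<times>\<times> ch A (n - 1))))),
      bd = (\<lambda>n (a, b, c, u, v).
        (bd A n a \<otimes>\<^bsub>ch A (n - 1)\<^esub> inv\<^bsub>ch A (n - 1)\<^esub> (u \<otimes>\<^bsub>ch A (n - 1)\<^esub> v),
         bd B n b \<otimes>\<^bsub>ch B (n - 1)\<^esub> f (n - 1) u,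
         bd C n c \<otimes>\<^bsub>ch C (n - 1)\<^esub> g (n - 1) v,
         inv\<^bsub>ch A (n - 2)\<^esub> bd A (n - 1) u,
         inv\<^bsub>ch A (n - 2)\<^esub> bd A (n - 1) v))\<rparr>"

lemma span_total_bd_closed:
  assumes A: "chain_complex A" and B: "chain_complex B" and C: "chain_complex C"
    and f: "\<And>k. f k \<in> hom (ch A k) (ch B k)" and g: "\<And>k. g k \<in> hom (ch A k) (ch C k)"
    and x: "x \<in> carrier (ch (span_total A B C f g) k)"
  shows "bd (span_total A B C f g) k x \<in> carrier (ch (span_total A B C f g) (k - 1))"
proof -
  obtain a b c u v where x: "x = (a, b, c, u, v)" "a \<in> carrier (ch A k)" "b \<in> carrier (ch B k)"
    "c \<in> carrier (ch C k)" "u \<in> carrier (ch A (k - 1))" "v \<in> carrier (ch A (k - 1))"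
    using x by (auto simp: span_total_def)
  interpret A1: group "ch A (k - 1)" by (rule chain_complexD[OF A])
  interpret A2: group "ch A (k - 2)" by (rule chain_complexD[OF A])
  interpret B1: group "ch B (k - 1)" by (rule chain_complexD[OF B])
  interpret C1: group "ch C (k - 1)" by (rule chain_complexD[OF C])
  note d = hom_in_carrier[OF chain_complexD(2)[OF A]] hom_in_carrier[OF chain_complexD(2)[OF B]]
    hom_in_carrier[OF chain_complexD(2)[OF C]] hom_in_carrier[OF f] hom_in_carrier[OF g]
  show ?thesis
    using x d(1)[OF x(2)] d(1)[OF x(5)] d(1)[OF x(6)] d(2)[OF x(3)] d(3)[OF x(4)] d(4)[OF x(5)] d(5)[OF x(6)]
    by (simp add: span_total_def)
qed

lemma (in comm_group) cancel_diff:
  assumes "x \<in> carrier G" "u \<in> carrier G" "v \<in> carrier G"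
  shows "x \<otimes> inv (x \<otimes> inv (u \<otimes> v)) \<otimes> inv u = v" "x \<otimes> inv (u \<otimes> (x \<otimes> inv v \<otimes> inv u)) = v"
proof -
  have "x \<otimes> inv (x \<otimes> inv (u \<otimes> v)) = u \<otimes> v"
    using assms by (simp add: inv_mult_group m_assoc[symmetric] m_comm[of _ "inv x"])
  then show "x \<otimes> inv (x \<otimes> inv (u \<otimes> v)) \<otimes> inv u = v"
    using assms by (simp add: m_comm[of u v] m_assoc)
  have "u \<otimes> (x \<otimes> inv v \<otimes> inv u) = x \<otimes> inv v"
    using assms by (simp add: m_comm[of "x \<otimes> inv v" "inv u"] m_assoc[symmetric])
  then show "x \<otimes> inv (u \<otimes> (x \<otimes> inv v \<otimes> inv u)) = v"
    using assms by (simp add: inv_mult_group m_assoc[symmetric] m_comm[of _ "inv x"])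
qed

lemma (in comm_group) cancel_mixed:
  assumes "x \<in> carrier G" "y \<in> carrier G" "u \<in> carrier G" "v \<in> carrier G"
  shows "(x \<otimes> v) \<otimes> (y \<otimes> inv (u \<otimes> v)) = inv u \<otimes> (x \<otimes> y)"
proof -
  have "v \<otimes> inv (u \<otimes> v) = inv u"
    using assms by (simp add: inv_mult_group m_assoc[symmetric])
  moreover have "(x \<otimes> v) \<otimes> (y \<otimes> inv (u \<otimes> v)) = (v \<otimes> inv (u \<otimes> v)) \<otimes> (x \<otimes> y)"
    using assms by (simp only: m_ac m_closed inv_closed)
  ultimately show ?thesis by simp
qed

text \<open>The new coordinates are \<open>w = u\<close>, \<open>b\<close> and \<open>c + g a\<close> for the cone, and \<open>y = a\<close>, \<open>s = d a - u - v\<close>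
for the path complex. The boundary of \<open>c + g a\<close> becomes \<open>d c + g v + g (d a - u - v) = d (c + g a) - g u\<close>,
and the boundary sends \<open>(y, s)\<close> to \<open>(s, 0)\<close>, because it replaces \<open>(a, u, v)\<close> by \<open>(s, - d u, - d v)\<close>
and \<open>d s + d u + d v = 0\<close>. The change of coordinates is reversible since \<open>v = d y - s - w\<close>.\<close>
lemma span_total_decomposition:
  assumes A: "chain_complex A" and B: "chain_complex B" and C: "chain_complex C"
    and f: "chain_map A B f" and g: "chain_map A C g"
  shows "cplx_iso (span_total A B C f g)
     (cplx_sum (mapping_cone A (cplx_sum B C) (pair_map f (neg_map C g))) (path_cplx A))"
proof -
  \<comment> \<open>\<open>?S\<close> solves the equations of the coordinates in \<open>?T\<close> for \<open>(a, b, c, u, v)\<close>.\<close>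
  let ?T = "\<lambda>n (a, b, c, u, v). ((u, (b, c \<otimes>\<^bsub>ch C n\<^esub> g n a)),
      (a, bd A n a \<otimes>\<^bsub>ch A (n - 1)\<^esub> inv\<^bsub>ch A (n - 1)\<^esub> (u \<otimes>\<^bsub>ch A (n - 1)\<^esub> v)))"
  let ?S = "\<lambda>n ((w, (b, c)), (y, s)). (y, b, c \<otimes>\<^bsub>ch C n\<^esub> inv\<^bsub>ch C n\<^esub> g n y, w,
      bd A n y \<otimes>\<^bsub>ch A (n - 1)\<^esub> inv\<^bsub>ch A (n - 1)\<^esub> s \<otimes>\<^bsub>ch A (n - 1)\<^esub> inv\<^bsub>ch A (n - 1)\<^esub> w)"
  show ?thesis
    unfolding cplx_iso_def
  proof (intro exI[of _ ?T] allI conjI ballI)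
    fix k
    interpret A0: comm_group "ch A k" by (rule chain_complexD[OF A])
    interpret A1: comm_group "ch A (k - 1)" by (rule chain_complexD[OF A])
    interpret A2: comm_group "ch A (k - 2)" by (rule chain_complexD[OF A])
    interpret B0: comm_group "ch B k" by (rule chain_complexD[OF B])
    interpret B1: comm_group "ch B (k - 1)" by (rule chain_complexD[OF B])
    interpret C0: comm_group "ch C k" by (rule chain_complexD[OF C])
    interpret C1: comm_group "ch C (k - 1)" by (rule chain_complexD[OF C])
    interpret dA: group_hom "ch A k" "ch A (k - 1)" "bd A k"
      using chain_complexD(2)[OF A, of k] by unfold_locales simp
    interpret dA1: group_hom "ch A (k - 1)" "ch A (k - 2)" "bd A (k - 1)"
      using chain_complexD(2)[OF A, of "k - 1"] by unfold_locales simp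
    interpret dB: group_hom "ch B k" "ch B (k - 1)" "bd B k"
      using chain_complexD(2)[OF B, of k] by unfold_locales simp
    interpret dC: group_hom "ch C k" "ch C (k - 1)" "bd C k"
      using chain_complexD(2)[OF C, of k] by unfold_locales simp
    interpret g0: group_hom "ch A k" "ch C k" "g k"
      using g by unfold_locales (simp add: chain_map_def)
    interpret g1: group_hom "ch A (k - 1)" "ch C (k - 1)" "g (k - 1)"
      using g by unfold_locales (simp add: chain_map_def)
    interpret f1: group_hom "ch A (k - 1)" "ch B (k - 1)" "f (k - 1)"
      using f by unfold_locales (simp add: chain_map_def)
    have c1: "c \<otimes>\<^bsub>ch C k\<^esub> x \<otimes>\<^bsub>ch C k\<^esub> inv\<^bsub>ch C k\<^esub> x = c" "c \<otimes>\<^bsub>ch C k\<^esub> inv\<^bsub>ch C k\<^esub> x \<otimes>\<^bsub>ch C k\<^esub> x = c"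
      if "c \<in> carrier (ch C k)" "x \<in> carrier (ch C k)" for c x
      using that by (simp_all add: C0.m_assoc)
    show "?T k \<in> iso (ch (span_total A B C f g) k)
       (ch (cplx_sum (mapping_cone A (cplx_sum B C) (pair_map f (neg_map C g))) (path_cplx A)) k)"
    proof (rule isoI_inverse[where g = "?S k"], rule homI)
      fix x y
      assume "x \<in> carrier (ch (span_total A B C f g) k)" "y \<in> carrier (ch (span_total A B C f g) k)"
      then show "?T k (x \<otimes>\<^bsub>ch (span_total A B C f g) k\<^esub> y)
        = ?T k x \<otimes>\<^bsub>ch (cplx_sum (mapping_cone A (cplx_sum B C) (pair_map f (neg_map C g))) (path_cplx A)) k\<^esub> ?T k y"
        by (auto simp: span_total_def cplx_sum_def mapping_cone_def path_cplx_def A1.inv_mult_group A1.m_ac C0.m_ac)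
    qed (auto simp: span_total_def cplx_sum_def mapping_cone_def path_cplx_def c1 A1.cancel_diff)
    fix x assume "x \<in> carrier (ch (span_total A B C f g) k)"
    then obtain a b c u v where x: "x = (a, b, c, u, v)" "a \<in> carrier (ch A k)" "b \<in> carrier (ch B k)"
      "c \<in> carrier (ch C k)" "u \<in> carrier (ch A (k - 1))" "v \<in> carrier (ch A (k - 1))"
      by (auto simp: span_total_def)
    have dd: "bd A (k - 1) (bd A k a) = \<one>\<^bsub>ch A (k - 2)\<^esub>"
      using chain_complexD(3)[OF A x(2)] .
    have gd: "g (k - 1) (bd A k a) = bd C k (g k a)"
      using g x(2) by (simp add: chain_map_def)
    have "(bd C k c \<otimes>\<^bsub>ch C (k - 1)\<^esub> g (k - 1) v) \<otimes>\<^bsub>ch C (k - 1)\<^esub>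
        (bd C k (g k a) \<otimes>\<^bsub>ch C (k - 1)\<^esub> inv\<^bsub>ch C (k - 1)\<^esub> (g (k - 1) u \<otimes>\<^bsub>ch C (k - 1)\<^esub> g (k - 1) v))
        = inv\<^bsub>ch C (k - 1)\<^esub> g (k - 1) u \<otimes>\<^bsub>ch C (k - 1)\<^esub> (bd C k c \<otimes>\<^bsub>ch C (k - 1)\<^esub> bd C k (g k a))"
      using x by (intro C1.cancel_mixed) auto
    moreover have "inv\<^bsub>ch A (k - 2)\<^esub> (inv\<^bsub>ch A (k - 2)\<^esub> p \<otimes>\<^bsub>ch A (k - 2)\<^esub> inv\<^bsub>ch A (k - 2)\<^esub> q) = p \<otimes>\<^bsub>ch A (k - 2)\<^esub> q"
      if "p \<in> carrier (ch A (k - 2))" "q \<in> carrier (ch A (k - 2))" for p q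
      using that by (simp add: A2.inv_mult)
    ultimately show "?T (k - 1) (bd (span_total A B C f g) k x) =
      bd (cplx_sum (mapping_cone A (cplx_sum B C) (pair_map f (neg_map C g))) (path_cplx A)) k (?T k x)"
      using x by (clarsimp simp: span_total_def cplx_sum_def mapping_cone_def path_cplx_def pair_map_def neg_map_def
        dd gd B1.m_comm)
  qed
qed

lemma trivial_group_DirProd: "trivial_group G \<Longrightarrow> trivial_group H \<Longrightarrow> trivial_group (G \<times>\<times> H)"
  by (auto simp: trivial_group_def DirProd_group)

lemma chain_map_pair_neg:
  assumes B: "chain_complex B" and C: "chain_complex C" and A: "chain_complex A"
    and f: "chain_map A B f" and g: "chain_map A C g"
  shows "chain_map A (cplx_sum B C) (pair_map f (neg_map C g))"
  unfolding chain_map_def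
proof (intro allI conjI ballI)
  fix k
  interpret C0: comm_group "ch C k" by (rule chain_complexD[OF C])
  interpret C1: comm_group "ch C (k - 1)" by (rule chain_complexD[OF C])
  interpret dC: group_hom "ch C k" "ch C (k - 1)" "bd C k"
    using chain_complexD(2)[OF C, of k] by unfold_locales simp
  have fh: "f k \<in> hom (ch A k) (ch B k)" and gh: "g k \<in> hom (ch A k) (ch C k)"
    using f g by (auto simp: chain_map_def)
  show "pair_map f (neg_map C g) k \<in> hom (ch A k) (ch (cplx_sum B C) k)"
    by (rule homI) (auto simp: pair_map_def neg_map_def cplx_sum_def hom_mult[OF fh] hom_mult[OF gh]
        hom_in_carrier[OF fh] hom_in_carrier[OF gh] C0.inv_mult)
  fix x assume "x \<in> carrier (ch A k)"
  then show "pair_map f (neg_map C g) (k - 1) (bd A k x) = bd (cplx_sum B C) k (pair_map f (neg_map C g) k x)"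
    using f g hom_in_carrier[OF gh] by (simp add: pair_map_def neg_map_def cplx_sum_def chain_map_def)
qed

lemma bounded_free_complex_DirProd:
  assumes A: "bounded_free_complex A" and B: "bounded_free_complex B" and E: "chain_complex E"
    and ch: "\<And>k. ch E k = ch A (k - i) \<times>\<times> ch B (k - j)"
  shows "bounded_free_complex E"
proof -
  have "{k. \<not> trivial_group (ch E k)}
      \<subseteq> (\<lambda>k. k + i) ` {k. \<not> trivial_group (ch A k)} \<union> (\<lambda>k. k + j) ` {k. \<not> trivial_group (ch B k)}"
  proof
    fix k assume "k \<in> {k. \<not> trivial_group (ch E k)}"
    then have "\<not> trivial_group (ch A (k - i)) \<or> \<not> trivial_group (ch B (k - j))"
      using trivial_group_DirProd by (auto simp: ch)
    then show "k \<in> (\<lambda>k. k + i) ` {k. \<not> trivial_group (ch A k)} \<union> (\<lambda>k. k + j) ` {k. \<not> trivial_group (ch B k)}"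
      by (force simp: image_iff intro: exI[of _ "k - i"] exI[of _ "k - j"])
  qed
  then have "finite {k. \<not> trivial_group (ch E k)}"
    by (rule finite_subset) (simp add: bounded_free_complexD(3)[OF A] bounded_free_complexD(3)[OF B])
  moreover have "fg_free (ch E k)" for k
    using bounded_free_complexD[OF A] bounded_free_complexD[OF B]
    by (simp add: ch fg_free_DirProd chain_complexD)
  ultimately show ?thesis using E by (simp add: bounded_free_complex_def)
qed

lemma bounded_free_complex_cplx_sum:
  assumes B: "bounded_free_complex B" and C: "bounded_free_complex C"
  shows "bounded_free_complex (cplx_sum B C)"
proof (rule bounded_free_complex_DirProd[OF B C, of _ 0 0])
  show "chain_complex (cplx_sum B C)"
    by (rule chain_complex_cplx_sum[OF bounded_free_complexD(1)[OF B] bounded_free_complexD(1)[OF C]])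
qed (simp add: cplx_sum_def)

lemma bounded_free_complex_path_cplx:
  assumes A: "bounded_free_complex A"
  shows "bounded_free_complex (path_cplx A)"
proof (rule bounded_free_complex_DirProd[OF A A, of _ 0 1])
  show "chain_complex (path_cplx A)" by (rule chain_complex_path_cplx[OF bounded_free_complexD(1)[OF A]])
qed (simp add: path_cplx_def)

lemma bounded_free_complex_mapping_cone:
  assumes A: "bounded_free_complex A" and B: "bounded_free_complex B" and f: "chain_map A B f"
  shows "bounded_free_complex (mapping_cone A B f)"
proof (rule bounded_free_complex_DirProd[OF A B, of _ 1 0])
  show "chain_complex (mapping_cone A B f)"
    by (rule chain_complex_mapping_cone[OF bounded_free_complexD(1)[OF A] bounded_free_complexD(1)[OF B] f])
qed (simp add: mapping_cone_def)

lemma inventory_cplx_sum: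
  assumes B: "bounded_free_complex B" and C: "bounded_free_complex C"
  shows "inventory (cplx_sum B C) = inventory B + inventory C"
proof (rule fls_eqI)
  fix n
  show "fls_nth (inventory (cplx_sum B C)) n = fls_nth (inventory B + inventory C) n"
    using bounded_free_complexD[OF B] bounded_free_complexD[OF C]
    by (simp add: inventory_nth bounded_free_complex_cplx_sum B C) (simp add: cplx_sum_def fg_free_DirProd chain_complexD)
qed

lemma inventory_path_cplx:
  assumes A: "bounded_free_complex A"
  shows "inventory (path_cplx A) = (1 + fls_X) * inventory A"
proof (rule fls_eqI)
  fix n
  have "rank_Z (ch (path_cplx A) n) = rank_Z (ch A n) + rank_Z (ch A (n - 1))"
    using bounded_free_complexD[OF A] by (simp add: path_cplx_def fg_free_DirProd chain_complexD)
  then show "fls_nth (inventory (path_cplx A)) n = fls_nth ((1 + fls_X) * inventory A) n"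
    by (simp add: inventory_nth bounded_free_complex_path_cplx A distrib_right fls_X_times_conv_shift)
qed

lemma inventory_iso:
  assumes "chain_complex C" "\<And>k. fg_free (ch C k)" "chain_complex D" "\<And>k. ch C k \<cong> ch D k"
  shows "inventory D = inventory C"
  using assms by (simp add: inventory_def rank_Z_iso[OF _ assms(4)] chain_complexD(4))

text \<open>A basis element of \<open>A_j\<close> occurs in degree \<open>j\<close> as a first coordinate and in degree \<open>j + 1\<close> as a second
coordinate; the boundary sends the latter occurrence to the former. This is a copy of \<open>E_(j+1)\<close>, so that
\<open>j + 1\<close> must occur in the list as often as the rank of \<open>A_j\<close> prescribes.\<close>
lemma path_cplx_elementary:
  assumes A: "bounded_free_complex A"
  obtains ks where "cplx_iso (path_cplx A) (cplx_Sum {..<length ks} (\<lambda>i. elementary_cplx (ks ! i)))"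
proof -
  have cA: "chain_complex A" by (rule bounded_free_complexD(1)[OF A])
  let ?r = "\<lambda>j. rank_Z (ch A j)"
  let ?J = "{j. ?r j \<noteq> 0}"
  have J: "finite ?J" by (rule bounded_free_complexD(4)[OF A])
  obtain ks where ks: "mset ks = (\<Sum>j\<in>?J. replicate_mset (?r j) (j + 1))"
    using ex_mset by blast
  \<comment> \<open>The positions of the list that serve as a basis of \<open>A_j\<close>.\<close>
  define S where "S j = {i. i < length ks \<and> ks ! i = j + 1}" for j
  have fS: "finite (S j)" for j by (simp add: S_def)
  have "card (S j) = ?r j" for j
  proof -
    have "card (S j) = count (mset ks) (j + 1)"
      unfolding S_def count_mset count_list_eq_length_filter length_filter_conv_card by (rule arg_cong[where f = card]) auto
    also have "\<dots> = (\<Sum>i\<in>?J. if i = j then ?r i else 0)"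
      by (simp add: ks count_sum) (rule sum.cong, auto)
    also have "\<dots> = ?r j" using J by simp
    finally show ?thesis .
  qed
  then have "free_Abelian_group {..<?r j} \<cong> free_Abelian_group (S j)" for j
    by (rule group.iso_sym[OF group_free_Abelian_group free_Abelian_group_card[OF fS]])
  then have "ch A j \<cong> free_Abelian_group (S j)" for j
    by (rule iso_trans[OF fg_freeD[OF chain_complexD(4)[OF cA] bounded_free_complexD(2)[OF A]]])
  then have "ch A j \<cong> sum_group (S j) (\<lambda>_. integer_group)" for j
    by (rule iso_trans) (simp add: group.iso_sym isomorphic_sum_integer_group)
  then have "\<exists>\<theta>. \<theta> \<in> iso (ch A j) (sum_group (S j) (\<lambda>_. integer_group))" for j
    unfolding is_iso_def by blast
  then obtain \<theta> where \<theta>: "\<And>j. \<theta> j \<in> iso (ch A j) (sum_group (S j) (\<lambda>_. integer_group))"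
    by metis
  then have "\<exists>\<eta>. group_isomorphisms (ch A j) (sum_group (S j) (\<lambda>_. integer_group)) (\<theta> j) \<eta>" for j
    using group.iso_iff_group_isomorphisms[OF chain_complexD(4)[OF cA]] by blast
  then obtain \<eta> where \<eta>: "\<And>j. group_isomorphisms (ch A j) (sum_group (S j) (\<lambda>_. integer_group)) (\<theta> j) (\<eta> j)"
    by metis
  have carS: "carrier (sum_group (S j) (\<lambda>_. integer_group)) = extensional (S j)" for j
    by (auto simp: carrier_sum_group fS PiE_def)
  have \<theta>h: "\<theta> j (x \<otimes>\<^bsub>ch A j\<^esub> y) i = \<theta> j x i + \<theta> j y i"
    if "x \<in> carrier (ch A j)" "y \<in> carrier (ch A j)" "i \<in> S j" for j x y i
    using hom_mult[OF iso_imp_homomorphism[OF \<theta>], OF that(1,2)] that(3) by simp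
  have \<theta>1: "\<theta> j \<one>\<^bsub>ch A j\<^esub> i = 0" if "i \<in> S j" for j i
    using hom_one[OF iso_imp_homomorphism[OF \<theta>[of j]]] chain_complexD(4)[OF cA] that by simp
  have \<theta>c: "\<theta> j x \<in> extensional (S j)" if "x \<in> carrier (ch A j)" for j x
    using hom_in_carrier[OF iso_imp_homomorphism[OF \<theta>] that] carS by simp
  have \<eta>c: "\<eta> j h \<in> carrier (ch A j)" if "h \<in> extensional (S j)" for j h
    using \<eta>[of j] that carS[of j] hom_in_carrier[of "\<eta> j"] by (auto simp: group_isomorphisms_def)
  have \<eta>\<theta>: "x \<in> carrier (ch A j) \<Longrightarrow> \<eta> j (\<theta> j x) = x" and \<theta>\<eta>: "h \<in> extensional (S j) \<Longrightarrow> \<theta> j (\<eta> j h) = h" for j x h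
    using \<eta>[of j] carS[of j] by (auto simp: group_isomorphisms_def)
  let ?I = "{..<length ks}"
  let ?E = "cplx_Sum ?I (\<lambda>i. elementary_cplx (ks ! i))"
  \<comment> \<open>In degree \<open>n\<close> the copies of \<open>E_(n+1)\<close> have their lower generator and those of \<open>E_n\<close> their upper one.\<close>
  let ?F = "\<lambda>n (y, z). \<lambda>i\<in>?I. if ks ! i = n + 1 then \<theta> n y i else if ks ! i = n then \<theta> (n - 1) z i else 0"
  let ?G = "\<lambda>n h. (\<eta> n (restrict h (S n)), \<eta> (n - 1) (restrict h (S (n - 1))))"
  have grp: "group (ch (elementary_cplx k) n)" for k n
    by (simp add: elementary_cplx_def)
  have carE: "carrier (ch ?E n) = {h \<in> extensional ?I. \<forall>i\<in>?I. ks ! i \<noteq> n + 1 \<and> ks ! i \<noteq> n \<longrightarrow> h i = 0}" for n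
    by (auto simp: cplx_Sum_def carrier_sum_group grp PiE_def Pi_def) (auto simp: elementary_cplx_def)
  have "?F n \<in> iso (ch (path_cplx A) n) (ch ?E n)" for n
  proof (rule isoI_inverse[where g = "?G n"], rule homI)
    fix x y assume "x \<in> carrier (ch (path_cplx A) n)" "y \<in> carrier (ch (path_cplx A) n)"
    then show "?F n (x \<otimes>\<^bsub>ch (path_cplx A) n\<^esub> y) = ?F n x \<otimes>\<^bsub>ch ?E n\<^esub> ?F n y"
      by (auto simp: path_cplx_def cplx_Sum_def elementary_cplx_def \<theta>h S_def singleton_group_def intro!: restrict_ext)
  next
    fix h assume "h \<in> carrier (ch ?E n)"
    then have h: "h \<in> extensional ?I" "\<And>i. i < length ks \<Longrightarrow> ks ! i \<noteq> n + 1 \<Longrightarrow> ks ! i \<noteq> n \<Longrightarrow> h i = 0"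
      by (auto simp: carE)
    then show "?F n (?G n h) = h"
      by (auto simp: \<theta>\<eta> S_def intro!: extensionalityI[of _ ?I])
  next
    fix x assume "x \<in> carrier (ch (path_cplx A) n)"
    then obtain y z where x: "x = (y, z)" "y \<in> carrier (ch A n)" "z \<in> carrier (ch A (n - 1))"
      by (auto simp: path_cplx_def)
    have "restrict (?F n x) (S n) = \<theta> n y" "restrict (?F n x) (S (n - 1)) = \<theta> (n - 1) z"
      by (rule extensionalityI[of _ "S n"], simp, rule \<theta>c, rule x, simp add: x S_def,
          rule extensionalityI[of _ "S (n - 1)"], simp, rule \<theta>c, rule x, simp add: x S_def)
    then show "?G n (?F n x) = x" using x \<eta>\<theta> by simp
  qed (auto simp: carE \<eta>c path_cplx_def)
  moreover have "?F (n - 1) (bd (path_cplx A) n x) = bd ?E n (?F n x)" if "x \<in> carrier (ch (path_cplx A) n)" for n x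
    using that \<theta>1[of _ "n - 2"]
    by (auto simp: path_cplx_def cplx_Sum_def elementary_cplx_def S_def intro!: restrict_ext)
  ultimately have "cplx_iso (path_cplx A) ?E"
    unfolding cplx_iso_def by (intro exI[of _ ?F]) blast
  then show ?thesis by (rule that)
qed

section \<open>Tensor products with the integers\<close>

lemma (in group) rcoset_eq_iff:
  assumes "subgroup N G" "x \<in> carrier G" "y \<in> carrier G"
  shows "N #> x = N #> y \<longleftrightarrow> x \<otimes> inv y \<in> N"
proof
  assume "N #> x = N #> y"
  then have "x \<in> N #> y" using rcos_self[OF assms(2,1)] by simp
  then show "x \<otimes> inv y \<in> N" using subgroup.rcos_module[OF assms(1) is_group assms(3,2)] by simp
next
  assume "x \<otimes> inv y \<in> N"
  then have "x \<in> N #> y" using subgroup.rcos_module[OF assms(1) is_group assms(3,2)] by simp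
  then show "N #> x = N #> y" using repr_independence[OF _ assms(3,1)] by simp
qed

lemma coset_map_rcoset:
  assumes F: "F \<in> hom G G'" and G: "group G" "group G'" and N: "subgroup N G" and N': "subgroup N' G'"
    and im: "F ` N \<subseteq> N'" and x: "x \<in> carrier G"
  shows "coset_map G' N' F (N #>\<^bsub>G\<^esub> x) = N' #>\<^bsub>G'\<^esub> F x"
proof -
  interpret G: group G by fact
  interpret G': group G' by fact
  interpret F: group_hom G G' F using F by unfold_locales
  have sub: "n \<in> carrier G" if "n \<in> N" for n using subgroup.mem_carrier[OF N that] .
  have sub': "n \<in> carrier G'" if "n \<in> N'" for n using subgroup.mem_carrier[OF N' that] .
  show ?thesis
  proof
    show "coset_map G' N' F (N #>\<^bsub>G\<^esub> x) \<subseteq> N' #>\<^bsub>G'\<^esub> F x"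
    proof
      fix z assume "z \<in> coset_map G' N' F (N #>\<^bsub>G\<^esub> x)"
      then obtain n' n where n: "n' \<in> N'" "n \<in> N" "z = n' \<otimes>\<^bsub>G'\<^esub> F (n \<otimes>\<^bsub>G\<^esub> x)"
        by (auto simp: coset_map_def set_mult_def r_coset_def)
      have "z = (n' \<otimes>\<^bsub>G'\<^esub> F n) \<otimes>\<^bsub>G'\<^esub> F x"
        using n sub sub' x by (simp add: G'.m_assoc)
      moreover have "n' \<otimes>\<^bsub>G'\<^esub> F n \<in> N'" using n im subgroup.m_closed[OF N'] by blast
      ultimately show "z \<in> N' #>\<^bsub>G'\<^esub> F x" by (auto simp: r_coset_def)
    qed
    show "N' #>\<^bsub>G'\<^esub> F x \<subseteq> coset_map G' N' F (N #>\<^bsub>G\<^esub> x)"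
    proof -
      have Fx: "F x \<in> F ` (N #>\<^bsub>G\<^esub> x)" using G.rcos_self[OF x N] by (rule imageI)
      show ?thesis
      proof
        fix z assume "z \<in> N' #>\<^bsub>G'\<^esub> F x"
        then obtain h where h: "h \<in> N'" "z = h \<otimes>\<^bsub>G'\<^esub> F x" by (auto simp: r_coset_def)
        show "z \<in> coset_map G' N' F (N #>\<^bsub>G\<^esub> x)"
          unfolding coset_map_def set_mult_def h(2) by (rule UN_I[OF h(1)], rule UN_I[OF Fx]) simp
      qed
    qed
  qed
qed

lemma coset_map_hom:
  assumes F: "F \<in> hom G G'" and G: "comm_group G" "comm_group G'" and N: "subgroup N G" and N': "subgroup N' G'"
    and im: "F ` N \<subseteq> N'"
  shows "coset_map G' N' F \<in> hom (G Mod N) (G' Mod N')"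
proof (rule homI)
  interpret G: comm_group G by fact
  interpret G': comm_group G' by fact
  interpret N: normal N G using N by (simp add: G.normal_iff_subgroup)
  interpret N': normal N' G' using N' by (simp add: G'.normal_iff_subgroup)
  note cm = coset_map_rcoset[OF F G.is_group G'.is_group N N' im]
  fix X assume "X \<in> carrier (G Mod N)"
  then obtain x where x: "x \<in> carrier G" "X = N #>\<^bsub>G\<^esub> x" by (auto simp: carrier_FactGroup)
  then show "coset_map G' N' F X \<in> carrier (G' Mod N')"
    using hom_in_carrier[OF F] by (simp add: cm carrier_FactGroup)
  fix Y assume "Y \<in> carrier (G Mod N)"
  then obtain y where y: "y \<in> carrier G" "Y = N #>\<^bsub>G\<^esub> y" by (auto simp: carrier_FactGroup)
  show "coset_map G' N' F (X \<otimes>\<^bsub>G Mod N\<^esub> Y) = coset_map G' N' F X \<otimes>\<^bsub>G' Mod N'\<^esub> coset_map G' N' F Y"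
    using x y hom_in_carrier[OF F] by (simp add: N.rcos_sum N'.rcos_sum cm hom_mult[OF F])
qed

definition tensor_elem :: "'a monoid \<Rightarrow> 'b monoid \<Rightarrow> 'a \<Rightarrow> 'b \<Rightarrow> ('a \<times> 'b \<Rightarrow>\<^sub>0 int) set" where
  "tensor_elem A B a b =
     tensor_relators A B #>\<^bsub>free_Abelian_group (carrier A \<times> carrier B)\<^esub> frag_of (a, b)"

locale tensor_pair =
  fixes A :: "'a monoid" and B :: "'b monoid"
  assumes A: "comm_group A" and B: "comm_group B"
begin

sublocale A: comm_group A by (rule A)
sublocale B: comm_group B by (rule B)

abbreviation "FR \<equiv> free_Abelian_group (carrier A \<times> carrier B)"
abbreviation "N \<equiv> tensor_relators A B"
abbreviation "T \<equiv> tensor_group A B"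

definition "bilinear_relators = {frag_of (a \<otimes>\<^bsub>A\<^esub> a', b) - frag_of (a, b) - frag_of (a', b) | a a' b.
           a \<in> carrier A \<and> a' \<in> carrier A \<and> b \<in> carrier B} \<union>
        {frag_of (a, b \<otimes>\<^bsub>B\<^esub> b') - frag_of (a, b) - frag_of (a, b') | a b b'.
           a \<in> carrier A \<and> b \<in> carrier B \<and> b' \<in> carrier B}"

lemma N_eq: "N = generate FR bilinear_relators"
  by (simp add: tensor_relators_def bilinear_relators_def)

lemma relators_carrier: "bilinear_relators \<subseteq> carrier FR"
  by (auto simp: bilinear_relators_def dest!: subsetD[OF keys_diff])

lemma subgroup_N: "subgroup N FR"
  unfolding N_eq by (rule group.generate_is_subgroup[OF group_free_Abelian_group relators_carrier])

sublocale T: comm_group T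
  unfolding tensor_group_def
  by (rule comm_group.abelian_FactGroup[OF abelian_free_Abelian_group subgroup_N])

sublocale N: normal N FR
  using subgroup_N by (simp add: comm_group.normal_iff_subgroup abelian_free_Abelian_group)

lemma coset_eq:
  assumes "x \<in> carrier FR" "y \<in> carrier FR" "x - y \<in> N"
  shows "N #>\<^bsub>FR\<^esub> x = N #>\<^bsub>FR\<^esub> y"
  using assms group.rcoset_eq_iff[OF group_free_Abelian_group subgroup_N assms(1,2)] by simp

lemma coset_mult: "x \<in> carrier FR \<Longrightarrow> y \<in> carrier FR \<Longrightarrow>
    (N #>\<^bsub>FR\<^esub> x) \<otimes>\<^bsub>T\<^esub> (N #>\<^bsub>FR\<^esub> y) = N #>\<^bsub>FR\<^esub> (x + y)"
  by (simp add: tensor_group_def N.rcos_sum)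

lemma tensor_elem_closed [simp]:
  "a \<in> carrier A \<Longrightarrow> b \<in> carrier B \<Longrightarrow> tensor_elem A B a b \<in> carrier T"
  by (auto simp: tensor_elem_def tensor_group_def carrier_FactGroup)

lemma tensor_elem_mult_left:
  assumes "a \<in> carrier A" "a' \<in> carrier A" "b \<in> carrier B"
  shows "tensor_elem A B (a \<otimes>\<^bsub>A\<^esub> a') b = tensor_elem A B a b \<otimes>\<^bsub>T\<^esub> tensor_elem A B a' b"
proof -
  have "frag_of (a \<otimes>\<^bsub>A\<^esub> a', b) - (frag_of (a, b) + frag_of (a', b)) \<in> N"
    unfolding N_eq using assms by (intro generate.incl) (auto simp: bilinear_relators_def diff_diff_eq)
  then show ?thesis
    using assms by (simp add: tensor_elem_def coset_mult) (rule coset_eq, auto dest!: subsetD[OF keys_add])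
qed

lemma tensor_elem_mult_right:
  assumes "a \<in> carrier A" "b \<in> carrier B" "b' \<in> carrier B"
  shows "tensor_elem A B a (b \<otimes>\<^bsub>B\<^esub> b') = tensor_elem A B a b \<otimes>\<^bsub>T\<^esub> tensor_elem A B a b'"
proof -
  have "frag_of (a, b \<otimes>\<^bsub>B\<^esub> b') - (frag_of (a, b) + frag_of (a, b')) \<in> N"
    unfolding N_eq using assms by (intro generate.incl) (auto simp: bilinear_relators_def diff_diff_eq)
  then show ?thesis
    using assms by (simp add: tensor_elem_def coset_mult) (rule coset_eq, auto dest!: subsetD[OF keys_add])
qed

lemma tensor_group_generated:
  assumes K: "subgroup K T" and elem: "\<And>a b. a \<in> carrier A \<Longrightarrow> b \<in> carrier B \<Longrightarrow> tensor_elem A B a b \<in> K"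
  shows "carrier T \<subseteq> K"
proof
  fix X assume "X \<in> carrier T"
  then obtain x where x: "x \<in> carrier FR" "X = N #>\<^bsub>FR\<^esub> x"
    by (auto simp: tensor_group_def carrier_FactGroup)
  have "N #>\<^bsub>FR\<^esub> x \<in> K"
  proof (rule free_Abelian_group_induct[of x "carrier A \<times> carrier B"])
    show "Poly_Mapping.keys x \<subseteq> carrier A \<times> carrier B" using x by simp
    have "N #>\<^bsub>FR\<^esub> 0 = \<one>\<^bsub>T\<^esub>"
      using group.coset_mult_one[OF group_free_Abelian_group N.subset] by (simp add: tensor_group_def)
    then show "N #>\<^bsub>FR\<^esub> 0 \<in> K" using subgroup.one_closed[OF K] by simp
    show "N #>\<^bsub>FR\<^esub> frag_of p \<in> K" if "p \<in> carrier A \<times> carrier B" for p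
      using elem that by (auto simp: tensor_elem_def)
    fix y z assume yz: "Poly_Mapping.keys y \<subseteq> carrier A \<times> carrier B" "Poly_Mapping.keys z \<subseteq> carrier A \<times> carrier B"
      "N #>\<^bsub>FR\<^esub> y \<in> K" "N #>\<^bsub>FR\<^esub> z \<in> K"
    have d: "y - z \<in> carrier FR" using yz keys_diff[of y z] by auto
    have "(N #>\<^bsub>FR\<^esub> (y - z)) \<otimes>\<^bsub>T\<^esub> (N #>\<^bsub>FR\<^esub> z) = N #>\<^bsub>FR\<^esub> y"
      using coset_mult[OF d, of z] yz by simp
    moreover have "N #>\<^bsub>FR\<^esub> (y - z) \<in> carrier T"
      using d by (auto simp: tensor_group_def carrier_FactGroup)
    ultimately have "N #>\<^bsub>FR\<^esub> (y - z) = (N #>\<^bsub>FR\<^esub> y) \<otimes>\<^bsub>T\<^esub> inv\<^bsub>T\<^esub> (N #>\<^bsub>FR\<^esub> z)"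
      using yz subgroup.mem_carrier[OF K] by (intro T.inv_solve_right[THEN iffD2]) auto
    then show "N #>\<^bsub>FR\<^esub> (y - z) \<in> K"
      using yz subgroup.m_closed[OF K] subgroup.m_inv_closed[OF K] by simp
  qed
  then show "X \<in> K" using x by simp
qed

end

lemma
  assumes A: "comm_group A" "comm_group A'" and B: "comm_group B" "comm_group B'"
    and f: "f \<in> hom A A'" and g: "g \<in> hom B B'"
  shows tensor_map_hom: "tensor_map A' B' f g \<in> hom (tensor_group A B) (tensor_group A' B')"
    and tensor_map_elem: "a \<in> carrier A \<Longrightarrow> b \<in> carrier B \<Longrightarrow>
      tensor_map A' B' f g (tensor_elem A B a b) = tensor_elem A' B' (f a) (g b)"
proof -
  interpret S: tensor_pair A B by (rule tensor_pair.intro) fact+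
  interpret S': tensor_pair A' B' by (rule tensor_pair.intro) fact+
  let ?F = "frag_extend (\<lambda>(a, b). frag_of (f a, g b))"
  have fc: "f a \<in> carrier A'" if "a \<in> carrier A" for a using hom_in_carrier[OF f that] .
  have gc: "g b \<in> carrier B'" if "b \<in> carrier B" for b using hom_in_carrier[OF g that] .
  have F: "?F \<in> hom S.FR S'.FR"
  proof (rule homI)
    fix x assume "x \<in> carrier S.FR"
    then have x: "Poly_Mapping.keys x \<subseteq> carrier A \<times> carrier B" by simp
    have "Poly_Mapping.keys (?F x) \<subseteq> (\<Union>p\<in>Poly_Mapping.keys x. Poly_Mapping.keys (case p of (a, b) \<Rightarrow> frag_of (f a, g b)))"
      by (rule keys_frag_extend)
    also have "\<dots> \<subseteq> carrier A' \<times> carrier B'" using x fc gc by auto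
    finally show "?F x \<in> carrier S'.FR" by simp
  qed (simp add: frag_extend_add)
  interpret F: group_hom S.FR S'.FR ?F using F by unfold_locales simp_all
  have "?F r \<in> S'.bilinear_relators" if "r \<in> S.bilinear_relators" for r
    using that fc gc hom_mult[OF f] hom_mult[OF g]
    unfolding S.bilinear_relators_def S'.bilinear_relators_def
    by (auto simp: frag_extend_diff) metis+
  then have "?F ` S.bilinear_relators \<subseteq> S'.bilinear_relators" by blast
  then have im: "?F ` S.N \<subseteq> S'.N"
    unfolding S.N_eq S'.N_eq F.generate_img[OF S.relators_carrier, symmetric]
    by (rule group.mono_generate[OF group_free_Abelian_group])
  show "tensor_map A' B' f g \<in> hom (tensor_group A B) (tensor_group A' B')"
    unfolding tensor_map_def tensor_group_def
    by (rule coset_map_hom[OF F abelian_free_Abelian_group abelian_free_Abelian_group S.subgroup_N S'.subgroup_N im])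
  show "tensor_map A' B' f g (tensor_elem A B a b) = tensor_elem A' B' (f a) (g b)"
    if "a \<in> carrier A" "b \<in> carrier B"
    unfolding tensor_map_def tensor_elem_def
    using that by (subst coset_map_rcoset[OF F group_free_Abelian_group group_free_Abelian_group S.subgroup_N S'.subgroup_N im]) simp_all
qed

lemma mult_singleton: "x \<otimes>\<^bsub>singleton_group a\<^esub> y = a"
  by (simp add: singleton_group_def)

text \<open>Since \<open>0 + 0 = 0\<close>, each \<open>a \<otimes> 0\<close> is its own double.\<close>
lemma tensor_singleton_trivial:
  assumes A: "comm_group A"
  shows "trivial_group (tensor_group A (singleton_group 0))"
proof -
  interpret tensor_pair A "singleton_group 0" by (rule tensor_pair.intro) (simp_all add: A)
  have "tensor_elem A (singleton_group 0) a 0 = \<one>\<^bsub>T\<^esub>" if "a \<in> carrier A" for a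
  proof -
    have "tensor_elem A (singleton_group 0) a 0 \<otimes>\<^bsub>T\<^esub> tensor_elem A (singleton_group 0) a 0 = tensor_elem A (singleton_group 0) a 0"
      using tensor_elem_mult_right[of a 0 0] that by (simp add: mult_singleton)
    then show ?thesis using that by (simp add: T.l_cancel_one')
  qed
  then have "carrier T \<subseteq> {\<one>\<^bsub>T\<^esub>}"
    by (intro tensor_group_generated T.triv_subgroup) auto
  then show ?thesis by (auto simp: trivial_group_def)
qed

text \<open>Surjectivity: \<open>a \<otimes> k = k a \<otimes> 1\<close>, and pure tensors generate. Injectivity: the homomorphism \<open>(a, k) \<mapsto> k a\<close> on the free
group kills the relators and recovers \<open>a\<close> from \<open>a \<otimes> 1\<close>.\<close>
lemma tensor_integer_iso:
  assumes A: "comm_group A"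
  shows "(\<lambda>a. tensor_elem A integer_group a 1) \<in> iso A (tensor_group A integer_group)"
proof -
  interpret tensor_pair A integer_group by (rule tensor_pair.intro) (simp_all add: A abelian_integer_group)
  let ?\<tau> = "\<lambda>a. tensor_elem A integer_group a 1"
  have hom: "?\<tau> \<in> hom A T"
    by (rule homI) (simp_all add: tensor_elem_mult_left)
  interpret \<tau>: group_hom A T ?\<tau> using hom by unfold_locales
  have "tensor_elem A integer_group a k \<in> ?\<tau> ` carrier A" if a: "a \<in> carrier A" for a k
  proof -
    have h: "tensor_elem A integer_group a \<in> hom integer_group T"
      using tensor_elem_mult_right[OF a] a by (intro homI) auto
    have "tensor_elem A integer_group a (1 [^]\<^bsub>integer_group\<^esub> k) = ?\<tau> a [^]\<^bsub>T\<^esub> k"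
      by (rule hom_int_pow[OF h]) simp_all
    also have "\<dots> = ?\<tau> (a [^]\<^bsub>A\<^esub> k)"
      using a by (simp add: \<tau>.hom_int_pow)
    finally show ?thesis using a by simp
  qed
  then have "carrier T \<subseteq> ?\<tau> ` carrier A"
    using \<tau>.img_is_subgroup by (intro tensor_group_generated) auto
  moreover have "inj_on ?\<tau> (carrier A)"
  proof -
    have pc: "a [^]\<^bsub>A\<^esub> k \<in> carrier A" if "a \<in> carrier A" for a and k :: int
      using that by simp
    have "(\<lambda>(a, k :: int). a [^]\<^bsub>A\<^esub> k) ` (carrier A \<times> carrier integer_group) \<subseteq> carrier A"
      using pc by (simp add: image_subset_iff)
    then obtain h where h: "h \<in> hom FR A"
      "\<And>p. p \<in> carrier A \<times> carrier integer_group \<Longrightarrow> h (frag_of p) = (case p of (a, k) \<Rightarrow> a [^]\<^bsub>A\<^esub> k)"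
      using A.free_Abelian_group_universal by blast
    interpret h: group_hom FR A h using h(1) by unfold_locales simp_all
    have hd: "h (x - y) = h x \<otimes>\<^bsub>A\<^esub> inv\<^bsub>A\<^esub> h y" if "x \<in> carrier FR" "y \<in> carrier FR" for x y
    proof -
      have "h (x \<otimes>\<^bsub>FR\<^esub> inv\<^bsub>FR\<^esub> y) = h x \<otimes>\<^bsub>A\<^esub> inv\<^bsub>A\<^esub> h y"
        using that by (metis h.hom_mult h.hom_inv group.inv_closed group_free_Abelian_group)
      then show ?thesis using that by simp
    qed
    have "h r = \<one>\<^bsub>A\<^esub>" if "r \<in> bilinear_relators" for r
    proof -
      have d: "h (frag_of p - frag_of q - frag_of s) = h (frag_of p) \<otimes>\<^bsub>A\<^esub> inv\<^bsub>A\<^esub> h (frag_of q) \<otimes>\<^bsub>A\<^esub> inv\<^bsub>A\<^esub> h (frag_of s)"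
        if "p \<in> carrier A \<times> UNIV" "q \<in> carrier A \<times> UNIV" "s \<in> carrier A \<times> UNIV" for p q s
      proof -
        have "frag_of p - frag_of q \<in> carrier FR" using that keys_diff[of "frag_of p" "frag_of q"] by auto
        then show ?thesis using that by (simp add: hd)
      qed
      have c: "x \<otimes>\<^bsub>A\<^esub> y \<otimes>\<^bsub>A\<^esub> inv\<^bsub>A\<^esub> x \<otimes>\<^bsub>A\<^esub> inv\<^bsub>A\<^esub> y = \<one>\<^bsub>A\<^esub>" if "x \<in> carrier A" "y \<in> carrier A" for x y
        using that by (simp add: A.m_assoc A.m_comm[of "inv\<^bsub>A\<^esub> x" "inv\<^bsub>A\<^esub> y"]) (simp add: A.m_assoc[symmetric])
      have pd: "(x \<otimes>\<^bsub>A\<^esub> y) [^]\<^bsub>A\<^esub> k = x [^]\<^bsub>A\<^esub> k \<otimes>\<^bsub>A\<^esub> y [^]\<^bsub>A\<^esub> k" if "x \<in> carrier A" "y \<in> carrier A" for x y and k :: int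
        using that by (simp add: A.int_pow_mult_distrib A.m_comm)
      show ?thesis
        using that unfolding bilinear_relators_def
        by (auto simp: d h(2) pd A.int_pow_mult c)
    qed
    then have "bilinear_relators \<subseteq> kernel FR A h"
      using relators_carrier unfolding kernel_def by blast
    then have ker: "N \<subseteq> kernel FR A h"
      unfolding N_eq by (intro group.generate_subgroup_incl h.subgroup_kernel) simp_all
    show ?thesis
    proof (rule inj_onI)
      fix a a' assume a: "a \<in> carrier A" "a' \<in> carrier A" "?\<tau> a = ?\<tau> a'"
      then have "frag_of (a, 1) - frag_of (a', 1) \<in> N"
        using group.rcoset_eq_iff[OF group_free_Abelian_group subgroup_N, of "frag_of (a, 1)" "frag_of (a', 1)"]
        by (simp add: tensor_elem_def)
      then have "h (frag_of (a, 1) - frag_of (a', 1)) = \<one>\<^bsub>A\<^esub>" using ker by (auto simp: kernel_def)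
      then have "a \<otimes>\<^bsub>A\<^esub> inv\<^bsub>A\<^esub> a' = \<one>\<^bsub>A\<^esub>" using a by (simp add: hd h(2))
      then show "a = a'" using a A.inv_equality A.inv_inv by (metis A.inv_closed A.inv_comm)
    qed
  qed
  ultimately show ?thesis using hom \<tau>.hom_closed by (auto simp: iso_iff)
qed

lemma comm_group_elementary_cplx: "comm_group (ch (elementary_cplx k) n)"
  by (simp add: elementary_cplx_def abelian_integer_group)

lemma elementary_cplx_bd_hom: "bd (elementary_cplx k) n \<in> hom (ch (elementary_cplx k) n) (ch (elementary_cplx k) (n - 1))"
  by (rule homI) (auto simp: elementary_cplx_def mult_singleton)

text \<open>In degree \<open>n\<close> only the components of index \<open>n\<close> and \<open>n - 1\<close> of the tensor product are nontrivial. An element is therefore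
\<open>y \<otimes> e_0 + z \<otimes> e_1\<close>, with boundary \<open>(d y + (-1)\<^sup>n\<^sup>-\<^sup>1 z) \<otimes> e_0 + d z \<otimes> e_1\<close>. Taking the coefficient
\<open>w\<close> of \<open>e_0\<close> in the boundary as a coordinate in place of \<open>z\<close> gives the path complex.\<close>
lemma cplx_tensor_elementary_path:
  assumes A: "chain_complex A"
  shows "cplx_iso (path_cplx A) (cplx_tensor A (elementary_cplx 1))"
    and "chain_complex (cplx_tensor A (elementary_cplx 1))"
proof -
  let ?E = "elementary_cplx 1" and ?X = "cplx_tensor A (elementary_cplx 1)"
  have gA: "comm_group (ch A i)" for i by (rule chain_complexD[OF A])
  define G where "G n i = tensor_group (ch A i) (ch ?E (n - i))" for n i
  define \<tau> where "\<tau> i a = tensor_elem (ch A i) integer_group a 1" for i a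
  have chX: "ch ?X n = sum_group UNIV (G n)" for n
    by (simp add: cplx_tensor_def G_def[abs_def])
  have commG: "comm_group (G n i)" for n i
  proof -
    interpret tensor_pair "ch A i" "ch ?E (n - i)"
      by (rule tensor_pair.intro) (simp_all add: gA comm_group_elementary_cplx)
    show ?thesis unfolding G_def by (rule T.comm_group_axioms)
  qed
  then have grpG: "group (G n i)" for n i by (simp add: comm_group_def)
  have \<tau>: "\<tau> i \<in> iso (ch A i) (G n i)" if "i = n \<or> i = n - 1" for n i
  proof -
    have "ch ?E (n - i) = integer_group" using that by (auto simp: elementary_cplx_def)
    then show ?thesis
      using tensor_integer_iso[OF gA[of i]] by (simp add: G_def \<tau>_def[abs_def])
  qed
  have triv: "carrier (G n i) = {\<one>\<^bsub>G n i\<^esub>}" if "i \<noteq> n" "i \<noteq> n - 1" for n i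
  proof -
    have "ch ?E (n - i) = singleton_group 0" using that by (auto simp: elementary_cplx_def)
    moreover have "trivial_group (tensor_group (ch A i) (singleton_group (0::int)))"
      by (rule tensor_singleton_trivial[OF gA])
    ultimately show ?thesis by (simp add: G_def trivial_group_def)
  qed
  \<comment> \<open>\<open>\<zeta>\<close> recovers \<open>z\<close> from \<open>w = d y + (-1)\<^sup>n\<^sup>-\<^sup>1 z\<close>; the sign is its own inverse.\<close>
  define sg :: "int \<Rightarrow> int" where "sg i = (if even i then 1 else - 1)" for i
  define \<zeta> where "\<zeta> n y w = (w \<otimes>\<^bsub>ch A (n - 1)\<^esub> inv\<^bsub>ch A (n - 1)\<^esub> bd A n y) [^]\<^bsub>ch A (n - 1)\<^esub> sg (n - 1)" for n y w
  define M where "M n = (\<lambda>(y, w) i. if i = n then \<tau> n y else if i = n - 1 then \<tau> (n - 1) (\<zeta> n y w) else \<one>\<^bsub>G n i\<^esub>)" for n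
  have carX: "carrier (ch ?X n) = {x. \<forall>i. x i \<in> carrier (G n i)}" for n
  proof -
    have "finite {i. x i \<noteq> \<one>\<^bsub>G n i\<^esub>}" if "\<forall>i. x i \<in> carrier (G n i)" for x
    proof (rule finite_subset)
      show "{i. x i \<noteq> \<one>\<^bsub>G n i\<^esub>} \<subseteq> {n, n - 1}" using that triv by fastforce
    qed simp
    then show ?thesis by (auto simp: chX carrier_sum_group grpG)
  qed
  have \<zeta>h: "\<zeta> n (y \<otimes>\<^bsub>ch A n\<^esub> y') (w \<otimes>\<^bsub>ch A (n - 1)\<^esub> w') = \<zeta> n y w \<otimes>\<^bsub>ch A (n - 1)\<^esub> \<zeta> n y' w'"
    if "y \<in> carrier (ch A n)" "y' \<in> carrier (ch A n)" "w \<in> carrier (ch A (n - 1))" "w' \<in> carrier (ch A (n - 1))" for n y y' w w'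
  proof -
    interpret A1: comm_group "ch A (n - 1)" by (rule gA)
    have d: "bd A n y \<in> carrier (ch A (n - 1))" "bd A n y' \<in> carrier (ch A (n - 1))"
      using that chain_complexD(2)[OF A, of n] by (auto intro: hom_in_carrier)
    have "w \<otimes>\<^bsub>ch A (n - 1)\<^esub> w' \<otimes>\<^bsub>ch A (n - 1)\<^esub> inv\<^bsub>ch A (n - 1)\<^esub> bd A n (y \<otimes>\<^bsub>ch A n\<^esub> y')
       = (w \<otimes>\<^bsub>ch A (n - 1)\<^esub> inv\<^bsub>ch A (n - 1)\<^esub> bd A n y) \<otimes>\<^bsub>ch A (n - 1)\<^esub> (w' \<otimes>\<^bsub>ch A (n - 1)\<^esub> inv\<^bsub>ch A (n - 1)\<^esub> bd A n y')"
      using that d by (simp add: hom_mult[OF chain_complexD(2)[OF A]] A1.inv_mult A1.m_ac)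
    then show ?thesis
      using that d by (simp add: \<zeta>_def A1.int_pow_mult_distrib A1.m_comm)
  qed
  have \<zeta>c: "\<zeta> n y w \<in> carrier (ch A (n - 1))" if "y \<in> carrier (ch A n)" "w \<in> carrier (ch A (n - 1))" for n y w
  proof -
    interpret A1: comm_group "ch A (n - 1)" by (rule gA)
    show ?thesis using that hom_in_carrier[OF chain_complexD(2)[OF A, of n]] by (simp add: \<zeta>_def)
  qed
  have isoM: "M n \<in> iso (ch (path_cplx A) n) (ch ?X n)" for n
  proof -
    interpret A0: comm_group "ch A n" by (rule gA)
    interpret A1: comm_group "ch A (n - 1)" by (rule gA)
    have t0: "\<tau> n \<in> iso (ch A n) (G n n)" and t1: "\<tau> (n - 1) \<in> iso (ch A (n - 1)) (G n (n - 1))"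
      by (auto intro: \<tau>)
    have "M n \<in> hom (ch (path_cplx A) n) (ch ?X n)"
    proof (rule homI)
      fix x assume "x \<in> carrier (ch (path_cplx A) n)"
      then show "M n x \<in> carrier (ch ?X n)"
        using hom_in_carrier[OF iso_imp_homomorphism[OF t0]] hom_in_carrier[OF iso_imp_homomorphism[OF t1]] \<zeta>c[of _ n]
        by (auto simp: carX M_def path_cplx_def group.is_monoid[OF grpG] monoid.one_closed)
      fix x' assume "x' \<in> carrier (ch (path_cplx A) n)"
      with \<open>x \<in> carrier (ch (path_cplx A) n)\<close> show "M n (x \<otimes>\<^bsub>ch (path_cplx A) n\<^esub> x') = M n x \<otimes>\<^bsub>ch ?X n\<^esub> M n x'"
        using hom_mult[OF iso_imp_homomorphism[OF t0]] hom_mult[OF iso_imp_homomorphism[OF t1]]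
        by (auto simp: chX M_def path_cplx_def \<zeta>h \<zeta>c group.is_monoid[OF grpG] monoid.l_one monoid.one_closed fun_eq_iff)
    qed
    moreover have "inj_on (M n) (carrier (ch (path_cplx A) n))"
    proof (rule inj_onI)
      fix x x' assume x: "x \<in> carrier (ch (path_cplx A) n)" "x' \<in> carrier (ch (path_cplx A) n)" "M n x = M n x'"
      obtain y w y' w' where xy: "x = (y, w)" "x' = (y', w')" by fastforce
      with x have c: "y \<in> carrier (ch A n)" "y' \<in> carrier (ch A n)" "w \<in> carrier (ch A (n - 1))" "w' \<in> carrier (ch A (n - 1))"
        by (auto simp: path_cplx_def)
      have "\<tau> n y = \<tau> n y'" "\<tau> (n - 1) (\<zeta> n y w) = \<tau> (n - 1) (\<zeta> n y' w')"
        using fun_cong[OF x(3), of n] fun_cong[OF x(3), of "n - 1"] by (simp_all add: M_def xy)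
      then have y: "y = y'" and z: "\<zeta> n y w = \<zeta> n y' w'"
        using t0 t1 c \<zeta>c[of _ n] by (auto simp: iso_iff inj_on_def)
      have d: "bd A n y' \<in> carrier (ch A (n - 1))"
        using c hom_in_carrier[OF chain_complexD(2)[OF A, of n]] by simp
      have "w \<otimes>\<^bsub>ch A (n - 1)\<^esub> inv\<^bsub>ch A (n - 1)\<^esub> bd A n y' = w' \<otimes>\<^bsub>ch A (n - 1)\<^esub> inv\<^bsub>ch A (n - 1)\<^esub> bd A n y'"
        using z c d unfolding \<zeta>_def sg_def y
        by (auto simp: A1.int_pow_neg A1.int_pow_1 split: if_splits dest!: A1.inv_inj[THEN inj_onD])
      then show "x = x'" using c d y xy by simp
    qed
    moreover have "X \<in> M n ` carrier (ch (path_cplx A) n)" if "X \<in> carrier (ch ?X n)" for X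
    proof -
      have X: "X i \<in> carrier (G n i)" for i using that by (simp add: carX)
      obtain y where y: "y \<in> carrier (ch A n)" "X n = \<tau> n y"
        using X[of n] t0 by (auto simp: iso_iff)
      obtain z where z: "z \<in> carrier (ch A (n - 1))" "X (n - 1) = \<tau> (n - 1) z"
        using X[of "n - 1"] t1 by (auto simp: iso_iff)
      define w where "w = (z [^]\<^bsub>ch A (n - 1)\<^esub> sg (n - 1)) \<otimes>\<^bsub>ch A (n - 1)\<^esub> bd A n y"
      have d: "bd A n y \<in> carrier (ch A (n - 1))"
        using y hom_in_carrier[OF chain_complexD(2)[OF A, of n]] by simp
      have w: "w \<in> carrier (ch A (n - 1))" using z d by (simp add: w_def)
      have "\<zeta> n y w = (z [^]\<^bsub>ch A (n - 1)\<^esub> sg (n - 1)) [^]\<^bsub>ch A (n - 1)\<^esub> sg (n - 1)"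
        using z d by (simp add: \<zeta>_def w_def A1.m_assoc)
      also have "\<dots> = z" using z by (simp add: sg_def A1.int_pow_neg A1.int_pow_1)
      finally have "\<zeta> n y w = z" .
      moreover have "X i = \<one>\<^bsub>G n i\<^esub>" if "i \<noteq> n" "i \<noteq> n - 1" for i
        using X[of i] triv[OF that] by simp
      ultimately have "X = M n (y, w)"
        using y(2) z(2) unfolding M_def by (intro ext) simp
      then show ?thesis using y w by (auto simp: path_cplx_def)
    qed
    ultimately show ?thesis
      using hom_in_carrier[of "M n" "ch (path_cplx A) n" "ch ?X n"] by (auto simp: iso_iff)
  qed
  have comm: "M (n - 1) (bd (path_cplx A) n x) = bd ?X n (M n x)" if x: "x \<in> carrier (ch (path_cplx A) n)" for n x
  proof
    fix i
    obtain y w where xy: "x = (y, w)" "y \<in> carrier (ch A n)" "w \<in> carrier (ch A (n - 1))"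
      using x by (auto simp: path_cplx_def)
    interpret A1: comm_group "ch A (n - 1)" by (rule gA)
    interpret A2: comm_group "ch A (n - 2)" by (rule gA)
    interpret d1: group_hom "ch A (n - 1)" "ch A (n - 2)" "bd A (n - 1)"
      using chain_complexD(2)[OF A, of "n - 1"] by unfold_locales simp
    have d: "bd A n y \<in> carrier (ch A (n - 1))" "bd A (n - 1) w \<in> carrier (ch A (n - 2))"
      "bd A (n - 1) (bd A n y) = \<one>\<^bsub>ch A (n - 2)\<^esub>"
      using xy hom_in_carrier[OF chain_complexD(2)[OF A, of n]] chain_complexD(3)[OF A xy(2)] by simp_all
    let ?X1 = "M n x"
    define P where "P = tensor_map (ch A i) (ch ?E (n - 1 - i)) (bd A (i + 1)) id (?X1 (i + 1))"
    define Q where "Q = tensor_map (ch A i) (ch ?E (n - 1 - i)) id (bd ?E (n - i)) (?X1 i)"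
    have bdX: "bd ?X n ?X1 i = P \<otimes>\<^bsub>G (n - 1) i\<^esub> Q [^]\<^bsub>G (n - 1) i\<^esub> sg i"
      by (simp add: cplx_tensor_def Let_def P_def Q_def G_def sg_def)
    have X1: "?X1 j \<in> carrier (G n j)" for j
      using iso_imp_homomorphism[OF isoM[of n], THEN hom_in_carrier, OF x] by (simp add: carX)
    have Ph: "tensor_map (ch A i) (ch ?E (n - 1 - i)) (bd A (i + 1)) id \<in> hom (G n (i + 1)) (G (n - 1) i)"
      using tensor_map_hom[OF gA gA comm_group_elementary_cplx comm_group_elementary_cplx, of "bd A (i + 1)" "i + 1" i id 1 "n - (i + 1)" 1 "n - 1 - i"]
        chain_complexD(2)[OF A, of "i + 1"] by (simp add: G_def algebra_simps iso_imp_homomorphism[OF id_iso])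
    have Qh: "tensor_map (ch A i) (ch ?E (n - 1 - i)) id (bd ?E (n - i)) \<in> hom (G n i) (G (n - 1) i)"
      using tensor_map_hom[OF gA gA comm_group_elementary_cplx comm_group_elementary_cplx, of id i i "bd ?E (n - i)" 1 "n - i" 1 "n - 1 - i"]
        elementary_cplx_bd_hom[of 1 "n - i"] by (simp add: G_def algebra_simps iso_imp_homomorphism[OF id_iso])
    have P: "P \<in> carrier (G (n - 1) i)" unfolding P_def using hom_in_carrier[OF Ph X1] .
    have Q: "Q \<in> carrier (G (n - 1) i)" unfolding Q_def using hom_in_carrier[OF Qh X1] .
    interpret Gi: comm_group "G (n - 1) i" by (rule commG)
    consider (top) "i = n - 1" | (bot) "i = n - 2" | (other) "i \<noteq> n - 1" "i \<noteq> n - 2" by blast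
    then show "M (n - 1) (bd (path_cplx A) n x) i = bd ?X n ?X1 i"
    proof cases
      case top
      have E: "ch ?E 0 = integer_group" "ch ?E 1 = integer_group" "bd ?E 1 = id" by (auto simp: elementary_cplx_def)
      have t: "\<tau> (n - 1) \<in> hom (ch A (n - 1)) (G (n - 1) i)"
        using \<tau>[of "n - 1" "n - 1"] top by (simp add: iso_imp_homomorphism)
      have "P = \<tau> (n - 1) (bd A n y)"
        using tensor_map_elem[OF gA[of n] gA[of "n - 1"] abelian_integer_group abelian_integer_group _ iso_imp_homomorphism[OF id_iso], of "bd A n" y 1]
          chain_complexD(2)[OF A, of n] xy
        by (simp add: P_def top E M_def \<tau>_def)
      moreover have "Q = \<tau> (n - 1) (\<zeta> n y w)"
        using tensor_map_elem[OF gA[of "n - 1"] gA[of "n - 1"] abelian_integer_group abelian_integer_group iso_imp_homomorphism[OF id_iso] iso_imp_homomorphism[OF id_iso], of "\<zeta> n y w" 1] \<zeta>c[of y n w] xy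
        by (simp add: Q_def top E M_def \<tau>_def)
      moreover have "\<zeta> n y w [^]\<^bsub>ch A (n - 1)\<^esub> sg i = w \<otimes>\<^bsub>ch A (n - 1)\<^esub> inv\<^bsub>ch A (n - 1)\<^esub> bd A n y"
        using xy d by (simp add: \<zeta>_def top sg_def A1.int_pow_neg A1.int_pow_1)
      moreover have "\<tau> (n - 1) (\<zeta> n y w) [^]\<^bsub>G (n - 1) i\<^esub> sg i = \<tau> (n - 1) (\<zeta> n y w [^]\<^bsub>ch A (n - 1)\<^esub> sg i)"
        using hom_int_pow[OF t \<zeta>c[OF xy(2,3)] A1.is_group Gi.is_group] by simp
      ultimately have "bd ?X n ?X1 i = \<tau> (n - 1) (bd A n y \<otimes>\<^bsub>ch A (n - 1)\<^esub> (w \<otimes>\<^bsub>ch A (n - 1)\<^esub> inv\<^bsub>ch A (n - 1)\<^esub> bd A n y))"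
        using bdX hom_mult[OF t] xy d by simp
      also have "bd A n y \<otimes>\<^bsub>ch A (n - 1)\<^esub> (w \<otimes>\<^bsub>ch A (n - 1)\<^esub> inv\<^bsub>ch A (n - 1)\<^esub> bd A n y) = w"
        using xy d by (simp add: A1.m_comm[of w] A1.m_assoc[symmetric])
      finally show ?thesis by (simp add: M_def path_cplx_def xy top)
    next
      case bot
      have E: "ch ?E 1 = integer_group" by (auto simp: elementary_cplx_def)
      have "P = \<tau> (n - 2) (bd A (n - 1) (\<zeta> n y w))"
        using tensor_map_elem[OF gA[of "n - 1"] gA[of "n - 2"] abelian_integer_group abelian_integer_group _ iso_imp_homomorphism[OF id_iso], of "bd A (n - 1)" "\<zeta> n y w" 1]
          chain_complexD(2)[OF A, of "n - 1"] \<zeta>c[of y n w] xy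
        by (simp add: P_def bot E M_def \<tau>_def)
      moreover have "bd A (n - 1) (\<zeta> n y w) = \<zeta> (n - 1) w \<one>\<^bsub>ch A (n - 2)\<^esub>"
        using xy d by (auto simp: \<zeta>_def sg_def A1.int_pow_neg A1.int_pow_1 A2.int_pow_neg A2.int_pow_1)
      moreover have "Q = \<one>\<^bsub>G (n - 1) i\<^esub>"
        using hom_one[OF Qh grpG grpG] by (simp add: Q_def M_def bot xy)
      moreover have "\<one>\<^bsub>G (n - 1) i\<^esub> [^]\<^bsub>G (n - 1) i\<^esub> sg i = \<one>\<^bsub>G (n - 1) i\<^esub>"
        by (rule Gi.int_pow_one)
      ultimately have "bd ?X n ?X1 i = \<tau> (n - 2) (\<zeta> (n - 1) w \<one>\<^bsub>ch A (n - 2)\<^esub>)"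
        using bdX P by simp
      then show ?thesis by (simp add: M_def[of "n - 1"] path_cplx_def xy bot)
    next
      case other
      then have t: "carrier (G (n - 1) i) = {\<one>\<^bsub>G (n - 1) i\<^esub>}"
        by (intro triv) auto
      then have "bd ?X n ?X1 i = \<one>\<^bsub>G (n - 1) i\<^esub>"
        using bdX P Q by simp
      moreover have "M (n - 1) (bd (path_cplx A) n x) i = \<one>\<^bsub>G (n - 1) i\<^esub>"
        using other by (simp add: M_def path_cplx_def xy)
      ultimately show ?thesis by simp
    qed
  qed
  show iso: "cplx_iso (path_cplx A) ?X"
    unfolding cplx_iso_def using isoM comm by blast
  have "comm_group (ch ?X n)" for n
    unfolding chX by (rule comm_group_sum_group) (rule commG)
  then show "chain_complex ?X"
    by (rule cplx_iso_chain_complex[OF chain_complex_path_cplx[OF A] _ iso])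
qed

section \<open>The bar construction of a span-shaped diagram\<close>

lemma hom_finprod:
  assumes "comm_group H" "\<And>j. j \<in> J \<Longrightarrow> f j \<in> hom G H"
  shows "(\<lambda>x. finprod H (\<lambda>j. f j x) J) \<in> hom G H"
proof (rule homI)
  interpret H: comm_group H by fact
  have c: "f j x \<in> carrier H" if "j \<in> J" "x \<in> carrier G" for j x
    using hom_in_carrier[OF assms(2)] that by blast
  fix x assume x: "x \<in> carrier G"
  then show "finprod H (\<lambda>j. f j x) J \<in> carrier H" using c by (intro H.finprod_closed) auto
  fix y assume y: "y \<in> carrier G"
  have "finprod H (\<lambda>j. f j (x \<otimes>\<^bsub>G\<^esub> y)) J = finprod H (\<lambda>j. f j x \<otimes>\<^bsub>H\<^esub> f j y) J"
    using x y c by (intro H.finprod_cong') (auto simp: hom_mult[OF assms(2)])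
  also have "\<dots> = finprod H (\<lambda>j. f j x) J \<otimes>\<^bsub>H\<^esub> finprod H (\<lambda>j. f j y) J"
    using x y c by (intro H.finprod_multf) auto
  finally show "finprod H (\<lambda>j. f j (x \<otimes>\<^bsub>G\<^esub> y)) J = finprod H (\<lambda>j. f j x) J \<otimes>\<^bsub>H\<^esub> finprod H (\<lambda>j. f j y) J" .
qed

lemma hom_int_pow_comp:
  assumes "comm_group H" "f \<in> hom G H"
  shows "(\<lambda>x. f x [^]\<^bsub>H\<^esub> (k::int)) \<in> hom G H"
proof (rule homI)
  interpret H: comm_group H by fact
  fix x assume x: "x \<in> carrier G"
  then show "f x [^]\<^bsub>H\<^esub> k \<in> carrier H" using hom_in_carrier[OF assms(2)] by simp
  fix y assume "y \<in> carrier G"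
  with x show "f (x \<otimes>\<^bsub>G\<^esub> y) [^]\<^bsub>H\<^esub> k = f x [^]\<^bsub>H\<^esub> k \<otimes>\<^bsub>H\<^esub> f y [^]\<^bsub>H\<^esub> k"
    using hom_in_carrier[OF assms(2)] by (simp add: hom_mult[OF assms(2)] H.int_pow_mult_distrib H.m_comm)
qed

lemma carrier_finite_sum_group:
  assumes "finite I" "\<And>i. i \<in> I \<Longrightarrow> group (G i)"
  shows "carrier (sum_group I G) = (\<Pi>\<^sub>E i\<in>I. carrier (G i))"
  using assms by (auto simp: carrier_sum_group)

lemma sum_group_component_hom:
  assumes "\<And>i. i \<in> I \<Longrightarrow> group (G i)" "c \<in> I"
  shows "(\<lambda>x. x c) \<in> hom (sum_group I G) (G c)"
  by (rule homI) (use assms in \<open>auto simp: carrier_sum_group PiE_iff\<close>)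

lemma hom_into_sum_group:
  assumes "finite I" "\<And>i. i \<in> I \<Longrightarrow> group (G i)"
    and "\<And>i. i \<in> I \<Longrightarrow> (\<lambda>x. F x i) \<in> hom H (G i)" "\<And>x. x \<in> carrier H \<Longrightarrow> F x \<in> extensional I"
    and "group H"
  shows "F \<in> hom H (sum_group I G)"
proof (rule homI)
  fix x assume x: "x \<in> carrier H"
  then show "F x \<in> carrier (sum_group I G)"
    using assms hom_in_carrier[OF assms(3)] by (simp add: carrier_finite_sum_group PiE_iff)
  fix y assume y: "y \<in> carrier H"
  then have "x \<otimes>\<^bsub>H\<^esub> y \<in> carrier H" using x assms(5) by (simp add: group.is_monoid monoid.m_closed)
  then show "F (x \<otimes>\<^bsub>H\<^esub> y) = F x \<otimes>\<^bsub>sum_group I G\<^esub> F y"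
    using x y assms(4) hom_mult[OF assms(3)] by (intro extensionalityI[of _ I]) auto
qed

lemma sum_group_component_finprod:
  assumes "\<And>i. i \<in> I \<Longrightarrow> comm_group (G i)" "c \<in> I" "\<And>j. j \<in> J \<Longrightarrow> f j \<in> carrier (sum_group I G)"
  shows "finprod (sum_group I G) f J c = finprod (G c) (\<lambda>j. f j c) J"
proof -
  interpret S: comm_group "sum_group I G" by (rule comm_group_sum_group) (rule assms)
  interpret Gc: comm_group "G c" by (rule assms) fact
  have grp: "group (G i)" if "i \<in> I" for i using assms(1)[OF that] by (simp add: comm_group_def)
  have ev: "x c \<in> carrier (G c)" if "x \<in> carrier (sum_group I G)" for x
    using hom_in_carrier[OF sum_group_component_hom[OF grp assms(2)] that] .
  show ?thesis
    using assms(3)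
  proof (induction J rule: infinite_finite_induct)
    case (insert j J)
    then have "finprod (sum_group I G) f (insert j J) = f j \<otimes>\<^bsub>sum_group I G\<^esub> finprod (sum_group I G) f J"
      by (intro S.finprod_insert) auto
    then have "finprod (sum_group I G) f (insert j J) c = f j c \<otimes>\<^bsub>G c\<^esub> finprod (sum_group I G) f J c"
      using assms(2) by simp
    also have "\<dots> = finprod (G c) (\<lambda>j. f j c) (insert j J)"
      using insert ev by (subst Gc.finprod_insert) auto
    finally show ?case .
  qed (use assms(2) in simp_all)
qed

lemma sum_group_component_int_pow:
  assumes "\<And>i. i \<in> I \<Longrightarrow> group (G i)" "c \<in> I" "x \<in> carrier (sum_group I G)"
  shows "(x [^]\<^bsub>sum_group I G\<^esub> (k::int)) c = x c [^]\<^bsub>G c\<^esub> k"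
  by (rule hom_int_pow[OF sum_group_component_hom[OF assms(1,2)] assms(3)]) (use assms in simp_all)

lemma (in comm_monoid) finprod_single: "f a \<in> carrier G \<Longrightarrow> finprod G f {a} = f a"
  by simp

lemma finite_bar_index: "finite (bar_index q :: 'i::{order,finite} list set)"
  using finite_lists_length_eq[of "UNIV :: 'i set" "Suc q"]
  by (rule rev_finite_subset) (auto simp: bar_index_def)

lemma bar_index_nonempty: "c \<in> bar_index q \<Longrightarrow> c \<noteq> []"
  by (auto simp: bar_index_def)

lemma hd_omit: "b \<in> bar_index (Suc q) \<Longrightarrow> hd (omit j b) = (if j = 0 then b ! 1 else b ! 0)"
  by (cases b; cases "tl b"; cases j) (auto simp: bar_index_def omit_def)

lemma bar_index_first_le: "b \<in> bar_index (Suc q) \<Longrightarrow> b ! 0 \<le> b ! 1"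
  by (cases b; cases "tl b") (auto simp: bar_index_def)

lemma hd_bar_index: "b \<in> bar_index q \<Longrightarrow> hd b = b ! 0"
  by (simp add: bar_index_nonempty hd_conv_nth)

lemma length_repeat: "j < length b \<Longrightarrow> length (repeat j b) = Suc (length b)"
  by (simp add: repeat_def)

lemma repeat_nth:
  assumes "j < length b" shows "repeat j b ! j = b ! j" "repeat j b ! Suc j = b ! j"
  using assms by (auto simp: repeat_def nth_append)

lemma repeat_not_distinct: "j < length b \<Longrightarrow> \<not> distinct (repeat j b)"
  using repeat_nth[of j b] length_repeat[of j b]
  by (metis Suc_lessI Suc_mono distinct_conv_nth lessI less_SucI n_not_Suc_n)

lemma hd_repeat: "j < length b \<Longrightarrow> hd (repeat j b) = hd b"
  by (cases b) (auto simp: repeat_def)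

lemma repeat_inverse: "j < length b \<Longrightarrow> take (Suc j) (repeat j b) @ drop (Suc (Suc j)) (repeat j b) = b"
  by (simp add: repeat_def)

text \<open>Strings are weakly increasing, so that by antisymmetry a repetition forces two equal neighbours.\<close>
lemma bar_index_degenerate:
  assumes "c \<in> bar_index q" "\<not> distinct c"
  obtains p j b where "q = Suc p" "j \<le> p" "b \<in> bar_index p" "c = repeat j b"
proof -
  have len: "length c = Suc q" and sort: "sorted_wrt (\<le>) c" using assms by (auto simp: bar_index_def)
  obtain i k where ik: "i < k" "k < length c" "c ! i = c ! k"
    using assms(2) by (metis distinct_conv_nth nat_neq_iff)
  have "c ! i \<le> c ! Suc i" using sort ik by (intro sorted_wrt_nth_less) auto
  moreover have "c ! Suc i \<le> c ! k"
    using sort ik by (cases "Suc i = k") (auto intro: sorted_wrt_nth_less)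
  ultimately have eq: "c ! Suc i = c ! i" using ik by simp
  obtain p where p: "q = Suc p" using ik len by (cases q) auto
  define xs a ys where "xs = take i c" and "a = c ! i" and "ys = drop (Suc (Suc i)) c"
  have "drop (Suc i) c = c ! Suc i # drop (Suc (Suc i)) c"
    using ik by (simp add: Cons_nth_drop_Suc)
  then have c: "c = xs @ a # a # ys"
    using ik eq id_take_nth_drop[of i c] by (simp add: xs_def a_def ys_def)
  define b where "b = xs @ a # ys"
  have "c = repeat (length xs) b" "length xs \<le> p"
    using len p by (simp_all add: c b_def repeat_def)
  moreover have "b \<in> bar_index p"
    using len sort p by (auto simp: c b_def bar_index_def sorted_wrt_append)
  ultimately show ?thesis using that p by blast
qed

lemma bar_index_0: "bar_index 0 = {[Apex], [Minus], [Plus]}"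
proof -
  have "i \<in> {Apex, Minus, Plus}" for i by (cases i) auto
  then show ?thesis by (auto simp: bar_index_def length_Suc_conv)
qed

lemma bar_index_1: "bar_index (Suc 0) =
    {[Apex, Apex], [Apex, Minus], [Apex, Plus], [Minus, Minus], [Plus, Plus]}" (is "_ = ?S")
proof
  have S: "[i, j] \<in> ?S" if "i \<le> j" for i j
    using that by (cases i; cases j) (simp_all add: less_eq_span_obj_def)
  show "bar_index (Suc 0) \<subseteq> ?S"
  proof
    fix c :: "span_obj list" assume "c \<in> bar_index (Suc 0)"
    then obtain i j where "c = [i, j]" "i \<le> j" by (auto simp: bar_index_def length_Suc_conv)
    then show "c \<in> ?S" using S by simp
  qed
qed (simp add: bar_index_def less_eq_span_obj_def)

lemma bar_index_2: "bar_index (Suc (Suc 0)) =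
    {[Apex, Apex, Apex], [Apex, Apex, Minus], [Apex, Apex, Plus], [Apex, Minus, Minus], [Apex, Plus, Plus],
     [Minus, Minus, Minus], [Plus, Plus, Plus]}" (is "_ = ?S")
proof
  have S: "[i, j, k] \<in> ?S" if "i \<le> j" "j \<le> k" for i j k
    using that by (cases i; cases j; cases k) (simp_all add: less_eq_span_obj_def)
  show "bar_index (Suc (Suc 0)) \<subseteq> ?S"
  proof
    fix c :: "span_obj list" assume "c \<in> bar_index (Suc (Suc 0))"
    then obtain i j k where "c = [i, j, k]" "i \<le> j" "j \<le> k" by (auto simp: bar_index_def length_Suc_conv)
    then show "c \<in> ?S" using S by simp
  qed
qed (simp add: bar_index_def less_eq_span_obj_def)

lemma distinct_bar_index_short:
  assumes "c \<in> bar_index q" "distinct c"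
  shows "(q = 0 \<and> c \<in> {[Apex], [Minus], [Plus]}) \<or> (q = Suc 0 \<and> c \<in> {[Apex, Minus], [Apex, Plus]})"
proof (cases q)
  case 0
  then show ?thesis using assms by (simp add: bar_index_0)
next
  case (Suc p)
  show ?thesis
  proof (cases p)
    case 0
    then show ?thesis using assms Suc by (auto simp: bar_index_1)
  next
    case (Suc r)
    then obtain x y z s where "c = x # y # z # s"
      using assms \<open>q = Suc p\<close> by (auto simp: bar_index_def length_Suc_conv)
    then have "x \<le> y" "y \<le> z" "x \<noteq> y" "y \<noteq> z" using assms by (auto simp: bar_index_def)
    then show ?thesis by (auto simp: less_eq_span_obj_def)
  qed
qed

text \<open>All complexes of the diagram have the same element type here, as in the definition of the bar construction.\<close>
locale span_shaped =
  fixes D :: "(span_obj, 'a) diagram"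
  assumes complexes: "chain_complex (ob D i)"
    and mor_id: "mor D i i n = id"
    and mor_hom: "i \<le> j \<Longrightarrow> mor D i j n \<in> hom (ch (ob D i) n) (ch (ob D j) n)"
begin

lemma comm_ob: "comm_group (ch (ob D i) n)" by (rule chain_complexD[OF complexes])
lemma group_ob: "group (ch (ob D i) n)" by (rule chain_complexD[OF complexes])

lemma comm_bar_group: "comm_group (bar_group D q n)"
  unfolding bar_group_def by (rule comm_group_sum_group) (rule comm_ob)

lemma group_bar_group: "group (bar_group D q n)"
  using comm_bar_group by (simp add: comm_group_def)

lemma carrier_bar_group: "carrier (bar_group D q n) = (\<Pi>\<^sub>E c\<in>bar_index q. carrier (ch (ob D (hd c)) n))"
  unfolding bar_group_def by (rule carrier_finite_sum_group[OF finite_bar_index group_ob])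

lemma bar_group_mult: "(x \<otimes>\<^bsub>bar_group D q n\<^esub> y) = (\<lambda>c\<in>bar_index q. x c \<otimes>\<^bsub>ch (ob D (hd c)) n\<^esub> y c)"
  by (simp add: bar_group_def)

lemma bar_group_one: "\<one>\<^bsub>bar_group D q n\<^esub> = (\<lambda>c\<in>bar_index q. \<one>\<^bsub>ch (ob D (hd c)) n\<^esub>)"
  by (simp add: bar_group_def)

lemma bar_group_inv: "x \<in> carrier (bar_group D q n) \<Longrightarrow>
    inv\<^bsub>bar_group D q n\<^esub> x = (\<lambda>c\<in>bar_index q. inv\<^bsub>ch (ob D (hd c)) n\<^esub> x c)"
  unfolding bar_group_def by (rule inv_sum_group) (simp_all add: group_ob)

lemma bar_component_hom: "c \<in> bar_index q \<Longrightarrow> (\<lambda>x. x c) \<in> hom (bar_group D q n) (ch (ob D (hd c)) n)"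
  unfolding bar_group_def by (rule sum_group_component_hom[OF group_ob])

lemma bar_face_hom:
  "(\<lambda>x. bar_face D q n j x) \<in> hom (bar_group D (Suc q) n) (bar_group D q n)"
  unfolding bar_group_def[of D q]
proof (rule hom_into_sum_group[OF finite_bar_index group_ob])
  fix c assume c: "c \<in> (bar_index q :: span_obj list set)"
  have "(\<lambda>x. if j = 0 then mor D (b ! 0) (b ! 1) n (x b) else x b) \<in> hom (bar_group D (Suc q) n) (ch (ob D (hd c)) n)"
    if b: "b \<in> bar_index (Suc q)" "omit j b = c" for b :: "span_obj list"
  proof (cases "j = 0")
    case True
    have "mor D (b ! 0) (b ! 1) n \<circ> (\<lambda>x. x b) \<in> hom (bar_group D (Suc q) n) (ch (ob D (hd c)) n)"
    proof (rule hom_compose)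
      show "(\<lambda>x. x b) \<in> hom (bar_group D (Suc q) n) (ch (ob D (b ! 0)) n)"
        using bar_component_hom[OF b(1)] hd_bar_index[OF b(1)] by simp
      show "mor D (b ! 0) (b ! 1) n \<in> hom (ch (ob D (b ! 0)) n) (ch (ob D (hd c)) n)"
        using mor_hom[OF bar_index_first_le[OF b(1)]] hd_omit[OF b(1), of j] b(2) True by simp
    qed
    then show ?thesis using True by (simp add: comp_def)
  next
    case False
    then have "hd c = hd b" using hd_omit[OF b(1), of j] b hd_bar_index[OF b(1)] by simp
    then show ?thesis using False bar_component_hom[OF b(1)] by simp
  qed
  then show "(\<lambda>x. bar_face D q n j x c) \<in> hom (bar_group D (Suc q) n) (ch (ob D (hd c)) n)"
    using c by (auto simp: bar_face_def intro!: hom_finprod comm_ob)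
qed (auto simp: bar_face_def group_bar_group)

lemma bar_face_sum_hom: "bar_face_sum D q n \<in> hom (bar_group D (Suc q) n) (bar_group D q n)"
  unfolding bar_face_sum_def[abs_def]
  by (intro hom_finprod hom_int_pow_comp bar_face_hom comm_bar_group)

lemma bar_internal_hom: "bar_internal D q n \<in> hom (bar_group D q n) (bar_group D q (n - 1))"
  unfolding bar_group_def[of D q "n - 1"]
proof (rule hom_into_sum_group[OF finite_bar_index group_ob])
  fix c assume c: "c \<in> (bar_index q :: span_obj list set)"
  have "bd (ob D (hd c)) n \<circ> (\<lambda>x. x c) \<in> hom (bar_group D q n) (ch (ob D (hd c)) (n - 1))"
    by (rule hom_compose[OF bar_component_hom[OF c] chain_complexD(2)[OF complexes]])
  then show "(\<lambda>x. bar_internal D q n x c) \<in> hom (bar_group D q n) (ch (ob D (hd c)) (n - 1))"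
    using c by (simp add: bar_internal_def comp_def)
qed (auto simp: bar_internal_def group_bar_group)

lemma bar_face_sum_component:
  assumes x: "x \<in> carrier (bar_group D (Suc q) n)" and c: "c \<in> bar_index q"
  shows "bar_face_sum D q n x c =
    finprod (ch (ob D (hd c)) n) (\<lambda>j. bar_face D q n j x c [^]\<^bsub>ch (ob D (hd c)) n\<^esub> ((- 1) ^ j :: int)) {..Suc q}"
proof -
  have f: "bar_face D q n j x \<in> carrier (bar_group D q n)" for j
    using hom_in_carrier[OF bar_face_hom x] .
  interpret C: comm_group "ch (ob D (hd c)) n" by (rule comm_ob)
  have fc: "y c \<in> carrier (ch (ob D (hd c)) n)" if "y \<in> carrier (bar_group D q n)" for y
    using hom_in_carrier[OF bar_component_hom[OF c] that] .
  interpret B: comm_group "bar_group D q n" by (rule comm_bar_group)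
  have "bar_face_sum D q n x c = finprod (ch (ob D (hd c)) n)
      (\<lambda>j. (bar_face D q n j x [^]\<^bsub>bar_group D q n\<^esub> ((- 1) ^ j :: int)) c) {..Suc q}"
    unfolding bar_face_sum_def bar_group_def
    by (rule sum_group_component_finprod[OF comm_ob c])
      (use f in \<open>simp add: bar_group_def[symmetric]\<close>)
  also have "(\<lambda>j. (bar_face D q n j x [^]\<^bsub>bar_group D q n\<^esub> ((- 1) ^ j :: int)) c)
      = (\<lambda>j. bar_face D q n j x c [^]\<^bsub>ch (ob D (hd c)) n\<^esub> ((- 1) ^ j :: int))"
    unfolding bar_group_def
    by (intro ext sum_group_component_int_pow[OF group_ob c]) (use f in \<open>simp add: bar_group_def[symmetric]\<close>)
  finally show ?thesis .
qed

lemma component_closed: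
  "x \<in> carrier (bar_group D q n) \<Longrightarrow> c \<in> bar_index q \<Longrightarrow> x c \<in> carrier (ch (ob D (hd c)) n)"
  using hom_in_carrier[OF bar_component_hom] .

text \<open>A degeneracy maps the summand of a string to that of a string with a repetition, so that its image vanishes
on the other strings. Conversely an element that vanishes there is a product of elements supported on a
single string with a repetition, and each of these is the image of an element supported on the shortened string.\<close>
lemma bar_degenerate_eq:
  "bar_degenerate D q n = {x \<in> carrier (bar_group D q n). \<forall>c \<in> bar_index q. distinct c \<longrightarrow> x c = \<one>\<^bsub>ch (ob D (hd c)) n\<^esub>}"
  (is "?L = ?R")
proof
  let ?G = "bar_group D q n"
  interpret G: comm_group ?G by (rule comm_bar_group)
  have grp: "group (ch (ob D i) n)" for i by (rule group_ob)
  note mon = group.is_monoid[OF grp]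
  have sub: "subgroup ?R ?G"
  proof
    show "?R \<subseteq> carrier ?G" by blast
    show "\<one>\<^bsub>?G\<^esub> \<in> ?R" using G.one_closed by (simp add: bar_group_one)
    fix x assume x: "x \<in> ?R"
    then show "inv\<^bsub>?G\<^esub> x \<in> ?R" using G.inv_closed[of x] by (simp add: bar_group_inv monoid.inv_one[OF mon])
    fix y assume "y \<in> ?R"
    then show "x \<otimes>\<^bsub>?G\<^esub> y \<in> ?R" using x G.m_closed[of x y] by (simp add: bar_group_mult monoid.l_one[OF mon] monoid.one_closed[OF mon])
  qed
  have "bar_degen D p n j x \<in> ?R" if q: "q = Suc p" and j: "j \<le> p" and x: "x \<in> carrier (bar_group D p n)" for p j x
  proof -
    have "bar_degen D p n j x c \<in> carrier (ch (ob D (hd c)) n)" if c: "c \<in> bar_index (Suc p)" for c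
    proof -
      interpret C: comm_group "ch (ob D (hd c)) n" by (rule comm_ob)
      have "x b \<in> carrier (ch (ob D (hd c)) n)" if "b \<in> bar_index p" "repeat j b = c" for b
        using component_closed[OF x that(1)] hd_repeat[of j b] that j by (auto simp: bar_index_def)
      then show ?thesis using c by (auto simp: bar_degen_def intro!: C.finprod_closed)
    qed
    moreover have "bar_degen D p n j x c = \<one>\<^bsub>ch (ob D (hd c)) n\<^esub>" if c: "c \<in> bar_index (Suc p)" "distinct c" for c
    proof -
      interpret C: comm_group "ch (ob D (hd c)) n" by (rule comm_ob)
      have "repeat j b \<noteq> c" if "b \<in> bar_index p" for b
        using repeat_not_distinct[of j b] that j c(2) by (auto simp: bar_index_def)
      then have e: "{b \<in> bar_index p. repeat j b = c} = {}" by blast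
      have "bar_degen D p n j x c = finprod (ch (ob D (hd c)) n) x {b \<in> bar_index p. repeat j b = c}"
        using c(1) by (simp add: bar_degen_def)
      then show ?thesis by (simp only: e C.finprod_empty)
    qed
    ultimately show ?thesis using q by (auto simp: carrier_bar_group bar_degen_def)
  qed
  then show "?L \<subseteq> ?R"
    unfolding bar_degenerate_def by (intro G.generate_subgroup_incl sub) auto
  let ?gens = "{bar_degen D p n j x | p j x. q = Suc p \<and> j \<le> p \<and> x \<in> carrier (bar_group D p n)}"
  have gens: "?gens \<subseteq> carrier ?G" using \<open>\<And>x p j. _ \<Longrightarrow> _ \<Longrightarrow> _ \<Longrightarrow> bar_degen D p n j x \<in> ?R\<close> by blast
  have single: "(\<lambda>b\<in>bar_index q. if b = c then g else \<one>\<^bsub>ch (ob D (hd b)) n\<^esub>) \<in> ?L"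
    if c: "c \<in> bar_index q" "\<not> distinct c" and g: "g \<in> carrier (ch (ob D (hd c)) n)" for c g
  proof -
    obtain p j b where b: "q = Suc p" "j \<le> p" "b \<in> bar_index p" "c = repeat j b"
      using bar_index_degenerate[OF c] by metis
    have jb: "j < length b" using b by (simp add: bar_index_def)
    have hb: "hd c = hd b" using hd_repeat[OF jb] b by simp
    let ?x = "\<lambda>b'\<in>bar_index p. if b' = b then g else \<one>\<^bsub>ch (ob D (hd b')) n\<^esub>"
    have x: "?x \<in> carrier (bar_group D p n)"
      using g hb by (auto simp: carrier_bar_group monoid.one_closed[OF mon])
    have "bar_degen D p n j ?x c' = (if c' = c then g else \<one>\<^bsub>ch (ob D (hd c')) n\<^esub>)" if c': "c' \<in> bar_index q" for c'
    proof -
      interpret C: comm_group "ch (ob D (hd c')) n" by (rule comm_ob)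
      have inj: "b' = b''" if "b' \<in> bar_index p" "b'' \<in> bar_index p" "repeat j b' = repeat j b''" for b' b'' :: "span_obj list"
      proof -
        have "j < length b'" "j < length b''" using that b(2) by (auto simp: bar_index_def)
        then show ?thesis using repeat_inverse that(3) by metis
      qed
      show ?thesis
      proof (cases "c' = c")
        case True
        then have "{b' \<in> bar_index p. repeat j b' = c'} = {b}" using inj b by blast
        moreover have "finprod (ch (ob D (hd c')) n) ?x {b} = ?x b"
          using b(3) g True by (intro C.finprod_single) simp
        ultimately show ?thesis using True c' b by (simp add: bar_degen_def del: restrict_apply) simp
      next
        case False
        have "?x b' = \<one>\<^bsub>ch (ob D (hd c')) n\<^esub>" if "b' \<in> {b' \<in> bar_index p. repeat j b' = c'}" for b'
          using that False b hd_repeat[of j b'] by (auto simp: bar_index_def)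
        then have "finprod (ch (ob D (hd c')) n) ?x {b' \<in> bar_index p. repeat j b' = c'} = \<one>\<^bsub>ch (ob D (hd c')) n\<^esub>"
          by (rule C.finprod_one_eqI)
        then show ?thesis using False c' b(1) by (simp add: bar_degen_def)
      qed
    qed
    then have "(\<lambda>b\<in>bar_index q. if b = c then g else \<one>\<^bsub>ch (ob D (hd b)) n\<^esub>) = bar_degen D p n j ?x"
      using b(1) by (intro extensionalityI[of _ "bar_index q"]) (auto simp: bar_degen_def)
    then show ?thesis
      unfolding bar_degenerate_def using x b by (auto intro!: generate.incl)
  qed
  have gen: "x \<in> ?L" if "finite S" "S \<subseteq> {c \<in> bar_index q. \<not> distinct c}" "x \<in> carrier ?G"
    "\<And>c. c \<in> bar_index q \<Longrightarrow> c \<notin> S \<Longrightarrow> x c = \<one>\<^bsub>ch (ob D (hd c)) n\<^esub>" for S x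
    using that
  proof (induction S arbitrary: x rule: finite_induct)
    case empty
    then have "x = \<one>\<^bsub>?G\<^esub>" by (auto simp: bar_group_one carrier_bar_group PiE_iff intro!: extensionalityI[of _ "bar_index q"])
    then show ?case by (simp add: bar_degenerate_def generate.one)
  next
    case (insert c S)
    let ?s = "\<lambda>b\<in>bar_index q. if b = c then x c else \<one>\<^bsub>ch (ob D (hd b)) n\<^esub>"
    let ?y = "\<lambda>b\<in>bar_index q. if b = c then \<one>\<^bsub>ch (ob D (hd b)) n\<^esub> else x b"
    have c: "c \<in> bar_index q" "\<not> distinct c" using insert.prems by auto
    have xc: "x b \<in> carrier (ch (ob D (hd b)) n)" if "b \<in> bar_index q" for b
      using component_closed[OF insert.prems(2) that] .
    have s: "?s \<in> ?L" using single[OF c xc[OF c(1)]] .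
    have y: "?y \<in> ?L"
    proof (rule insert.IH)
      show "?y \<in> carrier ?G" using xc by (auto simp: carrier_bar_group monoid.one_closed[OF mon])
    qed (use insert.prems in auto)
    have x: "x = ?s \<otimes>\<^bsub>?G\<^esub> ?y"
    proof (rule extensionalityI[of _ "bar_index q"])
      show "x \<in> extensional (bar_index q)" using insert.prems(2) by (simp add: carrier_bar_group PiE_iff)
      fix b assume b: "b \<in> (bar_index q :: span_obj list set)"
      show "x b = (?s \<otimes>\<^bsub>?G\<^esub> ?y) b"
        using xc[OF b] xc[OF c(1)] b by (simp add: bar_group_mult monoid.l_one[OF mon] monoid.r_one[OF mon])
    qed (simp add: bar_group_mult)
    have "?s \<otimes>\<^bsub>?G\<^esub> ?y \<in> ?L"
      using s y unfolding bar_degenerate_def by (rule generate.eng)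
    then show ?case using x by simp
  qed
  show "?R \<subseteq> ?L"
  proof
    fix x assume "x \<in> ?R"
    then show "x \<in> ?L"
      by (intro gen[of "{c \<in> bar_index q. \<not> distinct c}"]) (auto simp: finite_bar_index)
  qed
qed

lemma subgroup_bar_degenerate: "subgroup (bar_degenerate D q n) (bar_group D q n)"
proof -
  have "{bar_degen D p n j x | p j x. q = Suc p \<and> j \<le> p \<and> x \<in> carrier (bar_group D p n)} \<subseteq> bar_degenerate D q n"
    unfolding bar_degenerate_def by (auto intro: generate.incl)
  also have "\<dots> \<subseteq> carrier (bar_group D q n)" by (auto simp: bar_degenerate_eq)
  finally show ?thesis
    unfolding bar_degenerate_def by (rule group.generate_is_subgroup[OF group_bar_group])
qed

lemma bar_coset_eq_iff:
  assumes "x \<in> carrier (bar_group D q n)" "y \<in> carrier (bar_group D q n)"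
  shows "bar_degenerate D q n #>\<^bsub>bar_group D q n\<^esub> x = bar_degenerate D q n #>\<^bsub>bar_group D q n\<^esub> y
    \<longleftrightarrow> (\<forall>c \<in> bar_index q. distinct c \<longrightarrow> x c = y c)"
proof -
  interpret G: comm_group "bar_group D q n" by (rule comm_bar_group)
  have "x c \<otimes>\<^bsub>ch (ob D (hd c)) n\<^esub> inv\<^bsub>ch (ob D (hd c)) n\<^esub> y c = \<one>\<^bsub>ch (ob D (hd c)) n\<^esub> \<longleftrightarrow> x c = y c"
    if "c \<in> bar_index q" for c
  proof -
    interpret C: comm_group "ch (ob D (hd c)) n" by (rule comm_ob)
    show ?thesis
      using component_closed[OF assms(1) that] component_closed[OF assms(2) that]
      by (metis C.inv_closed C.inv_equality C.inv_inv C.r_inv)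
  qed
  then show ?thesis
    using G.rcoset_eq_iff[OF subgroup_bar_degenerate assms] G.m_closed[OF assms(1) G.inv_closed[OF assms(2)]] assms
    by (simp add: bar_degenerate_eq bar_group_mult bar_group_inv)
qed

lemma bar_face_set:
  "{b \<in> bar_index (Suc 0). omit 0 b = [Apex]} = {[Apex, Apex]}"
  "{b \<in> bar_index (Suc 0). omit 0 b = [Minus]} = {[Apex, Minus], [Minus, Minus]}"
  "{b \<in> bar_index (Suc 0). omit 0 b = [Plus]} = {[Apex, Plus], [Plus, Plus]}"
  "{b \<in> bar_index (Suc 0). omit (Suc 0) b = [Apex]} = {[Apex, Apex], [Apex, Minus], [Apex, Plus]}"
  "{b \<in> bar_index (Suc 0). omit (Suc 0) b = [Minus]} = {[Minus, Minus]}"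
  "{b \<in> bar_index (Suc 0). omit (Suc 0) b = [Plus]} = {[Plus, Plus]}"
  "{b \<in> bar_index (Suc (Suc 0)). omit 0 b = [Apex, Minus]} = {[Apex, Apex, Minus]}"
  "{b \<in> bar_index (Suc (Suc 0)). omit 0 b = [Apex, Plus]} = {[Apex, Apex, Plus]}"
  "{b \<in> bar_index (Suc (Suc 0)). omit (Suc 0) b = [Apex, Minus]} = {[Apex, Apex, Minus], [Apex, Minus, Minus]}"
  "{b \<in> bar_index (Suc (Suc 0)). omit (Suc 0) b = [Apex, Plus]} = {[Apex, Apex, Plus], [Apex, Plus, Plus]}"
  "{b \<in> bar_index (Suc (Suc 0)). omit (Suc (Suc 0)) b = [Apex, Minus]} = {[Apex, Minus, Minus]}"
  "{b \<in> bar_index (Suc (Suc 0)). omit (Suc (Suc 0)) b = [Apex, Plus]} = {[Apex, Plus, Plus]}"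
  unfolding bar_index_1 bar_index_2 by (auto simp: omit_def)

text \<open>An arrow contributes its end minus its beginning. Both faces of a repeated string \<open>[i, i]\<close> are \<open>[i]\<close>, with
opposite signs, so that its component occurs twice and cancels.\<close>
lemma bar_face_sum_0:
  assumes x: "x \<in> carrier (bar_group D (Suc 0) n)"
  shows "bar_face_sum D 0 n x [Apex] =
      x [Apex, Apex] \<otimes>\<^bsub>ch (ob D Apex) n\<^esub> inv\<^bsub>ch (ob D Apex) n\<^esub>
        (x [Apex, Apex] \<otimes>\<^bsub>ch (ob D Apex) n\<^esub> (x [Apex, Minus] \<otimes>\<^bsub>ch (ob D Apex) n\<^esub> x [Apex, Plus]))" (is ?apex)
    and "bar_face_sum D 0 n x [Minus] =
      mor D Apex Minus n (x [Apex, Minus]) \<otimes>\<^bsub>ch (ob D Minus) n\<^esub> x [Minus, Minus]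
        \<otimes>\<^bsub>ch (ob D Minus) n\<^esub> inv\<^bsub>ch (ob D Minus) n\<^esub> x [Minus, Minus]" (is ?minus)
    and "bar_face_sum D 0 n x [Plus] =
      mor D Apex Plus n (x [Apex, Plus]) \<otimes>\<^bsub>ch (ob D Plus) n\<^esub> x [Plus, Plus]
        \<otimes>\<^bsub>ch (ob D Plus) n\<^esub> inv\<^bsub>ch (ob D Plus) n\<^esub> x [Plus, Plus]" (is ?plus)
proof -
  have c: "x c \<in> carrier (ch (ob D (hd c)) n)" if "c \<in> bar_index (Suc 0)" for c
    using component_closed[OF x that] .
  have cs: "x [Apex, Apex] \<in> carrier (ch (ob D Apex) n)" "x [Apex, Minus] \<in> carrier (ch (ob D Apex) n)"
    "x [Apex, Plus] \<in> carrier (ch (ob D Apex) n)" "x [Minus, Minus] \<in> carrier (ch (ob D Minus) n)"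
    "x [Plus, Plus] \<in> carrier (ch (ob D Plus) n)"
    using c[of "[Apex, Apex]"] c[of "[Apex, Minus]"] c[of "[Apex, Plus]"] c[of "[Minus, Minus]"] c[of "[Plus, Plus]"]
    by (simp_all add: bar_index_1)
  have ms: "mor D Apex Minus n (x [Apex, Minus]) \<in> carrier (ch (ob D Minus) n)"
    "mor D Apex Plus n (x [Apex, Plus]) \<in> carrier (ch (ob D Plus) n)"
    using hom_in_carrier[OF mor_hom cs(2), of Minus] hom_in_carrier[OF mor_hom cs(3), of Plus]
    by (simp_all add: less_eq_span_obj_def)
  interpret A: comm_group "ch (ob D Apex) n" by (rule comm_ob)
  interpret B: comm_group "ch (ob D Minus) n" by (rule comm_ob)
  interpret C: comm_group "ch (ob D Plus) n" by (rule comm_ob)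
  have two: "{..Suc 0} = {0, Suc 0}" by auto
  note simps = bar_face_sum_component[OF x] bar_index_0 bar_face_def bar_face_set two mor_id
    A.int_pow_neg A.int_pow_1 B.int_pow_neg B.int_pow_1 C.int_pow_neg C.int_pow_1
  show ?apex using cs by (simp add: simps)
  show ?minus using cs ms by (simp add: simps)
  show ?plus using cs ms by (simp add: simps)
qed

text \<open>The strings of length three all repeat an object. Those with an arrow \<open>c\<close> as a face are \<open>c\<close> with
its first or its last object doubled, and each of them has \<open>c\<close> as two neighbouring faces, with opposite signs.\<close>
lemma bar_face_sum_1:
  assumes x: "x \<in> carrier (bar_group D (Suc (Suc 0)) n)" and c: "c \<in> {[Apex, Minus], [Apex, Plus]}"
  shows "bar_face_sum D (Suc 0) n x c = \<one>\<^bsub>ch (ob D Apex) n\<^esub>"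
proof -
  have cl: "x c \<in> carrier (ch (ob D (hd c)) n)" if "c \<in> bar_index (Suc (Suc 0))" for c
    using component_closed[OF x that] .
  have cs: "x [Apex, Apex, Minus] \<in> carrier (ch (ob D Apex) n)" "x [Apex, Minus, Minus] \<in> carrier (ch (ob D Apex) n)"
    "x [Apex, Apex, Plus] \<in> carrier (ch (ob D Apex) n)" "x [Apex, Plus, Plus] \<in> carrier (ch (ob D Apex) n)"
    using cl[of "[Apex, Apex, Minus]"] cl[of "[Apex, Minus, Minus]"] cl[of "[Apex, Apex, Plus]"] cl[of "[Apex, Plus, Plus]"]
    by (simp_all add: bar_index_2)
  interpret A: comm_group "ch (ob D Apex) n" by (rule comm_ob)
  have canc: "y \<otimes>\<^bsub>ch (ob D Apex) n\<^esub> (inv\<^bsub>ch (ob D Apex) n\<^esub> (y \<otimes>\<^bsub>ch (ob D Apex) n\<^esub> z) \<otimes>\<^bsub>ch (ob D Apex) n\<^esub> z) = \<one>\<^bsub>ch (ob D Apex) n\<^esub>"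
    if "y \<in> carrier (ch (ob D Apex) n)" "z \<in> carrier (ch (ob D Apex) n)" for y z
    using that by (simp add: A.m_comm[of "inv\<^bsub>ch (ob D Apex) n\<^esub> (y \<otimes>\<^bsub>ch (ob D Apex) n\<^esub> z)" z] A.m_assoc[symmetric])
  have three: "{..Suc (Suc 0)} = {0, Suc 0, Suc (Suc 0)}" by auto
  note simps = bar_face_sum_component[OF x] bar_index_1 bar_face_def bar_face_set three mor_id
    A.int_pow_neg A.int_pow_1
  show ?thesis using c cs by (auto simp: simps canc)
qed

lemma bar_degenerate_long: "1 < q \<Longrightarrow> bar_degenerate D q n = carrier (bar_group D q n)"
  using distinct_bar_index_short by (auto simp: bar_degenerate_eq)

text \<open>The condition is void in simplicial degrees above \<open>1\<close>, where every element is degenerate, so the simplicial identities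
are needed in the two lowest degrees only.\<close>
lemma bar_face_sum_degenerate:
  "bar_face_sum D q n ` bar_degenerate D (Suc q) n \<subseteq> bar_degenerate D q n"
proof
  fix z assume "z \<in> bar_face_sum D q n ` bar_degenerate D (Suc q) n"
  then obtain x where x: "x \<in> carrier (bar_group D (Suc q) n)"
    "\<And>c. c \<in> bar_index (Suc q) \<Longrightarrow> distinct c \<Longrightarrow> x c = \<one>\<^bsub>ch (ob D (hd c)) n\<^esub>" "z = bar_face_sum D q n x"
    by (auto simp: bar_degenerate_eq)
  have "z \<in> carrier (bar_group D q n)" using x(1,3) hom_in_carrier[OF bar_face_sum_hom] by simp
  moreover have "z c = \<one>\<^bsub>ch (ob D (hd c)) n\<^esub>" if c: "c \<in> bar_index q" "distinct c" for c
    using distinct_bar_index_short[OF c]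
  proof (elim disjE conjE)
    assume q: "q = 0" and c: "c \<in> {[Apex], [Minus], [Plus]}"
    interpret A: comm_group "ch (ob D Apex) n" by (rule comm_ob)
    interpret B: comm_group "ch (ob D Minus) n" by (rule comm_ob)
    interpret C: comm_group "ch (ob D Plus) n" by (rule comm_ob)
    have x1: "x \<in> carrier (bar_group D (Suc 0) n)" using x q by simp
    have v: "x [Apex, Minus] = \<one>\<^bsub>ch (ob D Apex) n\<^esub>" "x [Apex, Plus] = \<one>\<^bsub>ch (ob D Apex) n\<^esub>"
      using x(2)[of "[Apex, Minus]"] x(2)[of "[Apex, Plus]"] q by (simp_all add: bar_index_1)
    have cs: "x [Apex, Apex] \<in> carrier (ch (ob D Apex) n)" "x [Minus, Minus] \<in> carrier (ch (ob D Minus) n)"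
      "x [Plus, Plus] \<in> carrier (ch (ob D Plus) n)"
      using component_closed[OF x1, of "[Apex, Apex]"] component_closed[OF x1, of "[Minus, Minus]"] component_closed[OF x1, of "[Plus, Plus]"]
      by (simp_all add: bar_index_1)
    have m1: "mor D Apex j n \<one>\<^bsub>ch (ob D Apex) n\<^esub> = \<one>\<^bsub>ch (ob D j) n\<^esub>" for j
      by (rule hom_one[OF mor_hom group_ob group_ob]) (simp add: less_eq_span_obj_def)
    show ?thesis using c cs by (auto simp: x(3) q bar_face_sum_0[OF x1] v m1)
  next
    assume q: "q = Suc 0" and c: "c \<in> {[Apex, Minus], [Apex, Plus]}"
    then show ?thesis using bar_face_sum_1[of x n c] x by auto
  qed
  ultimately show "z \<in> bar_degenerate D q n" by (simp add: bar_degenerate_eq)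
qed

lemma bar_internal_degenerate:
  "bar_internal D q n ` bar_degenerate D q n \<subseteq> bar_degenerate D q (n - 1)"
proof
  fix z assume "z \<in> bar_internal D q n ` bar_degenerate D q n"
  then obtain x where x: "x \<in> carrier (bar_group D q n)"
    "\<And>c. c \<in> bar_index q \<Longrightarrow> distinct c \<Longrightarrow> x c = \<one>\<^bsub>ch (ob D (hd c)) n\<^esub>" "z = bar_internal D q n x"
    by (auto simp: bar_degenerate_eq)
  have "bd (ob D i) n \<one>\<^bsub>ch (ob D i) n\<^esub> = \<one>\<^bsub>ch (ob D i) (n - 1)\<^esub>" for i
    by (rule hom_one[OF chain_complexD(2)[OF complexes] group_ob group_ob])
  then show "z \<in> bar_degenerate D q (n - 1)"
    using x hom_in_carrier[OF bar_internal_hom x(1)] by (simp add: bar_degenerate_eq) (simp add: bar_internal_def)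
qed

abbreviation "tot \<equiv> span_total (ob D Apex) (ob D Minus) (ob D Plus) (mor D Apex Minus) (mor D Apex Plus)"

text \<open>The representative of a coset that is supported on the strings without repetition. The length of a string determines its simplicial
degree \<open>q\<close>, so one formula serves for all \<open>q\<close>.\<close>
definition bar_chain :: "int \<Rightarrow> 'a \<times> 'a \<times> 'a \<times> 'a \<times> 'a \<Rightarrow> nat \<Rightarrow> span_obj list \<Rightarrow> 'a" where
  "bar_chain m = (\<lambda>(a, b, c, u, v) q. \<lambda>s\<in>bar_index q.
     if s = [Apex] then a else if s = [Minus] then b else if s = [Plus] then c
     else if s = [Apex, Minus] then u else if s = [Apex, Plus] then v
     else \<one>\<^bsub>ch (ob D (hd s)) (m - int q)\<^esub>)"

definition to_bar :: "int \<Rightarrow> 'a \<times> 'a \<times> 'a \<times> 'a \<times> 'a \<Rightarrow> nat \<Rightarrow> (span_obj list \<Rightarrow> 'a) set" where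
  "to_bar m e q = bar_degenerate D q (m - int q) #>\<^bsub>bar_group D q (m - int q)\<^esub> bar_chain m e q"

lemma bar_index_singleton: "[i] \<in> bar_index q \<longleftrightarrow> q = 0" "[i, j] \<in> bar_index q \<longleftrightarrow> q = Suc 0 \<and> i \<le> j"
  by (auto simp: bar_index_def)

lemma bar_chain_closed:
  assumes "e \<in> carrier (ch tot m)"
  shows "bar_chain m e q \<in> carrier (bar_group D q (m - int q))"
  using assms monoid.one_closed[OF group.is_monoid[OF group_ob]]
  by (auto simp: span_total_def bar_chain_def carrier_bar_group bar_index_singleton)

lemma norm_bar_group_comm: "comm_group (norm_bar_group D q n)"
  unfolding norm_bar_group_def by (rule comm_group.abelian_FactGroup[OF comm_bar_group subgroup_bar_degenerate])

lemma norm_bar_group_long: "1 < q \<Longrightarrow> carrier (norm_bar_group D q n) = {\<one>\<^bsub>norm_bar_group D q n\<^esub>}"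
proof -
  assume q: "1 < q"
  interpret G: comm_group "bar_group D q n" by (rule comm_bar_group)
  have "bar_degenerate D q n #>\<^bsub>bar_group D q n\<^esub> x = bar_degenerate D q n" if "x \<in> carrier (bar_group D q n)" for x
    using G.coset_join2[OF that subgroup_bar_degenerate] that bar_degenerate_long[OF q] by simp
  then show ?thesis
    using G.one_closed by (auto simp: norm_bar_group_def carrier_FactGroup image_iff)
qed

lemma carrier_bar_realization:
  "carrier (ch (bar_realization D) m) = {x. \<forall>q. x q \<in> carrier (norm_bar_group D q (m - int q))}"
proof -
  have g: "group (norm_bar_group D q n)" for q n using norm_bar_group_comm by (simp add: comm_group_def)
  have "finite {q. x q \<noteq> \<one>\<^bsub>norm_bar_group D q (m - int q)\<^esub>}"
    if "\<forall>q. x q \<in> carrier (norm_bar_group D q (m - int q))" for x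
  proof (rule finite_subset)
    show "{q. x q \<noteq> \<one>\<^bsub>norm_bar_group D q (m - int q)\<^esub>} \<subseteq> {..1}"
    proof
      fix q assume "q \<in> {q. x q \<noteq> \<one>\<^bsub>norm_bar_group D q (m - int q)\<^esub>}"
      then have "carrier (norm_bar_group D q (m - int q)) \<noteq> {\<one>\<^bsub>norm_bar_group D q (m - int q)\<^esub>}"
        using that by auto
      then show "q \<in> {..1}" using norm_bar_group_long[of q "m - int q"] by (simp add: not_less[symmetric]) blast
    qed
  qed simp
  then show ?thesis by (auto simp: bar_realization_def carrier_sum_group g)
qed

text \<open>Two elements of the bar group are congruent modulo degenerate ones if and only if they agree on the five strings without repetition,
that is, if they have the same five coordinates.\<close>
lemma to_bar_iso: "to_bar m \<in> iso (ch tot m) (ch (bar_realization D) m)"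
proof -
  have cl: "to_bar m e q \<in> carrier (norm_bar_group D q (m - int q))" if "e \<in> carrier (ch tot m)" for e q
    using bar_chain_closed[OF that, of q] by (auto simp: to_bar_def norm_bar_group_def carrier_FactGroup)
  have one: "\<one>\<^bsub>ch (ob D i) n\<^esub> = \<one>\<^bsub>ch (ob D i) n\<^esub> \<otimes>\<^bsub>ch (ob D i) n\<^esub> \<one>\<^bsub>ch (ob D i) n\<^esub>" for i n
    using group_ob group.is_monoid monoid.l_one monoid.one_closed by metis
  have "to_bar m \<in> hom (ch tot m) (ch (bar_realization D) m)"
  proof (rule homI)
    fix e assume e: "e \<in> carrier (ch tot m)"
    then show "to_bar m e \<in> carrier (ch (bar_realization D) m)" using cl by (simp add: carrier_bar_realization)
    fix e' assume e': "e' \<in> carrier (ch tot m)"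
    have "to_bar m (e \<otimes>\<^bsub>ch tot m\<^esub> e') q = to_bar m e q \<otimes>\<^bsub>norm_bar_group D q (m - int q)\<^esub> to_bar m e' q" for q
    proof -
      interpret N: normal "bar_degenerate D q (m - int q)" "bar_group D q (m - int q)"
        using subgroup_bar_degenerate by (simp add: comm_group.normal_iff_subgroup comm_bar_group)
      have "bar_chain m (e \<otimes>\<^bsub>ch tot m\<^esub> e') q = bar_chain m e q \<otimes>\<^bsub>bar_group D q (m - int q)\<^esub> bar_chain m e' q"
        using e e' one
        by (auto simp: span_total_def bar_chain_def bar_group_mult bar_index_singleton intro!: restrict_ext)
      then show ?thesis
        using bar_chain_closed[OF e] bar_chain_closed[OF e'] by (simp add: to_bar_def norm_bar_group_def N.rcos_sum)
    qed
    then show "to_bar m (e \<otimes>\<^bsub>ch tot m\<^esub> e') = to_bar m e \<otimes>\<^bsub>ch (bar_realization D) m\<^esub> to_bar m e'"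
      by (simp add: bar_realization_def fun_eq_iff)
  qed
  moreover have "inj_on (to_bar m) (carrier (ch tot m))"
  proof (rule inj_onI)
    fix e e' assume e: "e \<in> carrier (ch tot m)" "e' \<in> carrier (ch tot m)" "to_bar m e = to_bar m e'"
    have eq: "bar_chain m e q s = bar_chain m e' q s" if "s \<in> bar_index q" "distinct s" for q s
      using fun_cong[OF e(3), of q] bar_coset_eq_iff[OF bar_chain_closed[OF e(1), of q] bar_chain_closed[OF e(2), of q]] that
      by (simp add: to_bar_def)
    show "e = e'"
      using eq[of "[Apex]" 0] eq[of "[Minus]" 0] eq[of "[Plus]" 0] eq[of "[Apex, Minus]" "Suc 0"] eq[of "[Apex, Plus]" "Suc 0"]
      by (cases e; cases e') (simp add: bar_chain_def bar_index_0 bar_index_1)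
  qed
  moreover have "X \<in> to_bar m ` carrier (ch tot m)" if X: "X \<in> carrier (ch (bar_realization D) m)" for X
  proof -
    have "\<exists>x. x \<in> carrier (bar_group D q (m - int q)) \<and> X q = bar_degenerate D q (m - int q) #>\<^bsub>bar_group D q (m - int q)\<^esub> x" for q
      using X by (auto simp: carrier_bar_realization norm_bar_group_def carrier_FactGroup image_iff)
    then obtain x where x: "\<And>q. x q \<in> carrier (bar_group D q (m - int q))"
      "\<And>q. X q = bar_degenerate D q (m - int q) #>\<^bsub>bar_group D q (m - int q)\<^esub> x q" by metis
    let ?e = "(x 0 [Apex], x 0 [Minus], x 0 [Plus], x (Suc 0) [Apex, Minus], x (Suc 0) [Apex, Plus])"
    have e: "?e \<in> carrier (ch tot m)"
      using component_closed[OF x(1)[of 0], of "[Apex]"] component_closed[OF x(1)[of 0], of "[Minus]"]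
        component_closed[OF x(1)[of 0], of "[Plus]"] component_closed[OF x(1)[of "Suc 0"], of "[Apex, Minus]"]
        component_closed[OF x(1)[of "Suc 0"], of "[Apex, Plus]"]
      by (simp add: span_total_def bar_index_0 bar_index_1)
    have "to_bar m ?e q = X q" for q
      unfolding to_bar_def x(2) bar_coset_eq_iff[OF bar_chain_closed[OF e] x(1)]
    proof (intro ballI impI)
      fix s :: "span_obj list" assume s: "s \<in> bar_index q" "distinct s"
      from distinct_bar_index_short[OF s] s(1) show "bar_chain m ?e q s = x q s"
        by (elim disjE conjE) (auto simp: bar_chain_def)
    qed
    then have "X = to_bar m ?e" by auto
    then show ?thesis using e by blast
  qed
  ultimately show ?thesis
    using hom_in_carrier[of "to_bar m"] by (auto simp: iso_iff)
qed

text \<open>Both sides are cosets of explicit elements, which need to be compared on strings without repetition only.\<close>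
lemma to_bar_bd:
  assumes e: "e \<in> carrier (ch tot m)"
  shows "to_bar (m - 1) (bd tot m e) = bd (bar_realization D) m (to_bar m e)"
proof
  fix q
  define n where "n = m - 1 - int q"
  have n: "m - int (Suc q) = n" "m - int q - 1 = n" "m - 1 - int q = n" by (simp_all add: n_def)
  interpret N: normal "bar_degenerate D q n" "bar_group D q n"
    using subgroup_bar_degenerate by (simp add: comm_group.normal_iff_subgroup comm_bar_group)
  interpret G: comm_group "bar_group D q n" by (rule comm_bar_group)
  have r1: "bar_chain m e (Suc q) \<in> carrier (bar_group D (Suc q) n)" using bar_chain_closed[OF e, of "Suc q"] by (simp only: n(1))
  have r0: "bar_chain m e q \<in> carrier (bar_group D q (m - int q))" by (rule bar_chain_closed[OF e])
  let ?F = "bar_face_sum D q n (bar_chain m e (Suc q))" and ?I = "bar_internal D q (m - int q) (bar_chain m e q)"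
  have F: "?F \<in> carrier (bar_group D q n)" using hom_in_carrier[OF bar_face_sum_hom r1] .
  have I: "?I \<in> carrier (bar_group D q n)" using hom_in_carrier[OF bar_internal_hom r0] n by simp
  have c1: "coset_map (bar_group D q n) (bar_degenerate D q n) (bar_face_sum D q n) (to_bar m e (Suc q))
      = bar_degenerate D q n #>\<^bsub>bar_group D q n\<^esub> ?F"
    unfolding to_bar_def n(1)
    by (rule coset_map_rcoset[OF bar_face_sum_hom group_bar_group group_bar_group subgroup_bar_degenerate
          subgroup_bar_degenerate bar_face_sum_degenerate r1])
  have c2: "coset_map (bar_group D q n) (bar_degenerate D q n) (bar_internal D q (m - int q)) (to_bar m e q)
      = bar_degenerate D q n #>\<^bsub>bar_group D q n\<^esub> ?I"
    unfolding to_bar_def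
    by (rule coset_map_rcoset[OF _ group_bar_group group_bar_group subgroup_bar_degenerate subgroup_bar_degenerate _ r0])
      (use bar_internal_hom[of q "m - int q"] bar_internal_degenerate[of q "m - int q"] n in simp_all)
  let ?y = "?F \<otimes>\<^bsub>bar_group D q n\<^esub> (?I [^]\<^bsub>bar_group D q n\<^esub> ((- 1) ^ q :: int))"
  have "bd (bar_realization D) m (to_bar m e) q = (bar_degenerate D q n #>\<^bsub>bar_group D q n\<^esub> ?F) \<otimes>\<^bsub>norm_bar_group D q n\<^esub>
      (bar_degenerate D q n #>\<^bsub>bar_group D q n\<^esub> ?I) [^]\<^bsub>norm_bar_group D q n\<^esub> ((- 1) ^ q :: int)"
    unfolding c1[symmetric] c2[symmetric] by (simp add: bar_realization_def Let_def n_def)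
  also have "\<dots> = bar_degenerate D q n #>\<^bsub>bar_group D q n\<^esub> ?y"
    using F I by (simp add: norm_bar_group_def N.FactGroup_int_pow N.rcos_sum)
  finally have bar: "bd (bar_realization D) m (to_bar m e) q = bar_degenerate D q n #>\<^bsub>bar_group D q n\<^esub> ?y" .
  have y: "?y \<in> carrier (bar_group D q n)" using F I by simp
  obtain a b c u v where e': "e = (a, b, c, u, v)" "a \<in> carrier (ch (ob D Apex) m)" "b \<in> carrier (ch (ob D Minus) m)"
    "c \<in> carrier (ch (ob D Plus) m)" "u \<in> carrier (ch (ob D Apex) (m - 1))" "v \<in> carrier (ch (ob D Apex) (m - 1))"
    using e by (auto simp: span_total_def)
  have d: "bd (ob D i) k x \<in> carrier (ch (ob D i) (k - 1))" if "x \<in> carrier (ch (ob D i) k)" for i k x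
    using hom_in_carrier[OF chain_complexD(2)[OF complexes] that] .
  have f: "mor D Apex i k x \<in> carrier (ch (ob D i) k)" if "x \<in> carrier (ch (ob D Apex) k)" for i k x
    using hom_in_carrier[OF mor_hom that, of i] by (simp add: less_eq_span_obj_def)
  have f1: "mor D Apex i k \<one>\<^bsub>ch (ob D Apex) k\<^esub> = \<one>\<^bsub>ch (ob D i) k\<^esub>" for i k
    by (rule hom_one[OF mor_hom group_ob group_ob]) (simp add: less_eq_span_obj_def)
  interpret A1: comm_group "ch (ob D Apex) (m - 1)" by (rule comm_ob)
  interpret A2: comm_group "ch (ob D Apex) (m - 2)" by (rule comm_ob)
  interpret B1: comm_group "ch (ob D Minus) (m - 1)" by (rule comm_ob)
  interpret C1: comm_group "ch (ob D Plus) (m - 1)" by (rule comm_ob)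
  have dA: "bd (ob D Apex) m a \<in> carrier (ch (ob D Apex) (m - 1))"
    "bd (ob D Minus) m b \<in> carrier (ch (ob D Minus) (m - 1))"
    "bd (ob D Plus) m c \<in> carrier (ch (ob D Plus) (m - 1))"
    "bd (ob D Apex) (m - 1) u \<in> carrier (ch (ob D Apex) (m - 2))"
    "bd (ob D Apex) (m - 1) v \<in> carrier (ch (ob D Apex) (m - 2))"
    using d[OF e'(2)] d[OF e'(3)] d[OF e'(4)] d[OF e'(5)] d[OF e'(6)] by simp_all
  have bde: "bd tot m e \<in> carrier (ch tot (m - 1))"
    by (rule span_total_bd_closed[OF complexes complexes complexes mor_hom mor_hom e])
      (simp_all add: less_eq_span_obj_def)
  have r: "bar_chain (m - 1) (bd tot m e) q \<in> carrier (bar_group D q n)"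
    using bar_chain_closed[OF bde, of q] n by simp
  have "bar_chain (m - 1) (bd tot m e) q s = ?y s" if s: "s \<in> bar_index q" "distinct s" for s
  proof -
    have ys: "?y s = ?F s \<otimes>\<^bsub>ch (ob D (hd s)) n\<^esub>
        (bd (ob D (hd s)) (m - int q) (bar_chain m e q s) [^]\<^bsub>ch (ob D (hd s)) n\<^esub> ((- 1) ^ q :: int))"
    proof -
      have "(?I [^]\<^bsub>bar_group D q n\<^esub> ((- 1) ^ q :: int)) s = ?I s [^]\<^bsub>ch (ob D (hd s)) n\<^esub> ((- 1) ^ q :: int)"
        unfolding bar_group_def
        by (rule sum_group_component_int_pow[OF group_ob s(1)]) (use I in \<open>simp add: bar_group_def\<close>)
      then show ?thesis using s(1) by (simp add: bar_group_mult bar_internal_def)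
    qed
    from distinct_bar_index_short[OF s] show ?thesis
    proof (elim disjE conjE)
      assume q: "q = 0" and sc: "s \<in> {[Apex], [Minus], [Plus]}"
      have n0: "n = m - 1" by (simp add: n_def q)
      let ?R = "bar_chain m e (Suc 0)"
      have R: "?R [Apex, Apex] = \<one>\<^bsub>ch (ob D Apex) (m - 1)\<^esub>" "?R [Apex, Minus] = u" "?R [Apex, Plus] = v"
        "?R [Minus, Minus] = \<one>\<^bsub>ch (ob D Minus) (m - 1)\<^esub>" "?R [Plus, Plus] = \<one>\<^bsub>ch (ob D Plus) (m - 1)\<^esub>"
        by (simp_all add: bar_chain_def bar_index_1 e'(1))
      have R0: "bar_chain m e 0 [Apex] = a" "bar_chain m e 0 [Minus] = b" "bar_chain m e 0 [Plus] = c"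
        by (simp_all add: bar_chain_def bar_index_0 e'(1))
      have Rc: "?R \<in> carrier (bar_group D (Suc 0) (m - 1))" using r1 by (simp only: q n0)
      have "?F s = bar_face_sum D 0 (m - 1) ?R s" by (simp only: q n0)
      moreover have "bar_face_sum D 0 (m - 1) ?R [Apex] = inv\<^bsub>ch (ob D Apex) (m - 1)\<^esub> (u \<otimes>\<^bsub>ch (ob D Apex) (m - 1)\<^esub> v)"
        "bar_face_sum D 0 (m - 1) ?R [Minus] = mor D Apex Minus (m - 1) u"
        "bar_face_sum D 0 (m - 1) ?R [Plus] = mor D Apex Plus (m - 1) v"
        using e'(5,6) f[OF e'(5), of Minus] f[OF e'(6), of Plus] by (simp_all add: bar_face_sum_0[OF Rc] R)
      moreover have "bar_chain (m - 1) (bd tot m e) 0 [Apex] = bd (ob D Apex) m a \<otimes>\<^bsub>ch (ob D Apex) (m - 1)\<^esub> inv\<^bsub>ch (ob D Apex) (m - 1)\<^esub> (u \<otimes>\<^bsub>ch (ob D Apex) (m - 1)\<^esub> v)"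
        "bar_chain (m - 1) (bd tot m e) 0 [Minus] = bd (ob D Minus) m b \<otimes>\<^bsub>ch (ob D Minus) (m - 1)\<^esub> mor D Apex Minus (m - 1) u"
        "bar_chain (m - 1) (bd tot m e) 0 [Plus] = bd (ob D Plus) m c \<otimes>\<^bsub>ch (ob D Plus) (m - 1)\<^esub> mor D Apex Plus (m - 1) v"
        by (simp_all add: bar_chain_def span_total_def bar_index_0 e'(1))
      ultimately show ?thesis
        unfolding ys using sc e'(2-6) dA f[OF e'(5), of Minus] f[OF e'(6), of Plus]
        by (auto simp: q n0 R0 A1.m_comm B1.m_comm C1.m_comm)
    next
      assume q: "q = Suc 0" and sc: "s \<in> {[Apex, Minus], [Apex, Plus]}"
      have n0: "n = m - 2" by (simp add: n_def q)
      have "?F s = \<one>\<^bsub>ch (ob D Apex) n\<^esub>"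
        using bar_face_sum_1[OF r1[unfolded q] sc] by (simp add: q)
      then show ?thesis
        unfolding ys using sc e' dA
        by (auto simp: q n0 bar_chain_def span_total_def bar_index_1 A2.int_pow_neg A2.int_pow_1)
    qed
  qed
  then have "bar_degenerate D q n #>\<^bsub>bar_group D q n\<^esub> bar_chain (m - 1) (bd tot m e) q = bar_degenerate D q n #>\<^bsub>bar_group D q n\<^esub> ?y"
    using bar_coset_eq_iff[OF r y] by blast
  then show "to_bar (m - 1) (bd tot m e) q = bd (bar_realization D) m (to_bar m e) q"
    unfolding bar to_bar_def n(3) .
qed

lemma span_total_bar_realization: "cplx_iso tot (bar_realization D)"
  unfolding cplx_iso_def using to_bar_iso to_bar_bd by blast

lemma comm_bar_realization: "comm_group (ch (bar_realization D) m)"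
  by (simp add: bar_realization_def comm_group_sum_group norm_bar_group_comm)

end

section \<open>Transport into the sum type\<close>

lemma image_group_iso:
  assumes "inj \<iota>"
  shows "\<iota> \<in> iso G (image_group \<iota> G)"
proof -
  have "inj_on \<iota> (carrier G)" using assms by (rule inj_on_subset) simp
  then show ?thesis by (auto simp: iso_iff hom_def image_group_def)
qed

lemma comm_group_image_group:
  assumes \<iota>: "inj \<iota>" and G: "comm_group G"
  shows "comm_group (image_group \<iota> G)"
proof -
  interpret G: comm_group G by fact
  have "comm_group ((image_group \<iota> G) \<lparr>one := \<iota> \<one>\<^bsub>G\<^esub>\<rparr>)"
    by (rule G.iso_imp_img_comm_group[OF image_group_iso[OF \<iota>]])
  then show ?thesis by (simp add: image_group_def)
qed

lemma
  assumes \<iota>: "inj \<iota>" and C: "chain_complex C"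
  shows embed_cplx_iso: "\<iota> \<in> iso (ch C k) (ch (embed_cplx \<iota> C) k)"
    and embed_cplx_bd: "x \<in> carrier (ch C k) \<Longrightarrow> bd (embed_cplx \<iota> C) k (\<iota> x) = \<iota> (bd C k x)"
    and chain_complex_embed_cplx: "chain_complex (embed_cplx \<iota> C)"
proof -
  show iso: "\<iota> \<in> iso (ch C k) (ch (embed_cplx \<iota> C) k)" for k
    by (simp add: embed_cplx_def image_group_iso \<iota>)
  show bd: "bd (embed_cplx \<iota> C) k (\<iota> x) = \<iota> (bd C k x)" if "x \<in> carrier (ch C k)" for k x
    using that \<iota> by (simp add: embed_cplx_def inv_into_f_f inj_on_subset)
  have "cplx_iso C (embed_cplx \<iota> C)"
    unfolding cplx_iso_def by (intro exI[of _ "\<lambda>_. \<iota>"]) (simp add: iso bd)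
  moreover have "comm_group (ch (embed_cplx \<iota> C) k)" for k
    by (simp add: embed_cplx_def comm_group_image_group \<iota> chain_complexD(1)[OF C])
  ultimately show "chain_complex (embed_cplx \<iota> C)" using cplx_iso_chain_complex[OF C] by blast
qed

lemma embed_cplx_hom:
  assumes \<iota>: "inj \<iota>" "inj \<kappa>" and A: "chain_complex A" and B: "chain_complex B"
    and h: "h \<in> hom (ch A n) (ch B n)"
    and h': "\<And>x. x \<in> carrier (ch A n) \<Longrightarrow> h' (\<iota> x) = \<kappa> (h x)"
  shows "h' \<in> hom (ch (embed_cplx \<iota> A) n) (ch (embed_cplx \<kappa> B) n)"
proof (rule homI)
  note hA = iso_imp_homomorphism[OF embed_cplx_iso[OF \<iota>(1) A]] and hB = iso_imp_homomorphism[OF embed_cplx_iso[OF \<iota>(2) B]]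
  have car: "carrier (ch (embed_cplx \<iota> A) n) = \<iota> ` carrier (ch A n)"
    by (simp add: embed_cplx_def image_group_carrier)
  fix x assume "x \<in> carrier (ch (embed_cplx \<iota> A) n)"
  then obtain a where a: "a \<in> carrier (ch A n)" "x = \<iota> a" by (auto simp: car)
  then show "h' x \<in> carrier (ch (embed_cplx \<kappa> B) n)"
    using hom_in_carrier[OF hB hom_in_carrier[OF h]] by (simp add: h')
  fix y assume "y \<in> carrier (ch (embed_cplx \<iota> A) n)"
  then obtain b where b: "b \<in> carrier (ch A n)" "y = \<iota> b" by (auto simp: car)
  have "a \<otimes>\<^bsub>ch A n\<^esub> b \<in> carrier (ch A n)"
    using a b chain_complexD(4)[OF A, of n] by (simp add: group.is_monoid monoid.m_closed)
  then show "h' (x \<otimes>\<^bsub>ch (embed_cplx \<iota> A) n\<^esub> y) = h' x \<otimes>\<^bsub>ch (embed_cplx \<kappa> B) n\<^esub> h' y"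
    using a b hom_in_carrier[OF h] by (simp add: h' hom_mult[OF h] hom_mult[OF hB] flip: hom_mult[OF hA])
qed

text \<open>The diagram of a span embeds its three complexes into a sum type. Homomorphisms and sums of groups see nothing of the
embedding, so that the total complex of the span stays the same up to isomorphism.\<close>
lemma span_total_embed:
  assumes A: "chain_complex A" and B: "chain_complex B" and C: "chain_complex C"
    and f: "chain_map A B f" and g: "chain_map A C g"
    and \<iota>: "inj \<iota>" "inj \<kappa>" "inj \<mu>"
    and f': "\<And>k x. x \<in> carrier (ch A k) \<Longrightarrow> f' k (\<iota> x) = \<kappa> (f k x)"
    and g': "\<And>k x. x \<in> carrier (ch A k) \<Longrightarrow> g' k (\<iota> x) = \<mu> (g k x)"
  shows "cplx_iso (span_total A B C f g) (span_total (embed_cplx \<iota> A) (embed_cplx \<kappa> B) (embed_cplx \<mu> C) f' g')"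
proof -
  let ?A = "embed_cplx \<iota> A" and ?B = "embed_cplx \<kappa> B" and ?C = "embed_cplx \<mu> C"
  note iA = embed_cplx_iso[OF \<iota>(1) A] and iB = embed_cplx_iso[OF \<iota>(2) B] and iC = embed_cplx_iso[OF \<iota>(3) C]
  note hA = iso_imp_homomorphism[OF iA] and hB = iso_imp_homomorphism[OF iB] and hC = iso_imp_homomorphism[OF iC]
  let ?h = "\<lambda>(k::int) (a, b, c, u, v). (\<iota> a, \<kappa> b, \<mu> c, \<iota> u, \<iota> v)"
  show ?thesis
    unfolding cplx_iso_def
  proof (intro exI[of _ ?h] allI conjI ballI)
    fix k
    have "(\<lambda>(a, b, c, u, v). (\<iota> a, \<kappa> b, \<mu> c, \<iota> u, \<iota> v))
        = (\<lambda>(a, r). (\<iota> a, (\<lambda>(b, r). (\<kappa> b, (\<lambda>(c, r). (\<mu> c, (\<lambda>(u, v). (\<iota> u, \<iota> v)) r)) r)) r))"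
      by auto
    then show "?h k \<in> iso (ch (span_total A B C f g) k) (ch (span_total ?A ?B ?C f' g') k)"
      by (simp add: span_total_def iso_paired2 DirProd_group chain_complexD(4) A B C iA iB iC)
    fix x assume "x \<in> carrier (ch (span_total A B C f g) k)"
    then obtain a b c u v where x: "x = (a, b, c, u, v)" "a \<in> carrier (ch A k)" "b \<in> carrier (ch B k)"
      "c \<in> carrier (ch C k)" "u \<in> carrier (ch A (k - 1))" "v \<in> carrier (ch A (k - 1))"
      by (auto simp: span_total_def)
    have inv: "\<iota> (inv\<^bsub>ch A n\<^esub> y) = inv\<^bsub>ch ?A n\<^esub> \<iota> y" if "y \<in> carrier (ch A n)" for n y
    proof -
      interpret group_hom "ch A n" "ch ?A n" \<iota>
        using hA chain_complexD(4)[OF A] chain_complexD(4)[OF chain_complex_embed_cplx[OF \<iota>(1) A]]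
        by (simp add: group_hom_def group_hom_axioms_def)
      show ?thesis using that by simp
    qed
    have cl: "y \<otimes>\<^bsub>ch A n\<^esub> z \<in> carrier (ch A n)" "inv\<^bsub>ch A n\<^esub> y \<in> carrier (ch A n)"
      if "y \<in> carrier (ch A n)" "z \<in> carrier (ch A n)" for n y z
      using that chain_complexD(4)[OF A, of n] by (simp_all add: group.is_monoid monoid.m_closed group.inv_closed)
    have d: "bd A k a \<in> carrier (ch A (k - 1))" "bd B k b \<in> carrier (ch B (k - 1))" "bd C k c \<in> carrier (ch C (k - 1))"
      "bd A (k - 1) u \<in> carrier (ch A (k - 2))" "bd A (k - 1) v \<in> carrier (ch A (k - 2))"
      "f (k - 1) u \<in> carrier (ch B (k - 1))" "g (k - 1) v \<in> carrier (ch C (k - 1))"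
      using x f g hom_in_carrier[OF chain_complexD(2)[OF A, of k]] hom_in_carrier[OF chain_complexD(2)[OF B, of k]]
        hom_in_carrier[OF chain_complexD(2)[OF C, of k]] hom_in_carrier[OF chain_complexD(2)[OF A, of "k - 1"]]
      by (auto simp: chain_map_def intro: hom_in_carrier)
    show "?h (k - 1) (bd (span_total A B C f g) k x) = bd (span_total ?A ?B ?C f' g') k (?h k x)"
      using x d
      by (simp add: span_total_def embed_cplx_bd[OF \<iota>(1) A] embed_cplx_bd[OF \<iota>(2) B] embed_cplx_bd[OF \<iota>(3) C]
          hom_mult[OF hA] hom_mult[OF hB] hom_mult[OF hC] inv cl f' g')
  qed
qed

lemma span_shaped_span_diagram:
  assumes A: "chain_complex A" and B: "chain_complex B" and C: "chain_complex C"
    and f: "chain_map A B f" and g: "chain_map A C g"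
  shows "span_shaped (span_diagram A B C f g)"
proof
  have inj: "inj (Inl :: 'a \<Rightarrow> 'a + 'b + 'c)" "inj (Inr \<circ> Inl :: 'b \<Rightarrow> 'a + 'b + 'c)" "inj (Inr \<circ> Inr :: 'c \<Rightarrow> 'a + 'b + 'c)"
    by (auto intro!: injI)
  fix i j n
  show "chain_complex (ob (span_diagram A B C f g) i)"
    using chain_complex_embed_cplx[OF inj(1) A] chain_complex_embed_cplx[OF inj(2) B] chain_complex_embed_cplx[OF inj(3) C]
    by (cases i) (simp_all add: span_diagram_def)
  show "mor (span_diagram A B C f g) i i n = id"
    by (cases i) (simp_all add: span_diagram_def)
  have fh: "f n \<in> hom (ch A n) (ch B n)" and gh: "g n \<in> hom (ch A n) (ch C n)"
    using f g by (auto simp: chain_map_def)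
  have fm: "Inr \<circ> Inl \<circ> f n \<circ> projl \<in> hom (ch (embed_cplx (Inl :: 'a \<Rightarrow> 'a + 'b + 'c) A) n) (ch (embed_cplx (Inr \<circ> Inl :: 'b \<Rightarrow> 'a + 'b + 'c) B) n)"
    by (rule embed_cplx_hom[OF inj(1,2) A B fh]) simp
  have gm: "Inr \<circ> Inr \<circ> g n \<circ> projl \<in> hom (ch (embed_cplx (Inl :: 'a \<Rightarrow> 'a + 'b + 'c) A) n) (ch (embed_cplx (Inr \<circ> Inr :: 'c \<Rightarrow> 'a + 'b + 'c) C) n)"
    by (rule embed_cplx_hom[OF inj(1,3) A C gh]) simp
  assume "i \<le> j"
  then show "mor (span_diagram A B C f g) i j n \<in> hom (ch (ob (span_diagram A B C f g) i) n) (ch (ob (span_diagram A B C f g) j) n)"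
    using fm gm by (cases i; cases j) (auto simp: span_diagram_def less_eq_span_obj_def iso_imp_homomorphism[OF id_iso])
qed

section \<open>The decomposition\<close>
theorem bar_realization_span_decomposition:
  assumes A: "chain_complex A" and B: "chain_complex B" and C: "chain_complex C"
    and f: "chain_map A B f" and g: "chain_map A C g"
  defines "Bar \<equiv> bar_realization (span_diagram A B C f g)"
    and "Cone \<equiv> mapping_cone A (cplx_sum B C) (pair_map f (neg_map C g))"
  shows "chain_complex Bar" and "cplx_iso (cplx_sum Cone (path_cplx A)) Bar"
proof -
  let ?D = "span_diagram A B C f g"
  interpret span_shaped ?D by (rule span_shaped_span_diagram) fact+
  have inj: "inj (Inl :: 'a \<Rightarrow> 'a + 'b + 'c)" "inj (Inr \<circ> Inl :: 'b \<Rightarrow> 'a + 'b + 'c)" "inj (Inr \<circ> Inr :: 'c \<Rightarrow> 'a + 'b + 'c)"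
    by (auto intro!: injI)
  have "cplx_iso (span_total A B C f g) (span_total (ob ?D Apex) (ob ?D Minus) (ob ?D Plus) (mor ?D Apex Minus) (mor ?D Apex Plus))"
    unfolding span_diagram_def diagram.simps span_obj.case prod.case
    by (rule span_total_embed[OF A B C f g inj]) simp_all
  then have bar: "cplx_iso (span_total A B C f g) Bar"
    unfolding Bar_def by (rule cplx_iso_trans[OF _ span_total_bar_realization])
  have cone: "cplx_iso (span_total A B C f g) (cplx_sum Cone (path_cplx A))"
    unfolding Cone_def by (rule span_total_decomposition[OF A B C f g])
  have cc: "chain_complex (cplx_sum Cone (path_cplx A))"
    unfolding Cone_def
    by (intro chain_complex_cplx_sum chain_complex_mapping_cone chain_complex_path_cplx chain_map_pair_neg A B C f g)
  have "cplx_iso (cplx_sum Cone (path_cplx A)) (span_total A B C f g)"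
  proof (rule cplx_iso_sym[OF _ _ cone])
    fix k
    show "group (ch (span_total A B C f g) k)"
      by (simp add: span_total_def DirProd_group chain_complexD A B C)
    fix x assume x: "x \<in> carrier (ch (span_total A B C f g) k)"
    show "bd (span_total A B C f g) k x \<in> carrier (ch (span_total A B C f g) (k - 1))"
      by (rule span_total_bd_closed[OF A B C _ _ x]) (use f g in \<open>simp_all add: chain_map_def\<close>)
  qed
  then show iso: "cplx_iso (cplx_sum Cone (path_cplx A)) Bar"
    using bar by (rule cplx_iso_trans)
  show "chain_complex Bar"
    unfolding Bar_def using cplx_iso_chain_complex[OF cc comm_bar_realization iso[unfolded Bar_def]] .
qed

theorem proposition11p6:
  fixes P :: "'p cell_complex" and Bm :: "'m cell_complex" and Bp :: "'q cell_complex"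
    and pm :: "'p \<Rightarrow> 'm" and pp :: "'p \<Rightarrow> 'q"
  assumes "finite_CW P" and "finite_CW Bm" and "finite_CW Bp"
    and "cellular_map P Bm pm" and "cellular_map P Bp pp"
  shows
    "let CP = cellular_chains P; Cm = cellular_chains Bm; Cp = cellular_chains Bp;
         fm = cellular_chain_map P Bm pm; fp = cellular_chain_map P Bp pp;
         Bar = bar_realization (span_diagram CP Cm Cp fm fp);
         Cone = mapping_cone CP (cplx_sum Cm Cp) (pair_map fm (neg_map Cp fp));
         Extra = cplx_tensor CP (elementary_cplx 1)
     in bounded_free_complex CP \<and> bounded_free_complex Bar \<and> bounded_free_complex Cone \<and>
        cplx_iso Bar (cplx_sum Cone Extra) \<and>
        inventory CP = cell_inventory P \<and>
        inventory Bar = inventory Cone + (1 + fls_X) * inventory CP \<and>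
        (\<exists>ks :: int list. cplx_iso Extra (cplx_Sum {..<length ks} (\<lambda>i. elementary_cplx (ks ! i))))"
proof -
  define CP Cm Cp where "CP = cellular_chains P" and "Cm = cellular_chains Bm" and "Cp = cellular_chains Bp"
  define fm fp where "fm = cellular_chain_map P Bm pm" and "fp = cellular_chain_map P Bp pp"
  define Bar where "Bar = bar_realization (span_diagram CP Cm Cp fm fp)"
  define Cone where "Cone = mapping_cone CP (cplx_sum Cm Cp) (pair_map fm (neg_map Cp fp))"
  define Extra where "Extra = cplx_tensor CP (elementary_cplx 1)"
  have bf: "bounded_free_complex CP" "bounded_free_complex Cm" "bounded_free_complex Cp"
    unfolding CP_def Cm_def Cp_def by (rule bounded_free_cellular_chains, fact)+
  note cc = bf[THEN bounded_free_complexD(1)]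
  have fm: "chain_map CP Cm fm" and fp: "chain_map CP Cp fp"
    unfolding chain_map_def CP_def Cm_def Cp_def fm_def fp_def
    using cellular_chain_map_hom cellular_chain_map_bd[OF assms(4)] cellular_chain_map_bd[OF assms(5)] by blast+
  have bar: "chain_complex Bar" and iso: "cplx_iso (cplx_sum Cone (path_cplx CP)) Bar"
    unfolding Bar_def Cone_def by (rule bar_realization_span_decomposition[OF cc fm fp])+
  have cone: "bounded_free_complex Cone"
    unfolding Cone_def
    by (intro bounded_free_complex_mapping_cone bounded_free_complex_cplx_sum bf chain_map_pair_neg cc fm fp)
  have path: "bounded_free_complex (path_cplx CP)" by (rule bounded_free_complex_path_cplx[OF bf(1)])
  have sum: "bounded_free_complex (cplx_sum Cone (path_cplx CP))"
    by (rule bounded_free_complex_cplx_sum[OF cone path])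
  have ext: "cplx_iso (path_cplx CP) Extra"
    unfolding Extra_def by (rule cplx_tensor_elementary_path[OF cc(1)])
  have "bounded_free_complex Bar"
    by (rule bounded_free_complex_iso[OF sum bar cplx_iso_ch[OF iso]])
  moreover have "cplx_iso Bar (cplx_sum Cone Extra)"
    by (rule cplx_iso_trans[OF chain_complex_iso_sym[OF bounded_free_complexD(1)[OF sum] iso]
        cplx_iso_sum[OF bounded_free_complexD(1)[OF cone] bounded_free_complexD(1)[OF path] cplx_iso_refl ext]])
  moreover have "inventory Bar = inventory Cone + (1 + fls_X) * inventory CP"
    using inventory_iso[OF bounded_free_complexD(1)[OF sum] bounded_free_complexD(2)[OF sum] bar cplx_iso_ch[OF iso]]
    by (simp add: inventory_cplx_sum[OF cone path] inventory_path_cplx[OF bf(1)])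
  moreover have "\<exists>ks :: int list. cplx_iso Extra (cplx_Sum {..<length ks} (\<lambda>i. elementary_cplx (ks ! i)))"
    using path_cplx_elementary[OF bf(1)] cplx_iso_trans[OF chain_complex_iso_sym[OF bounded_free_complexD(1)[OF path] ext]]
    by metis
  moreover have "inventory CP = cell_inventory P"
    unfolding CP_def by (rule inventory_cellular_chains[OF assms(1)])
  ultimately show ?thesis
    unfolding Let_def CP_def[symmetric] Cm_def[symmetric] Cp_def[symmetric] fm_def[symmetric] fp_def[symmetric]
      Bar_def[symmetric] Cone_def[symmetric] Extra_def[symmetric]
    using bf(1) cone by blast
qed

end
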